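(* For each $N$ let $G$ be an $N\times N$ matrix from the complex induced Ginibre ensemble with rectangularity index $L=0$, and let $A$ be an $N\times N$ matrix from the complex Ginibre ensemble. Then, in the limit $N\to\infty$, the left tail of the distribution of the minimum modulus $r_{min}^{(N)}(G)$ corresponds to the left tail of the distribution of the minimum modulus $r_{min}^{(N)}(A)$; i.e., for $0<r\ll1$ (as $r\to0^+$), $$\lim_{N\to+\infty}P\left(r_{min}^{(N)}(G)<r\right)=1-e^{-r^{2}}+O(r^{4}).$$
   Context: The complex induced Ginibre ensemble with rectangularity index $L\ge0$ is the set of $N\times N$ complex matrices $G$ with density (with respect to Lebesgue measure on the entries) proportional to $\left(\det G^\dagger G\right)^{L}\exp\left(-\mathrm{Tr}\,G^\dagger G\right)$. The joint density of its eigenvalues $\lambda_1,\dots,\lambda_N\in\mathbb C$ is $\frac{1}{Z_N}\prod_{j<k}|\lambda_k-\lambda_j|^2\prod_{j=1}^N|\lambda_j|^{2L}\exp\left(-\sum_{j=1}^N|\lambda_j|^2\right)$ with $Z_N=N!\,\pi^N\prod_{k=1}^N\Gamma(k+L)$. The complex Ginibre ensemble is the set of $N\times N$ complex matrices with i.i.d. entries of density $\frac1\pi e^{-|w|^2}$ on $\mathbb C$. For a matrix $M$, $r_{min}^{(N)}(M)$ is the minimum of the moduli of its eigenvalues. The limiting left tail for the complex Ginibre ensemble is the Rayleigh one: $\lim_{N\to\infty}P(r_{min}^{(N)}(A)<r)=1-e^{-r^2}(1-O(r^4))$ as $r\to0^+$. *)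

theory Defs
  imports "HOL-Probability.Probability" "HOL-Library.Landau_Symbols"
    "Jordan_Normal_Form.Schur_Decomposition" "Jordan_Normal_Form.Spectral_Radius"
begin

(* Lebesgue measure on the entries: the product of the planar measures "lborel :: complex measure",
   carried to matrices along the entry map, which is injective on the underlying space because
   the functions in a product measure are extensional. *)
definition lborel_mat :: "nat \<Rightarrow> complex mat measure" where
  "lborel_mat N =
     embed_measure (Pi\<^sub>M ({..<N} \<times> {..<N}) (\<lambda>_. lborel :: complex measure)) (Matrix.mat N N)"

lemma inj_on_mat_entries:
  "inj_on (Matrix.mat N N) (space (Pi\<^sub>M ({..<N} \<times> {..<N}) (\<lambda>_. lborel :: complex measure)))"
proof (rule inj_onI)
  fix f g :: "nat \<times> nat \<Rightarrow> complex"
  assume f: "f \<in> space (Pi\<^sub>M ({..<N} \<times> {..<N}) (\<lambda>_. lborel))"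
    and g: "g \<in> space (Pi\<^sub>M ({..<N} \<times> {..<N}) (\<lambda>_. lborel))"
    and eq: "Matrix.mat N N f = Matrix.mat N N g"
  have "f p = g p" if in_dom: "p \<in> {..<N} \<times> {..<N}" for p
  proof -
    obtain i j where p: "p = (i, j)" "i < N" "j < N" using in_dom by (cases p) auto
    have "Matrix.mat N N f $$ (i, j) = Matrix.mat N N g $$ (i, j)" using eq by simp
    then show ?thesis using p by simp
  qed
  then show "f = g" using f g by (auto simp: space_PiM intro: PiE_ext)
qed

lemma space_lborel_mat: "space (lborel_mat N) = carrier_mat N N"
proof
  show "space (lborel_mat N) \<subseteq> carrier_mat N N"
    by (auto simp: lborel_mat_def space_embed_measure)
  show "carrier_mat N N \<subseteq> space (lborel_mat N)"
  proof
    fix A :: "complex mat" assume A: "A \<in> carrier_mat N N"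
    let ?f = "restrict (\<lambda>p. A $$ p) ({..<N} \<times> {..<N})"
    have "A = Matrix.mat N N ?f" using A by (intro eq_matI) auto
    moreover have "?f \<in> space (Pi\<^sub>M ({..<N} \<times> {..<N}) (\<lambda>_. lborel :: complex measure))"
      by (simp add: space_PiM)
    ultimately show "A \<in> space (lborel_mat N)"
      unfolding lborel_mat_def space_embed_measure by blast
  qed
qed

definition mat_trace :: "'a :: comm_monoid_add mat \<Rightarrow> 'a" where
  "mat_trace X = (\<Sum>i<dim_row X. X $$ (i, i))"

(* The determinant and the trace of X\<dagger>X are nonnegative reals, so Re only changes the type.
   Since 0 powr 0 = 0, for L = 0 the first factor is 1 off the null set of singular matrices
   and 0 on it. *)
definition induced_ginibre_weight :: "real \<Rightarrow> complex mat \<Rightarrow> real" where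
  "induced_ginibre_weight L X =
     Re (Determinant.det (mat_adjoint X * X)) powr L * exp (- Re (mat_trace (mat_adjoint X * X)))"

definition induced_ginibre :: "'a measure \<Rightarrow> nat \<Rightarrow> real \<Rightarrow> ('a \<Rightarrow> complex mat) \<Rightarrow> bool" where
  "induced_ginibre M N L G \<longleftrightarrow> prob_space M \<and> L \<ge> 0 \<and>
     (\<exists>c>0. distributed M (lborel_mat N) G (\<lambda>X. ennreal (c * induced_ginibre_weight L X)))"

definition ginibre :: "'a measure \<Rightarrow> nat \<Rightarrow> ('a \<Rightarrow> complex mat) \<Rightarrow> bool" where
  "ginibre M N A \<longleftrightarrow> prob_space M \<and> A \<in> space M \<rightarrow> carrier_mat N N \<and>
     prob_space.indep_vars M (\<lambda>_. borel) (\<lambda>(i, j) \<omega>. A \<omega> $$ (i, j)) ({..<N} \<times> {..<N}) \<and>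
     (\<forall>i<N. \<forall>j<N. distributed M lborel (\<lambda>\<omega>. A \<omega> $$ (i, j))
        (\<lambda>w. ennreal (exp (- (cmod w)\<^sup>2) / pi)))"

definition r_min :: "complex mat \<Rightarrow> real" where
  "r_min X = Min (cmod ` spectrum X)"

end

(* Peeling off one eigenvalue at a time turns Gaussian integrals over matrices into integrals over
   the spectrum.  Write an (N+1) x (N+1) matrix as X = [D c; b a].  For generic D, b, c the corner
   entry is a rational function a = q(l)/p(l) of degree N+1 of the eigenvalue l of X, where p is the
   characteristic polynomial of D, so by the area formula integration over a becomes integration
   over l with weight |chi_X'(l)/p(l)|^2.  The column is c = (l - D) v for the eigenvector (v, 1), and
   a Householder reflection deflates X to an N x N matrix M with chi_X = (x - l) chi_M.  Hence
     int prod_j |chi_X(l_j)|^2 1(no eigenvalue in B) exp(-|X|^2) dX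
   equals a constant times the integral over l outside B of exp(-|l|^2) prod_j |l - l_j|^2 times the
   same expression for M with l added to the list of the l_j.  Iterating yields the squared
   Vandermonde determinant, and for a disc B of radius r the orthogonality of monomials gives
     P(r_min >= r) = prod_(k<N) m_k(r)/m_k(0),  m_k(r) = int_(|z|>=r) |z|^(2k) exp(-|z|^2) dz,
   for both ensembles.  This product decreases in N; its factor k = 0 is exp(-r^2) + O(r^4) and the
   remaining factors contribute O(r^4) in total. *)
theory Submission
  imports Defs "HOL-Complex_Analysis.Conformal_Mappings"
begin

section \<open>Lebesgue measure on finite families of complex numbers\<close>

text \<open>The joint density of the eigenvalues is not derived from one global change of variables
  over a unitary group. Each step needs only a one-variable area formula and linear substitutions,
  so Lebesgue measure on finite powers of the plane is the only measure involved.

  The weight carries a list of marked points because the Jacobian |chi_X'(l)|^2 turns into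
  |chi_M(l)|^2 after deflation, that is, into one more factor of the kind already present; with
  arbitrary lists the induction on N closes. The row that survives deflation enters only through the
  norm and integrates out.

  Constants are hardly tracked: conjugation contributes an unknown Haar factor, and everything
  independent of r and of the list is collected in one constant for each N. Comparison with r = 0,
  where the integral is a full Gaussian, eliminates it.

  Since r tends to 0 after N tends to infinity, the error bound must be uniform in N. It rests on a
  lower bound for m_k(0) independent of k and on m_k(0) - m_k(r) being of order r^(2k+2), so that
  the terms with k at least 1 sum to O(r^4).\<close>

abbreviation lebesgue_fun :: "'i set \<Rightarrow> ('i \<Rightarrow> complex) measure" where
  "lebesgue_fun I \<equiv> Pi\<^sub>M I (\<lambda>_. lborel :: complex measure)"

interpretation lborel_prod: product_sigma_finite "\<lambda>_ :: 'i. lborel :: complex measure"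
  by standard

lemma sigma_finite_lebesgue_fun: "finite I \<Longrightarrow> sigma_finite_measure (lebesgue_fun I)"
  by (rule lborel_prod.sigma_finite)

lemma pair_sigma_finite_lebesgue_fun:
  "finite I \<Longrightarrow> finite J \<Longrightarrow> pair_sigma_finite (lebesgue_fun I) (lebesgue_fun J)"
  by (simp add: pair_sigma_finite.intro sigma_finite_lebesgue_fun)

text \<open>Restricting to \<open>I\<close> keeps the sum extensional, so it stays in the space of
  the product measure.\<close>

definition fun_add :: "'i set \<Rightarrow> ('i \<Rightarrow> complex) \<Rightarrow> ('i \<Rightarrow> complex) \<Rightarrow> 'i \<Rightarrow> complex" where
  "fun_add I x y = (\<lambda>i\<in>I. x i + y i)"

lemma fun_add_measurable [measurable (raw)]:
  assumes [measurable]: "f \<in> M \<rightarrow>\<^sub>M lebesgue_fun I" "g \<in> M \<rightarrow>\<^sub>M lebesgue_fun I"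
  shows "(\<lambda>x. fun_add I (f x) (g x)) \<in> M \<rightarrow>\<^sub>M lebesgue_fun I"
  unfolding fun_add_def
proof (rule measurable_restrict)
  fix i assume i: "i \<in> I"
  have [measurable]: "(\<lambda>x. f x i) \<in> borel_measurable M" "(\<lambda>x. g x i) \<in> borel_measurable M"
    using measurable_compose[OF assms(1) measurable_component_singleton[OF i]]
      measurable_compose[OF assms(2) measurable_component_singleton[OF i]] by auto
  show "(\<lambda>x. f x i + g x i) \<in> M \<rightarrow>\<^sub>M lborel" by measurable
qed

lemma fun_add_commute: "fun_add I x y = fun_add I y x"
  by (auto simp: fun_add_def add.commute)

lemma nn_integral_lborel_translate:
  fixes c :: complex
  assumes [measurable]: "f \<in> borel_measurable borel"
  shows "(\<integral>\<^sup>+x. f (x + c) \<partial>lborel) = (\<integral>\<^sup>+x. f x \<partial>lborel)"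
proof -
  have "(\<integral>\<^sup>+x. f x \<partial>lborel) = (\<integral>\<^sup>+x. f x \<partial>distr lborel borel ((+) c))"
    by (simp add: lborel_distr_plus)
  also have "\<dots> = (\<integral>\<^sup>+x. f (c + x) \<partial>lborel)"
    by (subst nn_integral_distr) auto
  finally show ?thesis by (simp add: add.commute)
qed

text \<open>Induction over the coordinates: Tonelli separates the new coordinate, the induction
  hypothesis absorbs the shift of the others, and translation invariance in the plane absorbs the
  shift of the new one.\<close>

lemma nn_integral_lebesgue_fun_translate:
  assumes "finite I" "y \<in> space (lebesgue_fun I)" "f \<in> borel_measurable (lebesgue_fun I)"
  shows "(\<integral>\<^sup>+x. f (fun_add I x y) \<partial>lebesgue_fun I) = (\<integral>\<^sup>+x. f x \<partial>lebesgue_fun I)"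
  using assms
proof (induction I arbitrary: f y rule: finite_induct)
  case empty
  then show ?case
    by (intro nn_integral_cong) (auto simp: space_PiM fun_add_def)
next
  case (insert i I)
  note [measurable] = insert.prems(2)
  \<comment> \<open>The shift \<open>y\<close> lives over \<open>insert i I\<close>; its restriction
    is the shift for the induction hypothesis.\<close>
  have y': "restrict y I \<in> space (lebesgue_fun I)" by (auto simp: space_PiM)
  have [measurable]: "(\<lambda>x. fun_add (insert i I) x y) \<in> lebesgue_fun (insert i I) \<rightarrow>\<^sub>M lebesgue_fun (insert i I)"
    unfolding fun_add_def by measurable
  have eq: "fun_add (insert i I) (x(i := t)) y = (fun_add I x (restrict y I))(i := t + y i)" for x t
    using insert.hyps by (auto simp: fun_add_def fun_eq_iff)
  have "(\<integral>\<^sup>+x. f (fun_add (insert i I) x y) \<partial>lebesgue_fun (insert i I))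
      = (\<integral>\<^sup>+t. \<integral>\<^sup>+x. f (fun_add (insert i I) (x(i := t)) y) \<partial>lebesgue_fun I \<partial>lborel)"
    using insert.hyps by (intro lborel_prod.product_nn_integral_insert_rev) auto
  also have "\<dots> = (\<integral>\<^sup>+t. \<integral>\<^sup>+x. f (x(i := t + y i)) \<partial>lebesgue_fun I \<partial>lborel)"
  proof (rule nn_integral_cong)
    fix t :: complex
    have "(\<lambda>x. x(i := t + y i)) \<in> lebesgue_fun I \<rightarrow>\<^sub>M lebesgue_fun (insert i I)"
      by (rule measurable_fun_upd[where J = I]) auto
    then have "(\<lambda>x. f (x(i := t + y i))) \<in> borel_measurable (lebesgue_fun I)" by measurable
    from insert.IH[OF y' this]
    show "(\<integral>\<^sup>+x. f (fun_add (insert i I) (x(i := t)) y) \<partial>lebesgue_fun I)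
        = (\<integral>\<^sup>+x. f (x(i := t + y i)) \<partial>lebesgue_fun I)"
      unfolding eq .
  qed
  also have "\<dots> = (\<integral>\<^sup>+t. \<integral>\<^sup>+x. f (x(i := t)) \<partial>lebesgue_fun I \<partial>lborel)"
  proof (rule nn_integral_lborel_translate)
    interpret I: sigma_finite_measure "lebesgue_fun I"
      by (rule sigma_finite_lebesgue_fun[OF insert.hyps(1)])
    show "(\<lambda>t. \<integral>\<^sup>+x. f (x(i := t)) \<partial>lebesgue_fun I) \<in> borel_measurable borel"
      by measurable
  qed
  also have "\<dots> = (\<integral>\<^sup>+x. f x \<partial>lebesgue_fun (insert i I))"
    using insert.hyps by (intro lborel_prod.product_nn_integral_insert_rev[symmetric]) auto
  finally show ?case .
qed

lemma unit_square_emeasure: "emeasure lborel (cbox 0 (Complex 1 1)) = 1"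
  by (subst emeasure_lborel_cbox) (auto simp: Basis_complex_def)

(* Uniqueness of Haar measure for an additive bijection f: for a bump function p with integral 1,
   G = G * p in the mean, and Fubini together with translation invariance gives the scaling factor
   as the integral of p(-f z). *)
lemma nn_integral_lebesgue_fun_additive:
  assumes fin: "finite I" and f[measurable]: "f \<in> lebesgue_fun I \<rightarrow>\<^sub>M lebesgue_fun I"
    and add: "\<And>x y. x \<in> space (lebesgue_fun I) \<Longrightarrow> y \<in> space (lebesgue_fun I) \<Longrightarrow>
          f (fun_add I x y) = fun_add I (f x) (f y)"
    and surj: "space (lebesgue_fun I) \<subseteq> f ` space (lebesgue_fun I)"
  shows "\<exists>\<kappa>. \<forall>G \<in> borel_measurable (lebesgue_fun I).
      (\<integral>\<^sup>+z. G (f z) \<partial>lebesgue_fun I) = \<kappa> * (\<integral>\<^sup>+z. G z \<partial>lebesgue_fun I)"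
proof -
  let ?M = "lebesgue_fun I"
  interpret sigma_finite_measure ?M using fin by (rule sigma_finite_lebesgue_fun)
  interpret P: pair_sigma_finite ?M ?M using fin by (rule pair_sigma_finite_lebesgue_fun) fact
  define p :: "('a \<Rightarrow> complex) \<Rightarrow> ennreal" where "p = indicator (Pi\<^sub>E I (\<lambda>_. cbox 0 (Complex 1 1)))"
  have [measurable]: "p \<in> borel_measurable ?M" unfolding p_def using fin by measurable
  have p1: "(\<integral>\<^sup>+w. p w \<partial>?M) = 1"
    unfolding p_def using fin by (simp add: lborel_prod.emeasure_PiM unit_square_emeasure)
  define neg where "neg x = (\<lambda>i\<in>I. - x i)" for x :: "'a \<Rightarrow> complex"
  have neg_sp: "neg x \<in> space ?M" for x by (auto simp: neg_def space_PiM)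
  have [measurable]: "neg \<in> ?M \<rightarrow>\<^sub>M ?M" unfolding neg_def by measurable
  define \<kappa> where "\<kappa> = (\<integral>\<^sup>+z. p (neg (f z)) \<partial>?M)"
  have fsp: "f x \<in> space ?M" if "x \<in> space ?M" for x using measurable_space[OF f that] .
  have cancel: "fun_add I (fun_add I w (neg a)) a = w" if "w \<in> space ?M" for w a
    using that by (auto simp: fun_add_def neg_def space_PiM PiE_def extensional_def fun_eq_iff)
  have "(\<integral>\<^sup>+z. G (f z) \<partial>?M) = \<kappa> * (\<integral>\<^sup>+z. G z \<partial>?M)"
    if G[measurable]: "G \<in> borel_measurable ?M" for G
  proof -
    have "(\<integral>\<^sup>+z. G (f z) \<partial>?M) = (\<integral>\<^sup>+w. p w * (\<integral>\<^sup>+z. G (f z) \<partial>?M) \<partial>?M)"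
      by (simp add: nn_integral_multc p1)
    also have "\<dots> = (\<integral>\<^sup>+w. p w * (\<integral>\<^sup>+z. G (fun_add I (f z) w) \<partial>?M) \<partial>?M)"
    proof (rule nn_integral_cong)
      fix w assume w: "w \<in> space ?M"
      \<comment> \<open>Surjectivity and additivity turn a shift by \<open>w\<close> after
        \<open>f\<close> into a shift by \<open>u\<close> before \<open>f\<close>, which translation
        invariance removes.\<close>
      then obtain u where u: "u \<in> space ?M" "f u = w" using surj by auto
      have "(\<integral>\<^sup>+z. G (f z) \<partial>?M) = (\<integral>\<^sup>+z. G (f (fun_add I z u)) \<partial>?M)"
        using fin u by (intro nn_integral_lebesgue_fun_translate[symmetric]) auto
      also have "\<dots> = (\<integral>\<^sup>+z. G (fun_add I (f z) w) \<partial>?M)"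
        using u by (intro nn_integral_cong) (simp add: add)
      finally show "p w * (\<integral>\<^sup>+z. G (f z) \<partial>?M) = p w * (\<integral>\<^sup>+z. G (fun_add I (f z) w) \<partial>?M)" by simp
    qed
    also have "\<dots> = (\<integral>\<^sup>+w. \<integral>\<^sup>+z. p w * G (fun_add I (f z) w) \<partial>?M \<partial>?M)"
      by (intro nn_integral_cong nn_integral_cmult[symmetric]) measurable
    also have "\<dots> = (\<integral>\<^sup>+z. \<integral>\<^sup>+w. p w * G (fun_add I (f z) w) \<partial>?M \<partial>?M)"
      by (intro P.Fubini') measurable
    also have "\<dots> = (\<integral>\<^sup>+z. \<integral>\<^sup>+w. p (fun_add I w (neg (f z))) * G w \<partial>?M \<partial>?M)"
    proof (rule nn_integral_cong)
      fix z assume z: "z \<in> space ?M"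
      have "(\<integral>\<^sup>+w. p w * G (fun_add I (f z) w) \<partial>?M)
          = (\<integral>\<^sup>+w. p (fun_add I w (neg (f z))) * G (fun_add I (f z) (fun_add I w (neg (f z)))) \<partial>?M)"
        using fin neg_sp fsp[OF z] by (intro nn_integral_lebesgue_fun_translate[symmetric]) auto
      also have "\<dots> = (\<integral>\<^sup>+w. p (fun_add I w (neg (f z))) * G w \<partial>?M)"
        by (intro nn_integral_cong) (simp add: fun_add_commute[of _ "f z"] cancel)
      finally show "(\<integral>\<^sup>+w. p w * G (fun_add I (f z) w) \<partial>?M)
          = (\<integral>\<^sup>+w. p (fun_add I w (neg (f z))) * G w \<partial>?M)" .
    qed
    also have "\<dots> = (\<integral>\<^sup>+w. \<integral>\<^sup>+z. p (fun_add I w (neg (f z))) * G w \<partial>?M \<partial>?M)"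
      by (intro P.Fubini') measurable
    also have "\<dots> = (\<integral>\<^sup>+w. (\<integral>\<^sup>+z. p (fun_add I w (neg (f z))) \<partial>?M) * G w \<partial>?M)"
      by (intro nn_integral_cong nn_integral_multc) measurable
    also have "\<dots> = (\<integral>\<^sup>+w. \<kappa> * G w \<partial>?M)"
    proof (rule nn_integral_cong)
      fix w assume w: "w \<in> space ?M"
      then obtain u where u: "u \<in> space ?M" "f u = w" using surj by auto
      have "(\<integral>\<^sup>+z. p (fun_add I w (neg (f z))) \<partial>?M)
          = (\<integral>\<^sup>+z. p (fun_add I w (neg (f (fun_add I z u)))) \<partial>?M)"
        using fin u w by (intro nn_integral_lebesgue_fun_translate[symmetric]) auto
      also have "\<dots> = \<kappa>"
        unfolding \<kappa>_def
      proof (rule nn_integral_cong)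
        fix z assume "z \<in> space ?M"
        then have "fun_add I w (neg (f (fun_add I z u))) = neg (f z)"
          using u by (subst add) (auto simp: fun_add_def neg_def fun_eq_iff)
        then show "p (fun_add I w (neg (f (fun_add I z u)))) = p (neg (f z))" by simp
      qed
      finally show "(\<integral>\<^sup>+z. p (fun_add I w (neg (f z))) \<partial>?M) * G w = \<kappa> * G w" by simp
    qed
    also have "\<dots> = \<kappa> * (\<integral>\<^sup>+z. G z \<partial>?M)"
      by (intro nn_integral_cmult) measurable
    finally show ?thesis .
  qed
  then show ?thesis by blast
qed

section \<open>The area formula for rational functions\<close>

text \<open>The change of variables theorem with a Jacobian determinant speaks about
  \<open>real ^ 'n\<close>; this identification carries it to the complex plane.\<close>

definition vec_of_complex :: "complex \<Rightarrow> real ^ 2" where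
  "vec_of_complex z = vector [Re z, Im z]"

definition complex_of_vec :: "real ^ 2 \<Rightarrow> complex" where
  "complex_of_vec v = Complex (v $ 1) (v $ 2)"

lemma complex_of_vec_inverse [simp]: "vec_of_complex (complex_of_vec v) = v"
  by (simp add: vec_of_complex_def complex_of_vec_def Finite_Cartesian_Product.vec_eq_iff forall_2)

lemma vec_of_complex_inverse [simp]: "complex_of_vec (vec_of_complex z) = z"
  by (simp add: vec_of_complex_def complex_of_vec_def)

lemma bounded_linear_vec_of_complex: "bounded_linear vec_of_complex"
proof (rule linear_conv_bounded_linear[THEN iffD1], rule linearI)
  fix x y :: complex and r :: real
  show "vec_of_complex (x + y) = vec_of_complex x + vec_of_complex y"
    "vec_of_complex (r *\<^sub>R x) = r *\<^sub>R vec_of_complex x"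
    by (simp_all add: vec_of_complex_def Finite_Cartesian_Product.vec_eq_iff forall_2)
qed

lemma bounded_linear_complex_of_vec: "bounded_linear complex_of_vec"
proof (rule linear_conv_bounded_linear[THEN iffD1], rule linearI)
  fix x y :: "real^2" and r :: real
  show "complex_of_vec (x + y) = complex_of_vec x + complex_of_vec y"
    "complex_of_vec (r *\<^sub>R x) = r *\<^sub>R complex_of_vec x"
    by (simp_all add: complex_of_vec_def complex_eq_iff)
qed

lemma complex_of_vec_measurable [measurable]: "complex_of_vec \<in> borel_measurable borel"
  by (intro borel_measurable_continuous_onI linear_continuous_on bounded_linear_complex_of_vec)

lemma lborel_complex_of_vec: "(lborel :: complex measure) = distr (lborel :: (real^2) measure) borel complex_of_vec"
proof (rule lborel_eqI)
  fix l u :: complex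
  assume le: "\<And>b. b \<in> Basis \<Longrightarrow> l \<bullet> b \<le> u \<bullet> b"
  have "complex_of_vec -` box l u = box (vec_of_complex l) (vec_of_complex u)"
    by (auto simp: box_def Basis_complex_def complex_of_vec_def vec_of_complex_def Basis_vec_def
        inner_axis forall_2 cart_eq_inner_axis[symmetric])
  moreover have "(\<Prod>b\<in>Basis. (vec_of_complex u - vec_of_complex l) \<bullet> b) = (\<Prod>b\<in>Basis. (u - l) \<bullet> b)"
  proof -
    have "(Basis :: (real^2) set) = {axis 1 1, axis 2 1}" by (auto simp: Basis_vec_def UNIV_2)
    then have "(\<Prod>b\<in>Basis. (vec_of_complex u - vec_of_complex l) \<bullet> b)
        = (\<Prod>b\<in>{axis 1 1, axis 2 1}. (vec_of_complex u - vec_of_complex l) \<bullet> b)" by (simp only:)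
    also have "\<dots> = (\<Prod>b\<in>Basis. (u - l) \<bullet> b)"
      by (simp add: axis_eq_axis Basis_complex_def vec_of_complex_def inner_axis inner_diff_left)
    finally show ?thesis .
  qed
  moreover have "vec_of_complex l \<bullet> b \<le> vec_of_complex u \<bullet> b" if "b \<in> Basis" for b
    using that le[of 1] le[of \<i>] by (auto simp: Basis_vec_def UNIV_2 inner_axis vec_of_complex_def Basis_complex_def)
  ultimately show "emeasure (distr lborel borel complex_of_vec) (box l u) = ennreal (\<Prod>b\<in>Basis. (u - l) \<bullet> b)"
    by (subst emeasure_distr) (auto simp: emeasure_lborel_box)
qed auto

lemma nn_integral_complex_of_vec:
  assumes [measurable]: "f \<in> borel_measurable borel"
  shows "(\<integral>\<^sup>+z. f z \<partial>(lborel :: complex measure)) = (\<integral>\<^sup>+v. f (complex_of_vec v) \<partial>lborel)"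
  by (subst lborel_complex_of_vec, subst nn_integral_distr) auto

text \<open>In the real basis, multiplication by a + bi has the rows (a, -b) and (b, a), hence
  determinant a^2 + b^2. So |g'|^2 is the real Jacobian of a holomorphic map g.\<close>

lemma det_complex_mult:
  "Determinants.det (matrix (\<lambda>v. vec_of_complex (c * complex_of_vec v))) = (cmod c)\<^sup>2"
  unfolding cmod_power2
  by (simp add: det_2 matrix_def vec_of_complex_def complex_of_vec_def axis_def power2_eq_square)

text \<open>\<open>g\<close> has a holomorphic inverse on the open image of \<open>A\<close>.
  Extended by 0 it is a Borel function, and the image of \<open>B\<close> is the part of its
  preimage of \<open>B\<close> inside the image of \<open>A\<close>.\<close>

lemma borel_image_holomorphic_inj:
  assumes A: "open A" and g: "g holomorphic_on A" and inj: "inj_on g A"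
    and B: "B \<subseteq> A" "B \<in> sets borel"
  shows "g ` B \<in> sets borel"
proof -
  obtain h where h: "h holomorphic_on (g ` A)" "\<And>z. z \<in> A \<Longrightarrow> h (g z) = z"
    using holomorphic_has_inverse[OF g A inj] by metis
  have op: "open (g ` A)" using open_mapping_thm3[OF g A inj] .
  have "(\<lambda>w. if w \<in> g ` A then h w else 0) \<in> borel_measurable borel"
    using op h(1) by (intro borel_measurable_continuous_on_if holomorphic_on_imp_continuous_on) auto
  from measurable_sets_borel[OF this B(2)]
  have "(\<lambda>w. if w \<in> g ` A then h w else 0) -` B \<inter> g ` A \<in> sets borel"
    using op by auto
  moreover have "(\<lambda>w. if w \<in> g ` A then h w else 0) -` B \<inter> g ` A = g ` B" using B(1) h(2) by force
  ultimately show ?thesis by simp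
qed

text \<open>The real change of variables for injective maps, with Jacobian |g'|^2. That theorem
  relates finite measures to integrable Jacobians, so the infinite case needs a separate
  argument.\<close>

lemma emeasure_image_holomorphic_inj:
  assumes A: "open A" and g: "g holomorphic_on A" and inj: "inj_on g A"
    and B: "B \<subseteq> A" "B \<in> sets borel"
  shows "emeasure lborel (g ` B) = (\<integral>\<^sup>+z. ennreal ((cmod (deriv g z))\<^sup>2) * indicator B z \<partial>lborel)"
proof -
  define S where "S = complex_of_vec -` B"
  define F where "F = (\<lambda>v. vec_of_complex (g (complex_of_vec v)))"
  define F' where "F' = (\<lambda>x v. vec_of_complex (deriv g (complex_of_vec x) * complex_of_vec v))"
  have [measurable]: "B \<in> sets borel" "S \<in> sets borel"
    using B unfolding S_def by (auto intro: measurable_sets_borel[OF complex_of_vec_measurable])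
  have gB[measurable]: "g ` B \<in> sets borel" using borel_image_holomorphic_inj[OF A g inj B] .
  have der: "(F has_derivative F' x) (at x within S)" if "x \<in> S" for x
  proof -
    have "(g has_field_derivative deriv g (complex_of_vec x)) (at (complex_of_vec x))"
      using that B(1) by (intro holomorphic_derivI[OF g A]) (auto simp: S_def)
    then have "(g has_derivative (\<lambda>h. deriv g (complex_of_vec x) * h)) (at (complex_of_vec x))"
      by (simp add: has_field_derivative_def)
    from has_derivative_compose[OF bounded_linear_imp_has_derivative[OF bounded_linear_complex_of_vec] this]
    show ?thesis unfolding F_def F'_def
      by (rule bounded_linear.has_derivative[OF bounded_linear_vec_of_complex])
  qed
  have injF: "inj_on F S"
    using inj B(1) unfolding inj_on_def F_def S_def
    by (metis complex_of_vec_inverse subsetD vec_of_complex_inverse vimageE)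
  have detF: "\<bar>Determinants.det (matrix (F' x))\<bar> = (cmod (deriv g (complex_of_vec x)))\<^sup>2" for x
    unfolding F'_def by (simp add: det_complex_mult)
  have FS: "F ` S = complex_of_vec -` (g ` B)"
  proof (intro subset_antisym subsetI)
    fix x assume "x \<in> complex_of_vec -` (g ` B)"
    then obtain b where b: "b \<in> B" "complex_of_vec x = g b" by auto
    then have "x = F (vec_of_complex b)" unfolding F_def by (metis vec_of_complex_inverse complex_of_vec_inverse)
    then show "x \<in> F ` S" using b by (auto simp: S_def)
  qed (auto simp: F_def S_def)
  have FSb[measurable]: "F ` S \<in> sets borel"
    unfolding FS by (auto intro: measurable_sets_borel[OF complex_of_vec_measurable])
  have key: "F ` S \<in> lmeasurable \<and> measure lebesgue (F ` S) = m \<longleftrightarrow>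
      ((\<lambda>x. (cmod (deriv g (complex_of_vec x)))\<^sup>2) has_integral m) S" for m
    using has_measure_differentiable_image[of S F F' m] der injF by (simp add: detF)
  \<comment> \<open>\<open>deriv g\<close> is controlled on \<open>A\<close> only; extension by 0
    makes it Borel on the whole plane.\<close>
  have "(\<lambda>z. if z \<in> A then deriv g z else 0) \<in> borel_measurable borel"
    using A g by (intro borel_measurable_continuous_on_if holomorphic_on_imp_continuous_on holomorphic_deriv) auto
  then have dm: "(\<lambda>z. (cmod (if z \<in> A then deriv g z else 0))\<^sup>2 * indicator B z) \<in> borel_measurable borel"
    by measurable
  have deq: "(cmod (if z \<in> A then deriv g z else 0))\<^sup>2 * indicator B z = (cmod (deriv g z))\<^sup>2 * indicator B z" for z
    using B(1) by (auto simp: indicator_def)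
  define d where "d z = (cmod (deriv g z))\<^sup>2 * indicator B z" for z
  have [measurable]: "d \<in> borel_measurable borel" using dm by (rule measurable_cong[THEN iffD1, rotated]) (simp only: d_def deq)
  have d0: "0 \<le> d z" for z by (simp add: d_def)
  have em: "emeasure lborel (g ` B) = emeasure lborel (F ` S)"
    by (subst lborel_complex_of_vec, subst emeasure_distr) (auto simp: FS)
  have rhs: "(\<integral>\<^sup>+z. ennreal ((cmod (deriv g z))\<^sup>2) * indicator B z \<partial>lborel) = (\<integral>\<^sup>+v. d (complex_of_vec v) \<partial>lborel)"
    by (subst nn_integral_complex_of_vec[of "\<lambda>z. ennreal (d z)", symmetric], measurable)
       (auto intro!: nn_integral_cong simp: d_def indicator_def)
  have dS: "d (complex_of_vec v) = (if v \<in> S then (cmod (deriv g (complex_of_vec v)))\<^sup>2 else 0)" for v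
    by (auto simp: d_def S_def)
  have fin1: "emeasure lborel (F ` S) = (\<integral>\<^sup>+v. d (complex_of_vec v) \<partial>lborel)"
    if "((\<lambda>x. (cmod (deriv g (complex_of_vec x)))\<^sup>2) has_integral m) S" for m
  proof -
    have hi: "((\<lambda>v. d (complex_of_vec v)) has_integral m) UNIV"
      using that unfolding dS by (simp add: has_integral_restrict_UNIV)
    have "(\<integral>\<^sup>+v. d (complex_of_vec v) \<partial>lborel) = ennreal m"
      using hi by (intro nn_integral_has_integral_lborel) (auto simp: d0)
    moreover have "emeasure lborel (F ` S) = ennreal m"
    proof -
      have "F ` S \<in> lmeasurable" "measure lebesgue (F ` S) = m" using key that by auto
      then have "emeasure lebesgue (F ` S) = ennreal m" by (simp add: emeasure_eq_measure2 fmeasurableD2)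
      then show ?thesis by simp
    qed
    ultimately show ?thesis by simp
  qed
  show ?thesis
  proof (cases "(\<integral>\<^sup>+v. d (complex_of_vec v) \<partial>lborel) < \<infinity>")
    case True
    then have "(\<lambda>v. d (complex_of_vec v)) integrable_on UNIV"
      by (intro nn_integral_integrable_on) (auto simp: d0)
    then obtain m where "((\<lambda>x. (cmod (deriv g (complex_of_vec x)))\<^sup>2) has_integral m) S"
      unfolding dS by (auto simp: integrable_on_def has_integral_restrict_UNIV)
    then show ?thesis using fin1 em rhs by simp
  next
    case False
    \<comment> \<open>If the image had finite measure, \<open>key\<close> would make the Jacobian
      integrable on \<open>S\<close>, contrary to the case assumption.\<close>
    have "emeasure lborel (F ` S) = \<infinity>"
    proof (rule ccontr)
      assume "emeasure lborel (F ` S) \<noteq> \<infinity>"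
      then have "F ` S \<in> lmeasurable"
        by (intro fmeasurableI) (auto simp: less_top[symmetric])
      then show False using key fin1 False \<open>emeasure lborel (F ` S) \<noteq> \<infinity>\<close> by (metis less_top infinity_ennreal_def)
    qed
    then show ?thesis using False em rhs by (simp add: less_top[symmetric])
  qed
qed

text \<open>Two measures agree: the image under \<open>g\<close> of Lebesgue measure weighted by
  |g'|^2 on \<open>B\<close>, and Lebesgue measure restricted to the image of \<open>B\<close>. On a
  Borel set this is the area formula for a smaller \<open>B\<close>; integrating \<open>F\<close>
  against both gives the claim.\<close>

lemma nn_integral_holomorphic_inj:
  assumes A: "open A" and g: "g holomorphic_on A" and inj: "inj_on g A"
    and B: "B \<subseteq> A" "B \<in> sets borel" and F[measurable]: "F \<in> borel_measurable borel"
  shows "(\<integral>\<^sup>+z. ennreal ((cmod (deriv g z))\<^sup>2) * F (g z) * indicator B z \<partial>lborel)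
       = (\<integral>\<^sup>+w. F w * indicator (g ` B) w \<partial>lborel)"
proof -
  have [measurable]: "B \<in> sets borel" "g ` B \<in> sets borel"
    using B borel_image_holomorphic_inj[OF A g inj B] by auto
  define g0 where "g0 = (\<lambda>z. if z \<in> A then g z else 0)"
  have [measurable]: "g0 \<in> borel_measurable borel"
    unfolding g0_def using A g by (intro borel_measurable_continuous_on_if holomorphic_on_imp_continuous_on) auto
  define d where "d z = ennreal ((cmod (if z \<in> A then deriv g z else 0))\<^sup>2) * indicator B z" for z
  have "(\<lambda>z. if z \<in> A then deriv g z else 0) \<in> borel_measurable borel"
    using A g by (intro borel_measurable_continuous_on_if holomorphic_on_imp_continuous_on holomorphic_deriv) auto
  then have [measurable]: "d \<in> borel_measurable borel" unfolding d_def by measurable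
  have "distr (density lborel d) borel g0 = density lborel (indicator (g ` B))"
  proof (rule measure_eqI)
    fix C assume "C \<in> sets (distr (density lborel d) borel g0)"
    then have [measurable]: "C \<in> sets borel" by simp
    define B' where "B' = B \<inter> g0 -` C"
    have B': "B' \<subseteq> A" "B' \<in> sets borel" using B by (auto simp: B'_def intro: measurable_sets_borel)
    have "emeasure (distr (density lborel d) borel g0) C = (\<integral>\<^sup>+z. d z * indicator (g0 -` C) z \<partial>lborel)"
      by (subst emeasure_distr) (auto simp: emeasure_density measurable_sets_borel[of g0 borel])
    also have "\<dots> = (\<integral>\<^sup>+z. ennreal ((cmod (deriv g z))\<^sup>2) * indicator B' z \<partial>lborel)"
      using B(1) by (intro nn_integral_cong) (auto simp: d_def B'_def indicator_def)
    also have "\<dots> = emeasure lborel (g ` B')"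
      using emeasure_image_holomorphic_inj[OF A g inj B'] by simp
    also have "g ` B' = g ` B \<inter> C" using B(1) by (auto simp: B'_def g0_def)
    also have "emeasure lborel (g ` B \<inter> C) = emeasure (density lborel (indicator (g ` B))) C"
      by (subst emeasure_density) (auto simp: indicator_inter_arith[symmetric])
    finally show "emeasure (distr (density lborel d) borel g0) C = emeasure (density lborel (indicator (g ` B))) C" .
  qed simp
  then have "(\<integral>\<^sup>+w. F w \<partial>distr (density lborel d) borel g0) = (\<integral>\<^sup>+w. F w \<partial>density lborel (indicator (g ` B)))"
    by simp
  then have "(\<integral>\<^sup>+z. d z * F (g0 z) \<partial>lborel) = (\<integral>\<^sup>+w. indicator (g ` B) w * F w \<partial>lborel)"
    by (simp add: nn_integral_distr nn_integral_density)
  moreover have "d z * F (g0 z) = ennreal ((cmod (deriv g z))\<^sup>2) * F (g z) * indicator B z" for z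
    using B(1) by (auto simp: d_def g0_def indicator_def)
  ultimately show ?thesis by (simp add: mult.commute)
qed

lemma suminf_indicator_card:
  assumes "finite J"
  shows "(\<Sum>i. indicator J i :: ennreal) = of_nat (card J)"
  using assms by (subst suminf_finite[of J]) (auto simp: sum.If_cases)

text \<open>Where the derivative does not vanish, \<open>g\<close> is locally injective. Countably
  many such neighbourhoods cover \<open>V\<close> and can be made disjoint; summing the injective
  formula over the pieces counts each value as often as it is attained, which is \<open>n\<close>
  times almost everywhere.\<close>

lemma nn_integral_holomorphic_covering:
  assumes V: "open V" and g: "g holomorphic_on V" and nz: "\<And>z. z \<in> V \<Longrightarrow> deriv g z \<noteq> 0"
    and n: "AE a in lborel. card {z \<in> V. g z = a} = n" "n > 0"
    and F[measurable]: "F \<in> borel_measurable borel"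
  shows "(\<integral>\<^sup>+z. ennreal ((cmod (deriv g z))\<^sup>2) * F (g z) * indicator V z \<partial>lborel)
       = of_nat n * (\<integral>\<^sup>+a. F a \<partial>lborel)"
proof -
  define \<T> where "\<T> = {T. open T \<and> T \<subseteq> V \<and> inj_on g T}"
  have "\<exists>T. open T \<and> T \<subseteq> V \<and> inj_on g T \<and> z \<in> T" if "z \<in> V" for z
    using has_complex_derivative_locally_injective[OF g that V nz[OF that]]
    by (metis centre_in_ball open_ball)
  then have UT: "\<Union>\<T> = V" by (auto simp: \<T>_def)
  obtain \<T>' where T': "\<T>' \<subseteq> \<T>" "countable \<T>'" "\<Union>\<T>' = V"
    using Lindelof[of \<T>] UT by (metis (no_types, lifting) \<T>_def mem_Collect_eq)
  \<comment> \<open>Adding the empty set keeps the family nonempty even for empty \<open>V\<close>,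
    so it can be indexed by all naturals.\<close>
  define T where "T = from_nat_into (insert {} \<T>')"
  have rT: "range T = insert {} \<T>'"
    unfolding T_def using T'(2) by (intro range_from_nat_into) auto
  have T: "open (T i)" "T i \<subseteq> V" "inj_on g (T i)" for i
  proof -
    have "T i \<in> insert {} \<T>" using rT T'(1) by blast
    then show "open (T i)" "T i \<subseteq> V" "inj_on g (T i)" by (auto simp: \<T>_def)
  qed
  have UN: "(\<Union>i. T i) = V" using rT T'(3) by auto
  define B where "B = disjointed T"
  have B: "B i \<subseteq> T i" "B i \<in> sets borel" for i
  proof -
    show "B i \<subseteq> T i" by (auto simp: B_def disjointed_def)
    have "range (disjointed T) \<subseteq> sets borel"
      using T(1) by (intro sets.range_disjointed_sets) auto
    then show "B i \<in> sets borel" by (auto simp: B_def)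
  qed
  have Bdisj: "disjoint_family B" by (simp add: B_def disjoint_family_disjointed)
  have BV: "(\<Union>i. B i) = V" by (simp add: B_def UN_disjointed_eq UN)
  have gT: "g holomorphic_on T i" for i using g T(2) holomorphic_on_subset by blast
  have [measurable]: "g ` B i \<in> sets borel" "B i \<in> sets borel" for i
    using borel_image_holomorphic_inj[OF T(1) gT T(3) B] B(2) by auto
  define d where "d z = ennreal ((cmod (if z \<in> V then deriv g z else 0))\<^sup>2) * F (if z \<in> V then g z else 0)" for z
  have [measurable]: "(\<lambda>z. if z \<in> V then deriv g z else 0) \<in> borel_measurable borel"
     "(\<lambda>z. if z \<in> V then g z else 0) \<in> borel_measurable borel"
    using V g by (auto intro!: borel_measurable_continuous_on_if holomorphic_on_imp_continuous_on holomorphic_deriv)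
  have [measurable]: "d \<in> borel_measurable borel" unfolding d_def[abs_def] by measurable
  have "(\<integral>\<^sup>+z. ennreal ((cmod (deriv g z))\<^sup>2) * F (g z) * indicator V z \<partial>lborel)
      = (\<integral>\<^sup>+z. (\<Sum>i. d z * indicator (B i) z) \<partial>lborel)"
  proof (rule nn_integral_cong)
    fix z
    have "(\<Sum>i. d z * indicator (B i) z) = d z * (\<Sum>i. indicator (B i) z)" by (rule ennreal_suminf_cmult)
    also have "(\<Sum>i. indicator (B i) z :: ennreal) = indicator V z"
      using suminf_indicator[OF Bdisj] BV by simp
    finally show "ennreal ((cmod (deriv g z))\<^sup>2) * F (g z) * indicator V z = (\<Sum>i. d z * indicator (B i) z)"
      by (auto simp: d_def indicator_def)
  qed
  also have "\<dots> = (\<Sum>i. \<integral>\<^sup>+z. d z * indicator (B i) z \<partial>lborel)"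
    by (intro nn_integral_suminf) measurable
  also have "\<dots> = (\<Sum>i. \<integral>\<^sup>+w. F w * indicator (g ` B i) w \<partial>lborel)"
  proof (rule suminf_cong)
    fix i
    have "(\<integral>\<^sup>+z. d z * indicator (B i) z \<partial>lborel)
        = (\<integral>\<^sup>+z. ennreal ((cmod (deriv g z))\<^sup>2) * F (g z) * indicator (B i) z \<partial>lborel)"
      using BV by (intro nn_integral_cong) (auto simp: d_def indicator_def)
    also have "\<dots> = (\<integral>\<^sup>+w. F w * indicator (g ` B i) w \<partial>lborel)"
      using nn_integral_holomorphic_inj[OF T(1) gT T(3) B F] .
    finally show "(\<integral>\<^sup>+z. d z * indicator (B i) z \<partial>lborel) = (\<integral>\<^sup>+w. F w * indicator (g ` B i) w \<partial>lborel)" .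
  qed
  also have "\<dots> = (\<integral>\<^sup>+w. (\<Sum>i. F w * indicator (g ` B i) w) \<partial>lborel)"
    by (intro nn_integral_suminf[symmetric]) measurable
  also have "\<dots> = (\<integral>\<^sup>+w. of_nat n * F w \<partial>lborel)"
  proof (rule nn_integral_cong_AE)
    show "AE w in lborel. (\<Sum>i. F w * indicator (g ` B i) w) = of_nat n * F w"
      using n(1)
    proof eventually_elim
      case (elim w)
      let ?P = "{z \<in> V. g z = w}" and ?J = "{i. w \<in> g ` B i}"
      \<comment> \<open>An infinite fibre would have \<open>card\<close> 0, so \<open>n > 0\<close>
        yields finiteness.\<close>
      have fin: "finite ?P" using elim n(2) card_ge_0_finite by blast
      have ex: "\<exists>i. z \<in> B i" if "z \<in> ?P" for z using that BV by auto
      \<comment> \<open>The pieces are disjoint and \<open>g\<close> is injective on each of them,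
        so sending a preimage to its piece is a bijection from the fibre over \<open>w\<close> to
        the pieces whose image contains \<open>w\<close>.\<close>
      define ix where "ix z = (SOME i. z \<in> B i)" for z
      have ix: "z \<in> B (ix z)" if "z \<in> ?P" for z unfolding ix_def using someI_ex[OF ex[OF that]] .
      have "inj_on ix ?P"
      proof (rule inj_onI)
        fix x y assume xy: "x \<in> ?P" "y \<in> ?P" "ix x = ix y"
        then have "x \<in> T (ix x)" "y \<in> T (ix x)" using ix B(1) by (metis subsetD)+
        with T(3) xy show "x = y" by (auto simp: inj_on_def)
      qed
      moreover have "ix ` ?P = ?J"
      proof (intro subset_antisym subsetI)
        fix i assume "i \<in> ?J"
        then obtain z where z: "z \<in> B i" "w = g z" by auto
        then have zP: "z \<in> ?P" using BV by auto
        have "ix z = i"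
        proof (rule ccontr)
          assume "ix z \<noteq> i"
          then have "B (ix z) \<inter> B i = {}" using Bdisj by (auto simp: disjoint_family_on_def)
          then show False using ix[OF zP] z by auto
        qed
        then show "i \<in> ix ` ?P" using zP by blast
      qed (use ix in force)
      ultimately have "card ?J = card ?P" "finite ?J"
        using card_image[of ix ?P] finite_imageI[OF fin, of ix] by simp_all
      with elim have "card ?J = n" "finite ?J" by simp_all
      then have "(\<Sum>i. indicator ?J i :: ennreal) = of_nat n" using suminf_indicator_card by blast
      moreover have "indicator (g ` B i) w = (indicator ?J i :: ennreal)" for i by (auto simp: indicator_def)
      ultimately show ?case by (simp add: ennreal_suminf_cmult mult.commute)
    qed
  qed
  also have "\<dots> = of_nat n * (\<integral>\<^sup>+a. F a \<partial>lborel)" by (intro nn_integral_cmult) measurable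
  finally show ?thesis .
qed

text \<open>Induction with the fundamental theorem of algebra: if p = (x - a) q then p'(a) = q(a),
  so a simple root \<open>a\<close> is not a root of \<open>q\<close> and adds exactly one to the
  count.\<close>

lemma card_roots_eq_degree:
  fixes p :: "complex poly"
  assumes "\<And>z. poly p z = 0 \<Longrightarrow> poly (pderiv p) z \<noteq> 0" "p \<noteq> 0"
  shows "card {z. poly p z = 0} = degree p"
  using assms
proof (induction "degree p" arbitrary: p)
  case 0
  then obtain c where "p = [:c:]" using degree_eq_zeroE[of p] by metis
  with 0 show ?case by simp
next
  case (Suc n)
  have "\<not> constant (poly p)" using Suc.hyps(2) by (simp add: constant_degree)
  from Fundamental_Theorem_Algebra.fundamental_theorem_of_algebra[OF this]
  obtain a where a: "poly p a = 0" by blast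
  then obtain q where q: "p = [:-a, 1:] * q" by (metis dvdE poly_eq_0_iff_dvd)
  have q0: "q \<noteq> 0" using Suc.prems q by auto
  have pd: "pderiv p = [:-a, 1:] * pderiv q + q"     unfolding q by (simp only: pderiv_mult) (simp add: pderiv_pCons)
  have qa: "poly q a \<noteq> 0" using Suc.prems(1)[OF a] pd by simp
  have dq: "degree q = n" using Suc.hyps(2) q q0 by (simp add: degree_mult_eq del: mult_pCons_left)
  have "card {z. poly q z = 0} = degree q"
  proof (rule Suc.hyps(1))
    fix z assume z: "poly q z = 0"
    then have "poly (pderiv p) z \<noteq> 0" by (intro Suc.prems(1)) (simp add: q)
    then show "poly (pderiv q) z \<noteq> 0" using z pd by auto
  qed (use dq q0 in auto)
  moreover have "{z. poly p z = 0} = insert a {z. poly q z = 0}" unfolding q by auto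
  moreover have "finite {z. poly q z = 0}" using q0 poly_roots_finite by blast
  ultimately show ?case using qa dq Suc.hyps(2) by simp
qed

text \<open>The fibre of q/p over \<open>a\<close> is the root set of q - a p, of degree n + 1;
  coprimality keeps these roots away from the poles. They are simple unless \<open>a\<close> is one
  of the finitely many critical values, which form a null set. The derivative of q/p is written as
  (q' - a p')/p with a = q/p, because q - a p will be the characteristic polynomial with corner
  entry \<open>a\<close>.\<close>

lemma nn_integral_rational_covering:
  fixes p q :: "complex poly"
  assumes p: "lead_coeff p = 1" "degree p = n" and q: "lead_coeff q = 1" "degree q = Suc n"
    and cop: "\<And>z. poly p z = 0 \<Longrightarrow> poly q z \<noteq> 0"
    and F[measurable]: "F \<in> borel_measurable borel"
  shows "of_nat (Suc n) * (\<integral>\<^sup>+a. F a \<partial>lborel)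
    = (\<integral>\<^sup>+z. (if poly p z = 0 then 0 else
        ennreal ((cmod (poly (pderiv q) z - poly q z / poly p z * poly (pderiv p) z))\<^sup>2 / (cmod (poly p z))\<^sup>2)
          * F (poly q z / poly p z)) \<partial>lborel)"
proof -
  \<comment> \<open>The Wronskian: (q/p)' = r/p^2.\<close>
  define r where "r = pderiv q * p - q * pderiv p"
  define g where "g z = poly q z / poly p z" for z
  define V where "V = {z. poly p z \<noteq> 0 \<and> poly r z \<noteq> 0}"
  have p0: "p \<noteq> 0" and q0: "q \<noteq> 0" using p q by auto
  \<comment> \<open>The coefficient of x^(2n) in \<open>r\<close> is (n + 1) - n = 1.\<close>
  have r0: "r \<noteq> 0"
  proof -
    have "coeff (pderiv q * p) (n + n) = of_nat (Suc n)"
    proof -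
      have "degree (pderiv q) = n" using q by (simp add: degree_pderiv)
      then have "coeff (pderiv q * p) (n + n) = coeff (pderiv q) n * coeff p n"
        using coeff_mult_degree_sum[of "pderiv q" p] p by simp
      then show ?thesis using p q by (simp add: coeff_pderiv)
    qed
    moreover have "coeff (q * pderiv p) (n + n) = of_nat n"
    proof (cases n)
      case 0
      then have "pderiv p = 0" using p by (simp add: pderiv_eq_0_iff)
      then show ?thesis using 0 by simp
    next
      case (Suc m)
      have "degree (pderiv p) = m" using p Suc by (simp add: degree_pderiv)
      then have "coeff (q * pderiv p) (Suc n + m) = coeff q (Suc n) * coeff (pderiv p) m"
        using coeff_mult_degree_sum[of q "pderiv p"] q by simp
      then show ?thesis using p q Suc by (simp add: coeff_pderiv)
    qed
    ultimately have "coeff r (n + n) = 1" by (simp add: r_def)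
    then show ?thesis by auto
  qed
  have finp: "finite {z. poly p z = 0}" and finr: "finite {z. poly r z = 0}"
    using p0 r0 poly_roots_finite by auto
  have V: "open V"
  proof -
    have "closed ({z. poly p z = 0} \<union> {z. poly r z = 0})" using finp finr by (intro finite_imp_closed) auto
    moreover have "V = - ({z. poly p z = 0} \<union> {z. poly r z = 0})" by (auto simp: V_def)
    ultimately show ?thesis unfolding closed_def by (simp only: double_complement)
  qed
  have dg: "(g has_field_derivative (poly r z / (poly p z)\<^sup>2)) (at z)" if "poly p z \<noteq> 0" for z
    unfolding g_def r_def using that
    using DERIV_quotient[OF poly_DERIV[of q z] poly_DERIV[of p z] that] by (simp add: mult.commute power2_eq_square)
  have hol: "g holomorphic_on V"
    unfolding g_def by (intro holomorphic_intros) (auto simp: V_def)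
  have dgV: "deriv g z = poly r z / (poly p z)\<^sup>2" if "z \<in> V" for z
    using dg[of z] that by (intro DERIV_imp_deriv) (auto simp: V_def)
  have fin: "finite (g ` {z. poly r z = 0})" using finr by simp
  have AE: "AE a in lborel. card {z \<in> V. g z = a} = Suc n"
  proof (rule AE_I')
    show "g ` {z. poly r z = 0} \<in> null_sets lborel" using fin by (rule finite_imp_null_set_lborel)
    show "{a \<in> space lborel. card {z \<in> V. g z = a} \<noteq> Suc n} \<subseteq> g ` {z. poly r z = 0}"
    proof (rule subsetI, rule ccontr)
      fix a assume "a \<in> {a \<in> space lborel. card {z \<in> V. g z = a} \<noteq> Suc n}"
        and na: "a \<notin> g ` {z. poly r z = 0}"
      then have a: "card {z \<in> V. g z = a} \<noteq> Suc n" by simp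
      define s where "s = q - Polynomial.smult a p"
      have root: "poly s z = 0 \<longleftrightarrow> poly p z \<noteq> 0 \<and> g z = a" for z
      proof (cases "poly p z = 0")
        case True
        then show ?thesis using cop[of z] by (simp add: s_def)
      next
        case False
        then show ?thesis by (simp add: s_def g_def nonzero_divide_eq_eq)
      qed
      \<comment> \<open>Since \<open>a\<close> is not a critical value, no root of \<open>s\<close>
        is lost by restricting to \<open>V\<close>.\<close>
      have sV: "{z \<in> V. g z = a} = {z. poly s z = 0}"
        using na by (auto simp: root V_def)
      have "degree (- Polynomial.smult a p) < degree q" using degree_smult_le[of a p] p q by simp
      then have ds: "degree s = Suc n" unfolding s_def diff_conv_add_uminus q(2)[symmetric]
        by (rule degree_add_eq_left)
      have "card {z. poly s z = 0} = degree s"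
      proof (rule card_roots_eq_degree)
        fix z assume z: "poly s z = 0"
        then have pz: "poly p z \<noteq> 0" and gz: "g z = a" by (auto simp: root)
        have "poly r z \<noteq> 0" using na gz by auto
        moreover have "poly r z = poly (pderiv s) z * poly p z"
        proof -
          have qz: "poly q z = a * poly p z" using gz pz by (simp add: g_def nonzero_divide_eq_eq)
          show ?thesis by (simp add: r_def s_def pderiv_diff pderiv_smult qz algebra_simps)
        qed
        ultimately show "poly (pderiv s) z \<noteq> 0" by auto
      qed (use ds in auto)
      then show False using a ds sV by simp
    qed
  qed
  have "of_nat (Suc n) * (\<integral>\<^sup>+a. F a \<partial>lborel)
      = (\<integral>\<^sup>+z. ennreal ((cmod (deriv g z))\<^sup>2) * F (g z) * indicator V z \<partial>lborel)"
    by (rule nn_integral_holomorphic_covering[OF V hol _ AE _ F, symmetric])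
       (simp_all add: dgV, simp add: V_def)
  also have "\<dots> = (\<integral>\<^sup>+z. (if poly p z = 0 then 0 else
        ennreal ((cmod (poly (pderiv q) z - poly q z / poly p z * poly (pderiv p) z))\<^sup>2 / (cmod (poly p z))\<^sup>2)
          * F (poly q z / poly p z)) \<partial>lborel)"
  proof (rule nn_integral_cong)
    fix z
    have eq: "poly r z / (poly p z)\<^sup>2 = (poly (pderiv q) z - poly q z / poly p z * poly (pderiv p) z) / poly p z"
      if "poly p z \<noteq> 0"
    proof -
      have "(a * P - b * c) / P\<^sup>2 = (a - b / P * c) / P" if "P \<noteq> 0" for a b c P :: complex
        using that by (simp add: divide_simps power2_eq_square)
      from this[OF that] show ?thesis by (simp add: r_def)
    qed
    show "ennreal ((cmod (deriv g z))\<^sup>2) * F (g z) * indicator V z = (if poly p z = 0 then 0 else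
        ennreal ((cmod (poly (pderiv q) z - poly q z / poly p z * poly (pderiv p) z))\<^sup>2 / (cmod (poly p z))\<^sup>2)
          * F (poly q z / poly p z))"
    proof (cases "z \<in> V")
      case True
      then have "poly p z \<noteq> 0" by (simp add: V_def)
      then show ?thesis using True by (simp add: dgV eq norm_divide power_divide g_def)
    next
      \<comment> \<open>Off \<open>V\<close> either \<open>p\<close> vanishes, or \<open>r\<close>
        does and the squared derivative is 0.\<close>
      case False
      then show ?thesis using eq by (auto simp: V_def)
    qed
  qed
  finally show ?thesis .
qed

section \<open>Linear substitutions\<close>

lemma nn_integral_lborel_mult:
  fixes t :: complex
  assumes "t \<noteq> 0" and F: "F \<in> borel_measurable borel"
  shows "(\<integral>\<^sup>+z. F z \<partial>lborel) = ennreal ((cmod t)\<^sup>2) * (\<integral>\<^sup>+z. F (t * z) \<partial>lborel)"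
proof -
  note [measurable] = F
  have "range ((*) t) = UNIV" using assms(1) by (intro surjI[of _ "\<lambda>w. w / t"]) auto
  then have "(\<integral>\<^sup>+z. F z \<partial>lborel) = (\<integral>\<^sup>+z. ennreal ((cmod (deriv ((*) t) z))\<^sup>2) * F (t * z) * indicator UNIV z \<partial>lborel)"
    using assms by (subst nn_integral_holomorphic_inj[where A = UNIV])
      (auto intro!: holomorphic_intros simp: inj_on_def)
  moreover have "deriv ((*) t) z = t" for z by (intro DERIV_imp_deriv) (auto intro!: derivative_eq_intros)
  ultimately show ?thesis by (simp add: nn_integral_cmult del: deriv_cmult_right deriv_cmult)
qed

text \<open>Matrices act here on extensional functions, the points of \<open>lebesgue_fun\<close>,
  rather than on the vector type.\<close>

definition mult_fun :: "nat \<Rightarrow> complex mat \<Rightarrow> (nat \<Rightarrow> complex) \<Rightarrow> nat \<Rightarrow> complex" where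
  "mult_fun n A v = (\<lambda>i\<in>{..<n}. \<Sum>j<n. A $$ (i, j) * v j)"

lemma mult_fun_measurable [measurable]:
  "mult_fun n A \<in> lebesgue_fun {..<n} \<rightarrow>\<^sub>M lebesgue_fun {..<n}"
proof -
  have "(\<lambda>v. \<lambda>i\<in>{..<n}. \<Sum>j<n. A $$ (i, j) * v j) \<in> lebesgue_fun {..<n} \<rightarrow>\<^sub>M lebesgue_fun {..<n}"
  proof (rule measurable_restrict)
    fix i
    have "(\<lambda>v. \<Sum>j<n. A $$ (i, j) * v j) \<in> borel_measurable (lebesgue_fun {..<n})"
      by (intro borel_measurable_sum borel_measurable_times borel_measurable_const)
         (simp add: measurable_component_singleton)
    then show "(\<lambda>v. \<Sum>j<n. A $$ (i, j) * v j) \<in> lebesgue_fun {..<n} \<rightarrow>\<^sub>M lborel" by simp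
  qed
  then show ?thesis unfolding mult_fun_def[abs_def] .
qed

lemma mult_fun_mult:
  assumes "A \<in> carrier_mat n n" "B \<in> carrier_mat n n"
  shows "mult_fun n (A * B) v = mult_fun n A (mult_fun n B v)"
proof (rule ext)
  fix i
  show "mult_fun n (A * B) v i = mult_fun n A (mult_fun n B v) i"
  proof (cases "i < n")
    case True
    have "(\<Sum>j<n. (A * B) $$ (i, j) * v j) = (\<Sum>j<n. \<Sum>k<n. A $$ (i, k) * B $$ (k, j) * v j)"
      using assms True
      by (intro sum.cong refl) (auto simp: scalar_prod_def sum_distrib_right atLeast0LessThan)
    also have "\<dots> = (\<Sum>k<n. A $$ (i, k) * (\<Sum>j<n. B $$ (k, j) * v j))"
      by (subst sum.swap) (simp add: sum_distrib_left mult.assoc)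
    finally show ?thesis using True by (simp add: mult_fun_def)
  qed (simp add: mult_fun_def)
qed

lemma mult_fun_one: "v \<in> space (lebesgue_fun {..<n}) \<Longrightarrow> mult_fun n (1\<^sub>m n) v = v"
  by (auto simp: mult_fun_def space_PiM PiE_def extensional_def fun_eq_iff if_distrib[of "\<lambda>x. x * _"] cong: if_cong)

lemma mult_fun_add: "mult_fun n A (fun_add {..<n} v w) = fun_add {..<n} (mult_fun n A v) (mult_fun n A w)"
  by (auto simp: mult_fun_def fun_add_def sum.distrib ring_distribs fun_eq_iff)

text \<open>Only the diagonal stretches volume: with the last coordinate fixed, the entries above
  the diagonal in its column merely translate the other coordinates.\<close>

lemma nn_integral_triangular:
  fixes t :: "nat \<Rightarrow> nat \<Rightarrow> complex"
  assumes "\<And>i. i < n \<Longrightarrow> t i i \<noteq> 0" "G \<in> borel_measurable (lebesgue_fun {..<n})"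
  shows "(\<integral>\<^sup>+v. G v \<partial>lebesgue_fun {..<n}) = ennreal (\<Prod>i<n. (cmod (t i i))\<^sup>2) *
     (\<integral>\<^sup>+v. G (\<lambda>i\<in>{..<n}. \<Sum>j\<in>{i..<n}. t i j * v j) \<partial>lebesgue_fun {..<n})"
  using assms
proof (induction n arbitrary: G)
  case 0
  have "v = (\<lambda>i\<in>{..<0}. \<Sum>j\<in>{i..<0}. t i j * v j)" if "v \<in> space (lebesgue_fun {..<0})" for v
    using that by (auto simp: space_PiM)
  then have "(\<integral>\<^sup>+v. G v \<partial>lebesgue_fun {..<0})
      = (\<integral>\<^sup>+v. G (\<lambda>i\<in>{..<0}. \<Sum>j\<in>{i..<0}. t i j * v j) \<partial>lebesgue_fun {..<0})"
    by (intro nn_integral_cong arg_cong[where f = G]) blast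
  then show ?case by (simp only: lessThan_0 prod.empty ennreal_1 mult_1)
next
  case (Suc n)
  note [measurable] = Suc.prems(2)
  let ?T = "\<lambda>n v. (\<lambda>i\<in>{..<n}. \<Sum>j\<in>{i..<n}. t i j * v j) :: nat \<Rightarrow> complex"
  have Tm[measurable]: "?T n \<in> lebesgue_fun {..<n} \<rightarrow>\<^sub>M lebesgue_fun {..<n}" for n
  proof (rule measurable_restrict)
    fix i
    have "(\<lambda>v. \<Sum>j\<in>{i..<n}. t i j * v j) \<in> borel_measurable (lebesgue_fun {..<n})"
      by (intro borel_measurable_sum borel_measurable_times borel_measurable_const)
         (simp add: measurable_component_singleton)
    then show "(\<lambda>v. \<Sum>j\<in>{i..<n}. t i j * v j) \<in> lebesgue_fun {..<n} \<rightarrow>\<^sub>M lborel" by simp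
  qed
  have ins: "{..<Suc n} = insert n {..<n}" by auto
  have Gm: "(\<lambda>p. G ((fst p)(n := snd p))) \<in> borel_measurable (lebesgue_fun {..<n} \<Otimes>\<^sub>M lborel)"
    using measurable_compose[OF measurable_add_dim[of n "{..<n}" "\<lambda>_. lborel :: complex measure"]] Suc.prems(2)
    unfolding ins by (simp only: case_prod_beta')
  have Gx[measurable]: "(\<lambda>u. G (u(n := x))) \<in> borel_measurable (lebesgue_fun {..<n})" for x
    using measurable_compose[OF measurable_Pair2' Gm, of x] by simp
  interpret S: sigma_finite_measure "lebesgue_fun {..<n}" by (intro sigma_finite_lebesgue_fun) simp
  define K where "K x = (\<integral>\<^sup>+u. G (u(n := x)) \<partial>lebesgue_fun {..<n})" for x
  have Km: "K \<in> borel_measurable borel"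
  proof -
    have "(\<lambda>p. G ((snd p)(n := fst p))) \<in> borel_measurable (lborel \<Otimes>\<^sub>M lebesgue_fun {..<n})"
      using measurable_compose[OF measurable_Pair[OF measurable_snd measurable_fst] Gm] by simp
    then have "(\<lambda>x. \<integral>\<^sup>+u. G (u(n := x)) \<partial>lebesgue_fun {..<n}) \<in> borel_measurable lborel"
      by (intro S.borel_measurable_nn_integral) (simp only: case_prod_beta')
    then show ?thesis unfolding K_def[abs_def] by simp
  qed
  let ?P = "ennreal (\<Prod>i<n. (cmod (t i i))\<^sup>2)"
  \<comment> \<open>The last coordinate acts on the others as translation by \<open>x\<close> times
    column \<open>n\<close>.\<close>
  have Tu: "?T (Suc n) (u(n := x)) = (fun_add {..<n} (?T n u) (\<lambda>i\<in>{..<n}. t i n * x))(n := t n n * x)" for u x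
    by (auto simp: fun_add_def fun_eq_iff atLeastLessThanSuc)
  have IH: "K (t n n * x) = ?P * (\<integral>\<^sup>+u. G (?T (Suc n) (u(n := x))) \<partial>lebesgue_fun {..<n})" for x
  proof -
    let ?y = "(\<lambda>i\<in>{..<n}. t i n * x) :: nat \<Rightarrow> complex"
    have y: "?y \<in> space (lebesgue_fun {..<n})" by (auto simp: space_PiM)
    have m: "(\<lambda>u. fun_add {..<n} u ?y) \<in> lebesgue_fun {..<n} \<rightarrow>\<^sub>M lebesgue_fun {..<n}"
      by (rule fun_add_measurable[OF measurable_ident_sets[OF refl] measurable_const[OF y]])
    have "K (t n n * x) = (\<integral>\<^sup>+u. G ((fun_add {..<n} u ?y)(n := t n n * x)) \<partial>lebesgue_fun {..<n})"
      unfolding K_def by (rule nn_integral_lebesgue_fun_translate[symmetric, OF _ y Gx]) simp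
    also have "\<dots> = ?P * (\<integral>\<^sup>+u. G ((fun_add {..<n} (?T n u) ?y)(n := t n n * x)) \<partial>lebesgue_fun {..<n})"
      by (rule Suc.IH[OF _ measurable_compose[OF m Gx]]) (simp add: Suc.prems(1))
    finally show ?thesis by (simp only: Tu)
  qed
  have "(\<integral>\<^sup>+v. G v \<partial>lebesgue_fun {..<Suc n}) = (\<integral>\<^sup>+x. K x \<partial>lborel)"
    unfolding K_def ins
    by (rule lborel_prod.product_nn_integral_insert_rev[OF _ _ Suc.prems(2)[unfolded ins]]) simp_all
  also have "\<dots> = ennreal ((cmod (t n n))\<^sup>2) * (\<integral>\<^sup>+x. K (t n n * x) \<partial>lborel)"
    by (rule nn_integral_lborel_mult[OF _ Km]) (simp add: Suc.prems(1))
  also have "(\<integral>\<^sup>+x. K (t n n * x) \<partial>lborel)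
      = ?P * (\<integral>\<^sup>+x. \<integral>\<^sup>+u. G (?T (Suc n) (u(n := x))) \<partial>lebesgue_fun {..<n} \<partial>lborel)"
    unfolding IH
  proof (rule nn_integral_cmult)
    have "(\<lambda>p. G (?T (Suc n) ((fst p)(n := snd p)))) \<in> borel_measurable (lebesgue_fun {..<n} \<Otimes>\<^sub>M lborel)"
      using measurable_compose[OF measurable_add_dim[of n "{..<n}" "\<lambda>_. lborel :: complex measure"],
          of "\<lambda>v. G (?T (Suc n) v)"] measurable_compose[OF Tm[of "Suc n"] Suc.prems(2)]
      unfolding ins by (simp only: case_prod_beta')
    from measurable_compose[OF measurable_Pair[OF measurable_snd measurable_fst] this]
    have "(\<lambda>p. G (?T (Suc n) ((snd p)(n := fst p)))) \<in> borel_measurable (lborel \<Otimes>\<^sub>M lebesgue_fun {..<n})"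
      by (simp only: fst_conv snd_conv)
    then show "(\<lambda>x. \<integral>\<^sup>+u. G (?T (Suc n) (u(n := x))) \<partial>lebesgue_fun {..<n}) \<in> borel_measurable lborel"
      by (intro S.borel_measurable_nn_integral) (simp only: case_prod_beta')
  qed
  also have "(\<integral>\<^sup>+x. \<integral>\<^sup>+u. G (?T (Suc n) (u(n := x))) \<partial>lebesgue_fun {..<n} \<partial>lborel)
      = (\<integral>\<^sup>+v. G (?T (Suc n) v) \<partial>lebesgue_fun {..<Suc n})"
    unfolding ins
    by (rule lborel_prod.product_nn_integral_insert_rev
        [OF _ _ measurable_compose[OF Tm[of "Suc n"] Suc.prems(2), unfolded ins], symmetric]) simp_all
  finally have fin: "(\<integral>\<^sup>+v. G v \<partial>lebesgue_fun {..<Suc n})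
    = ennreal ((cmod (t n n))\<^sup>2) * (?P * (\<integral>\<^sup>+v. G (?T (Suc n) v) \<partial>lebesgue_fun {..<Suc n}))" .
  have "ennreal (\<Prod>i<Suc n. (cmod (t i i))\<^sup>2) = ennreal ((cmod (t n n))\<^sup>2) * ?P"
    by (simp add: ennreal_mult'[symmetric] mult.commute prod_nonneg)
  with fin show ?case by (simp only: mult.assoc)
qed


text \<open>Schur triangularisation A = P B Q, with Q inverse to P. Substituting by \<open>Q\<close>
  contributes an unknown factor \<open>\<kappa>\<close>; at the end the same factor turns the
  integral of G(P v) into that of G(P Q v) = G(v). So it disappears and only the diagonal of
  \<open>B\<close> remains.\<close>

lemma nn_integral_mult_fun:
  assumes A: "A \<in> carrier_mat n n" and det: "Determinant.det A \<noteq> 0"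
    and G: "G \<in> borel_measurable (lebesgue_fun {..<n})"
  shows "(\<integral>\<^sup>+v. G v \<partial>lebesgue_fun {..<n}) = ennreal ((cmod (Determinant.det A))\<^sup>2) *
     (\<integral>\<^sup>+v. G (mult_fun n A v) \<partial>lebesgue_fun {..<n})"
proof -
  let ?M = "lebesgue_fun {..<n}"
  obtain es where es: "char_poly A = (\<Prod>a\<leftarrow>es. [:- a, 1:])"
    using char_poly_factorized[OF A] by auto
  from schur_decomposition_exists[OF A es]
  obtain B where B: "B \<in> carrier_mat n n" "upper_triangular B" "similar_mat A B" by blast
  then obtain P Q where wit: "similar_mat_wit A B P Q" unfolding similar_mat_def by blast
  note w = similar_mat_witD2[OF A wit]
  have detB: "Determinant.det A = (\<Prod>i<n. B $$ (i, i))"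
    using det_similar[OF B(3)] det_upper_triangular[OF B(2,1)] B(1)
    by (simp add: diag_mat_def prod.list_conv_set_nth atLeast0LessThan)
  have nz: "B $$ (i, i) \<noteq> 0" if "i < n" for i using det detB that by auto
  have triv: "mult_fun n B v = (\<lambda>i\<in>{..<n}. \<Sum>j\<in>{i..<n}. B $$ (i, j) * v j)" for v
  proof -
    have "(\<Sum>j<n. B $$ (i, j) * v j) = (\<Sum>j\<in>{i..<n}. B $$ (i, j) * v j)" if "i < n" for i
      using B(1,2) that by (intro sum.mono_neutral_right) (auto simp: upper_triangular_def)
    then show ?thesis by (auto simp: mult_fun_def fun_eq_iff)
  qed
  have comp: "mult_fun n A v = mult_fun n P (mult_fun n B (mult_fun n Q v))" for v
    using w by (simp add: mult_fun_mult[of _ n, symmetric])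
  have GP: "(\<lambda>v. G (mult_fun n P v)) \<in> borel_measurable ?M"
    using measurable_compose[OF mult_fun_measurable G] .
  have GPB: "(\<lambda>v. G (mult_fun n P (mult_fun n B v))) \<in> borel_measurable ?M"
    using measurable_compose[OF mult_fun_measurable GP] .
  have "\<exists>\<kappa>. \<forall>G \<in> borel_measurable ?M. (\<integral>\<^sup>+z. G (mult_fun n Q z) \<partial>?M) = \<kappa> * (\<integral>\<^sup>+z. G z \<partial>?M)"
  proof (rule nn_integral_lebesgue_fun_additive)
    show "space ?M \<subseteq> mult_fun n Q ` space ?M"
    proof
      fix v assume v: "v \<in> space ?M"
      have "mult_fun n Q (mult_fun n P v) = v"
        using w v by (simp add: mult_fun_mult[of _ n, symmetric] mult_fun_one)
      moreover have "mult_fun n P v \<in> space ?M" by (auto simp: mult_fun_def space_PiM)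
      ultimately show "v \<in> mult_fun n Q ` space ?M" by (metis imageI)
    qed
  qed (simp_all add: mult_fun_add)
  then obtain \<kappa> where \<kappa>: "\<And>G. G \<in> borel_measurable ?M \<Longrightarrow>
      (\<integral>\<^sup>+z. G (mult_fun n Q z) \<partial>?M) = \<kappa> * (\<integral>\<^sup>+z. G z \<partial>?M)" by blast
  have "ennreal ((cmod (Determinant.det A))\<^sup>2) * (\<integral>\<^sup>+v. G (mult_fun n A v) \<partial>?M)
      = \<kappa> * (ennreal (\<Prod>i<n. (cmod (B $$ (i, i)))\<^sup>2) * (\<integral>\<^sup>+v. G (mult_fun n P (mult_fun n B v)) \<partial>?M))"
    unfolding comp \<kappa>[OF GPB] detB
    by (simp add: prod_norm[symmetric] prod_power_distrib mult.left_commute)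
  also have "\<dots> = \<kappa> * (\<integral>\<^sup>+v. G (mult_fun n P v) \<partial>?M)"
    using nn_integral_triangular[of n "\<lambda>i j. B $$ (i, j)", OF nz GP] by (simp only: triv)
  also have "\<dots> = (\<integral>\<^sup>+v. G (mult_fun n P (mult_fun n Q v)) \<partial>?M)"
    by (rule \<kappa>[OF GP, symmetric])
  also have "\<dots> = (\<integral>\<^sup>+v. G v \<partial>?M)"
    using w by (intro nn_integral_cong) (simp add: mult_fun_mult[of _ n, symmetric] mult_fun_one)
  finally show ?thesis ..
qed

section \<open>Characteristic polynomials and bordered matrices\<close>

lemma poly_char_poly_mat:
  fixes f :: "nat \<times> nat \<Rightarrow> complex"
  shows "poly (char_poly (Matrix.mat n n f)) z
    = Determinant.det (Matrix.mat n n (\<lambda>(i, j). (if i = j then z else 0) - f (i, j)))"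
  unfolding char_poly_def
  by (rule poly_det_cong[of _ n]) (auto simp: char_poly_matrix_def)

section \<open>Measurability of characteristic polynomials and of events about their roots\<close>

lemma borel_measurable_det:
  fixes f :: "'x \<Rightarrow> nat \<times> nat \<Rightarrow> complex"
  assumes "\<And>i j. i < n \<Longrightarrow> j < n \<Longrightarrow> (\<lambda>x. f x (i, j)) \<in> borel_measurable M"
  shows "(\<lambda>x. Determinant.det (Matrix.mat n n (f x))) \<in> borel_measurable M"
proof -
  have eq: "Determinant.det (Matrix.mat n n (f x))
      = (\<Sum>p | p permutes {0..<n}. signof p * (\<Prod>i = 0..<n. f x (i, p i)))" for x
    by (subst det_def'[of _ n]) (auto intro!: sum.cong prod.cong simp: permutes_in_image)
  show ?thesis unfolding eq
  proof (intro borel_measurable_sum borel_measurable_times borel_measurable_const borel_measurable_prod)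
    fix p i assume "p \<in> {p. p permutes {0..<n}}" "i \<in> {0..<n}"
    then have "i < n" "p i < n" using permutes_in_image[of p "{0..<n}" i] by auto
    then show "(\<lambda>x. f x (i, p i)) \<in> borel_measurable M" by (rule assms)
  qed
qed

lemma borel_measurable_char_poly:
  fixes f :: "'x \<Rightarrow> nat \<times> nat \<Rightarrow> complex"
  assumes "\<And>i j. i < n \<Longrightarrow> j < n \<Longrightarrow> (\<lambda>x. f x (i, j)) \<in> borel_measurable M"
    and "z \<in> borel_measurable M"
  shows "(\<lambda>x. poly (char_poly (Matrix.mat n n (f x))) (z x)) \<in> borel_measurable M"
  unfolding poly_char_poly_mat using assms
  by (intro borel_measurable_det) auto

text \<open>By compactness, the closed ball contains a zero iff for every n some point of norm below
  R + 1/(n+1) has |F| < 1/(n+1). By continuity such points may be taken from a countable dense set,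
  which leaves countable unions and intersections.\<close>

lemma measurable_root_cball:
  fixes F :: "'x \<Rightarrow> complex \<Rightarrow> real"
  assumes m: "\<And>z. (\<lambda>x. F x z) \<in> borel_measurable M"
    and c: "\<And>x. continuous_on UNIV (F x)"
  shows "{x \<in> space M. \<exists>z\<in>cball 0 R. F x z = 0} \<in> sets M"
proof -
  note [measurable] = m
  obtain Q :: "complex set" where Q: "countable Q" "\<And>X. open X \<Longrightarrow> X \<noteq> {} \<Longrightarrow> \<exists>q\<in>Q. q \<in> X"
    using countable_dense_exists by metis
  have eq: "(\<exists>z\<in>cball 0 R. F x z = 0) \<longleftrightarrow>
      (\<forall>n. \<exists>q\<in>Q. cmod q < R + 1 / Suc n \<and> \<bar>F x q\<bar> < 1 / Suc n)" for x
  proof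
    assume "\<exists>z\<in>cball 0 R. F x z = 0"
    then obtain z where z: "cmod z \<le> R" "F x z = 0" by auto
    show "\<forall>n. \<exists>q\<in>Q. cmod q < R + 1 / Suc n \<and> \<bar>F x q\<bar> < 1 / Suc n"
    proof
      fix n
      have "open {q. cmod q < R + 1 / Suc n \<and> \<bar>F x q\<bar> < 1 / Suc n}"
        using c[of x] by (intro open_Collect_conj open_Collect_less continuous_intros) auto
      moreover have "z \<in> {q. cmod q < R + 1 / Suc n \<and> \<bar>F x q\<bar> < 1 / Suc n}"
        using z by (auto intro: le_less_trans)
      ultimately show "\<exists>q\<in>Q. cmod q < R + 1 / Suc n \<and> \<bar>F x q\<bar> < 1 / Suc n"
        using Q(2) by blast
    qed
  next
    assume "\<forall>n. \<exists>q\<in>Q. cmod q < R + 1 / Suc n \<and> \<bar>F x q\<bar> < 1 / Suc n"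
    then obtain q where q: "\<And>n. cmod (q n) < R + 1 / Suc n" "\<And>n. \<bar>F x (q n)\<bar> < 1 / Suc n"
      by metis
    have "q n \<in> cball 0 (R + 1)" for n
    proof -
      have "1 / real (Suc n) \<le> 1" by simp
      then show ?thesis using q(1)[of n] by (simp only: mem_cball_0)
    qed
    then obtain z r where zr: "strict_mono r" "(q \<circ> r) \<longlonglongrightarrow> z"
      using compact_cball[of "0::complex" "R + 1"] unfolding compact_def by blast
    have inv: "(\<lambda>n. 1 / real (Suc (r n))) \<longlonglongrightarrow> 0"
      using LIMSEQ_subseq_LIMSEQ[OF LIMSEQ_inverse_real_of_nat zr(1)] by (simp add: o_def inverse_eq_divide)
    have "cmod z \<le> R + 0"
    proof (rule LIMSEQ_le)
      show "(\<lambda>n. cmod ((q \<circ> r) n)) \<longlonglongrightarrow> cmod z" using zr(2) by (rule tendsto_norm)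
      show "(\<lambda>n. R + 1 / real (Suc (r n))) \<longlonglongrightarrow> R + 0" using inv by (intro tendsto_intros)
      show "\<exists>N. \<forall>n\<ge>N. cmod ((q \<circ> r) n) \<le> R + 1 / real (Suc (r n))" using q(1) by (auto intro: less_imp_le)
    qed
    moreover have "\<bar>F x z\<bar> \<le> 0"
    proof (rule LIMSEQ_le)
      have "(\<lambda>n. F x ((q \<circ> r) n)) \<longlonglongrightarrow> F x z"
        using c[of x] zr(2) by (metis UNIV_I continuous_on_eq_continuous_at isCont_tendsto_compose open_UNIV)
      then show "(\<lambda>n. \<bar>F x ((q \<circ> r) n)\<bar>) \<longlonglongrightarrow> \<bar>F x z\<bar>" by (rule tendsto_rabs)
      show "(\<lambda>n. 1 / real (Suc (r n))) \<longlonglongrightarrow> 0" by (rule inv)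
      show "\<exists>N. \<forall>n\<ge>N. \<bar>F x ((q \<circ> r) n)\<bar> \<le> 1 / real (Suc (r n))" using q(2) by (auto intro: less_imp_le)
    qed
    ultimately show "\<exists>z\<in>cball 0 R. F x z = 0" by auto
  qed
  show ?thesis unfolding eq using Q(1) by measurable
qed

lemma measurable_root_ball:
  fixes F :: "'x \<Rightarrow> complex \<Rightarrow> real"
  assumes m: "\<And>z. (\<lambda>x. F x z) \<in> borel_measurable M"
    and c: "\<And>x. continuous_on UNIV (F x)"
  shows "{x \<in> space M. \<exists>z\<in>ball 0 R. F x z = 0} \<in> sets M"
proof -
  have "ball 0 R = (\<Union>n. cball (0 :: complex) (R - 1 / Suc n))"
  proof (intro subset_antisym subsetI)
    fix z :: complex assume "z \<in> ball 0 R"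
    then have "R - cmod z > 0" by simp
    then obtain n where "1 / real (Suc n) < R - cmod z" using nat_approx_posE by blast
    then show "z \<in> (\<Union>n. cball (0 :: complex) (R - 1 / Suc n))" by auto (smt (verit))
  next
    fix z :: complex assume "z \<in> (\<Union>n. cball (0 :: complex) (R - 1 / Suc n))"
    then obtain n where "cmod z \<le> R - 1 / Suc n" by auto
    moreover have "1 / real (Suc n) > 0" by simp
    ultimately show "z \<in> ball 0 R" by (simp only: mem_ball_0)
  qed
  then have "{x \<in> space M. \<exists>z\<in>ball 0 R. F x z = 0}
      = (\<Union>n. {x \<in> space M. \<exists>z\<in>cball 0 (R - 1 / Suc n). F x z = 0})" by auto
  then show ?thesis using measurable_root_cball[OF m c] by auto
qed

lemma measurable_root_UNIV:
  fixes F :: "'x \<Rightarrow> complex \<Rightarrow> real"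
  assumes m: "\<And>z. (\<lambda>x. F x z) \<in> borel_measurable M"
    and c: "\<And>x. continuous_on UNIV (F x)"
  shows "{x \<in> space M. \<exists>z. F x z = 0} \<in> sets M"
proof -
  have "{x \<in> space M. \<exists>z. F x z = 0} = (\<Union>n. {x \<in> space M. \<exists>z\<in>cball 0 (real n). F x z = 0})"
  proof (intro subset_antisym subsetI)
    fix x assume "x \<in> {x \<in> space M. \<exists>z. F x z = 0}"
    then obtain z where z: "x \<in> space M" "F x z = 0" by blast
    obtain n where "cmod z \<le> real n" using real_arch_simple by blast
    then show "x \<in> (\<Union>n. {x \<in> space M. \<exists>z\<in>cball 0 (real n). F x z = 0})"
      using z by (intro UN_I[of n]) (auto intro!: bexI[of _ z])
  qed blast
  then show ?thesis using measurable_root_cball[OF m c] by auto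
qed

lemma mat_delete_mat_last:
  "mat_delete (Matrix.mat (Suc n) (Suc n) f) n n = Matrix.mat n n f"
  by (auto simp: mat_delete_def intro!: eq_matI)

section \<open>Perturbation of a single entry, and zero sets of affine functions\<close>

lemma det_add_entry:
  fixes A :: "complex mat"
  assumes A: "A \<in> carrier_mat n n" and ij: "i < n" "j < n"
    and A': "A' \<in> carrier_mat n n" "A' $$ (i, j) = A $$ (i, j) + t"
      "\<And>k l. k < n \<Longrightarrow> l < n \<Longrightarrow> (k, l) \<noteq> (i, j) \<Longrightarrow> A' $$ (k, l) = A $$ (k, l)"
  shows "Determinant.det A' = Determinant.det A + t * cofactor A i j"
proof -
  have "mat_delete A' k j = mat_delete A k j" if "k < n" for k
    using A A' that by (intro eq_matI) (auto simp: mat_delete_def)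
  then have cof: "cofactor A' k j = cofactor A k j" if "k < n" for k
    using that by (simp add: cofactor_def)
  have "Determinant.det A' = (\<Sum>k<n. A' $$ (k, j) * cofactor A k j)"
    using laplace_expansion_column[OF A'(1) ij(2)] cof by simp
  also have "\<dots> = (\<Sum>k<n. A $$ (k, j) * cofactor A k j + (if k = i then t * cofactor A i j else 0))"
    using A' ij by (intro sum.cong) (auto simp: algebra_simps)
  also have "\<dots> = Determinant.det A + t * cofactor A i j"
    using laplace_expansion_column[OF A ij(2)] ij by (simp add: sum.distrib)
  finally show ?thesis .
qed

text \<open>Every line in direction \<open>i\<close> meets the zero set in exactly one point,
  because the slope \<open>k\<close> is not 0; by Tonelli the zero set is null.\<close>

lemma AE_affine_nonzero:
  assumes I: "finite I" "i \<in> I" and f: "f \<in> borel_measurable (lebesgue_fun I)"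
    and k: "k \<noteq> (0 :: complex)"
    and aff: "\<And>x t. f (x(i := x i + t)) = f x + t * k"
  shows "AE x in lebesgue_fun I. f x \<noteq> 0"
proof (rule AE_I')
  note [measurable] = f
  let ?J = "I - {i}"
  have ins: "I = insert i ?J" using I by auto
  have S[measurable]: "{x \<in> space (lebesgue_fun I). f x = 0} \<in> sets (lebesgue_fun I)" by measurable
  have "emeasure (lebesgue_fun I) {x \<in> space (lebesgue_fun I). f x = 0}
      = (\<integral>\<^sup>+x. indicator {x \<in> space (lebesgue_fun I). f x = 0} x \<partial>lebesgue_fun I)"
    using S by simp
  also have "\<dots> = (\<integral>\<^sup>+x. indicator {0} (f x) \<partial>lebesgue_fun I)"
    by (intro nn_integral_cong) (auto simp: indicator_def)
  also have "\<dots> = (\<integral>\<^sup>+x. \<integral>\<^sup>+t. indicator {0} (f (x(i := t))) \<partial>lborel \<partial>lebesgue_fun ?J)"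
  proof -
    have "(\<lambda>x. indicator {0} (f x) :: ennreal) \<in> borel_measurable (lebesgue_fun I)" by measurable
    then show ?thesis
      using lborel_prod.product_nn_integral_insert[of ?J i "\<lambda>x. indicator {0} (f x)"] I(1) ins[symmetric]
      by simp
  qed
  also have "\<dots> = (\<integral>\<^sup>+x. 0 \<partial>lebesgue_fun ?J)"
  proof (rule nn_integral_cong)
    fix x
    have e: "f (x(i := t)) = f (x(i := 0)) + t * k" for t using aff[of "x(i := 0)" t] by simp
    have e':  "a + t * k = 0 \<longleftrightarrow> t = - a / k" for a t
      by (simp only: nonzero_eq_divide_eq[OF k] eq_neg_iff_add_eq_0 add.commute[of a])
    have "(indicator {0} (f (x(i := t))) :: ennreal) = indicator {- f (x(i := 0)) / k} t" for t
      unfolding e[of t] indicator_def singleton_iff e' ..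
    then show "(\<integral>\<^sup>+t. indicator {0} (f (x(i := t))) \<partial>lborel) = (0 :: ennreal)" by simp
  qed
  finally show "{x \<in> space (lebesgue_fun I). f x = 0} \<in> null_sets (lebesgue_fun I)"
    using S by (simp add: null_sets_def)
qed auto

section \<open>Bordered matrices and the product structure of their Lebesgue measure\<close>

definition block :: "nat \<Rightarrow> (nat \<times> nat \<Rightarrow> complex) \<Rightarrow> (nat \<Rightarrow> complex) \<Rightarrow> (nat \<Rightarrow> complex) \<Rightarrow> complex
    \<Rightarrow> nat \<times> nat \<Rightarrow> complex" where
  "block N D b c a = (\<lambda>(i, j). if i < N then if j < N then D (i, j) else c i else if j < N then b j else a)"

abbreviation grid :: "nat \<Rightarrow> (nat \<times> nat) set" where
  "grid N \<equiv> {..<N} \<times> {..<N}"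

abbreviation chi :: "nat \<Rightarrow> (nat \<times> nat \<Rightarrow> complex) \<Rightarrow> complex poly" where
  "chi n f \<equiv> char_poly (Matrix.mat n n f)"

lemma grid_Suc_eq: "grid (Suc N) = grid N \<union> Pair N ` {..<N} \<union> (\<lambda>i. (i, N)) ` {..<N} \<union> {(N, N)}"
  by (auto simp: less_Suc_eq)

text \<open>Stated in \<open>comm_monoid_set\<close> so that it serves products of measures
  (\<open>prod.grid_Suc\<close>) as well as sums of squares (\<open>sum.grid_Suc\<close>).\<close>

lemma (in comm_monoid_set) grid_Suc:
  "F g (grid (Suc N)) = F g (grid N) \<^bold>* (F (\<lambda>j. g (N, j)) {..<N} \<^bold>* (F (\<lambda>i. g (i, N)) {..<N} \<^bold>* g (N, N)))"
proof -
  have "F g (grid (Suc N)) = F g (grid N \<union> Pair N ` {..<N} \<union> (\<lambda>i. (i, N)) ` {..<N}) \<^bold>* F g {(N, N)}"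
    unfolding grid_Suc_eq by (rule union_disjoint) auto
  also have "F g (grid N \<union> Pair N ` {..<N} \<union> (\<lambda>i. (i, N)) ` {..<N})
      = F g (grid N \<union> Pair N ` {..<N}) \<^bold>* F g ((\<lambda>i. (i, N)) ` {..<N})"
    by (rule union_disjoint) auto
  also have "F g (grid N \<union> Pair N ` {..<N}) = F g (grid N) \<^bold>* F g (Pair N ` {..<N})"
    by (rule union_disjoint) auto
  also have "F g (Pair N ` {..<N}) = F (\<lambda>j. g (N, j)) {..<N}"
    by (subst reindex) (auto simp: inj_on_def comp_def)
  also have "F g ((\<lambda>i. (i, N)) ` {..<N}) = F (\<lambda>i. g (i, N)) {..<N}"
    by (subst reindex) (auto simp: inj_on_def comp_def)
  finally show ?thesis by (simp add: assoc)
qed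

lemma nn_integral_pair4:
  assumes "sigma_finite_measure M2" "sigma_finite_measure M3" "sigma_finite_measure M4"
    and f: "f \<in> borel_measurable (M1 \<Otimes>\<^sub>M (M2 \<Otimes>\<^sub>M (M3 \<Otimes>\<^sub>M M4)))"
  shows "(\<integral>\<^sup>+x. f x \<partial>(M1 \<Otimes>\<^sub>M (M2 \<Otimes>\<^sub>M (M3 \<Otimes>\<^sub>M M4))))
    = (\<integral>\<^sup>+x. \<integral>\<^sup>+y. \<integral>\<^sup>+z. \<integral>\<^sup>+w. f (x, y, z, w) \<partial>M4 \<partial>M3 \<partial>M2 \<partial>M1)"
proof -
  note [measurable] = f
  interpret M2: sigma_finite_measure M2 by fact
  interpret M3: sigma_finite_measure M3 by fact
  interpret M4: sigma_finite_measure M4 by fact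
  interpret M34: pair_sigma_finite M3 M4 ..
  interpret M234: pair_sigma_finite M2 "M3 \<Otimes>\<^sub>M M4" ..
  have f1: "(\<lambda>p. f (x, p)) \<in> borel_measurable (M2 \<Otimes>\<^sub>M (M3 \<Otimes>\<^sub>M M4))" if "x \<in> space M1" for x
    using measurable_compose[OF measurable_Pair1'[OF that] f] .
  have f2: "(\<lambda>p. f (x, y, p)) \<in> borel_measurable (M3 \<Otimes>\<^sub>M M4)" if "x \<in> space M1" "y \<in> space M2" for x y
    using measurable_compose[OF measurable_Pair1'[OF that(2)] f1[OF that(1)]] .
  have "(\<integral>\<^sup>+x. f x \<partial>(M1 \<Otimes>\<^sub>M (M2 \<Otimes>\<^sub>M (M3 \<Otimes>\<^sub>M M4)))) = (\<integral>\<^sup>+x. \<integral>\<^sup>+p. f (x, p) \<partial>(M2 \<Otimes>\<^sub>M (M3 \<Otimes>\<^sub>M M4)) \<partial>M1)"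
    by (rule M234.P.nn_integral_fst[OF f, symmetric])
  also have "\<dots> = (\<integral>\<^sup>+x. \<integral>\<^sup>+y. \<integral>\<^sup>+p. f (x, y, p) \<partial>(M3 \<Otimes>\<^sub>M M4) \<partial>M2 \<partial>M1)"
    by (rule nn_integral_cong, rule M34.P.nn_integral_fst[OF f1, symmetric])
  also have "\<dots> = (\<integral>\<^sup>+x. \<integral>\<^sup>+y. \<integral>\<^sup>+z. \<integral>\<^sup>+w. f (x, y, z, w) \<partial>M4 \<partial>M3 \<partial>M2 \<partial>M1)"
    by (rule nn_integral_cong, rule nn_integral_cong, rule M4.nn_integral_fst[OF f2, symmetric])
  finally show ?thesis .
qed

definition block_measure where
  "block_measure N = lebesgue_fun (grid N) \<Otimes>\<^sub>M (lebesgue_fun {..<N} \<Otimes>\<^sub>M (lebesgue_fun {..<N} \<Otimes>\<^sub>M (lborel :: complex measure)))"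

lemma block_measurable:
  "(\<lambda>(D, b, c, a). restrict (block N D b c a) (grid (Suc N))) \<in> block_measure N \<rightarrow>\<^sub>M lebesgue_fun (grid (Suc N))"
  unfolding case_prod_beta
proof (rule measurable_restrict)
  fix p assume p: "p \<in> grid (Suc N)"
  obtain i j where ij: "p = (i, j)" by (cases p)
  have c: "(\<lambda>x. f x k) \<in> borel_measurable (block_measure N)"
    if "f \<in> block_measure N \<rightarrow>\<^sub>M lebesgue_fun I" "k \<in> I" for f :: "_ \<Rightarrow> 'i \<Rightarrow> complex" and I k
    using measurable_compose[OF that(1) measurable_component_singleton[OF that(2)]] by simp
  have m: "fst \<in> block_measure N \<rightarrow>\<^sub>M lebesgue_fun (grid N)"
    "(\<lambda>x. fst (snd x)) \<in> block_measure N \<rightarrow>\<^sub>M lebesgue_fun {..<N}"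
    "(\<lambda>x. fst (snd (snd x))) \<in> block_measure N \<rightarrow>\<^sub>M lebesgue_fun {..<N}"
    "(\<lambda>x. snd (snd (snd x))) \<in> block_measure N \<rightarrow>\<^sub>M lborel"
    unfolding block_measure_def by measurable
  show "(\<lambda>x. block N (fst x) (fst (snd x)) (fst (snd (snd x))) (snd (snd (snd x))) p)
      \<in> block_measure N \<rightarrow>\<^sub>M lborel"
    unfolding ij block_def
    by (cases "i < N"; cases "j < N") (use c[OF m(1)] c[OF m(2)] c[OF m(3)] m(4) in auto)
qed

text \<open>The preimage of a box under \<open>block\<close> is the product of four boxes. So the
  image of the product measure agrees with Lebesgue measure on boxes, and these determine
  it.\<close>

lemma nn_integral_grid_Suc:
  assumes F: "F \<in> borel_measurable (lebesgue_fun (grid (Suc N)))"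
  shows "(\<integral>\<^sup>+x. F x \<partial>lebesgue_fun (grid (Suc N))) =
    (\<integral>\<^sup>+D. \<integral>\<^sup>+b. \<integral>\<^sup>+c. \<integral>\<^sup>+a. F (restrict (block N D b c a) (grid (Suc N)))
      \<partial>lborel \<partial>lebesgue_fun {..<N} \<partial>lebesgue_fun {..<N} \<partial>lebesgue_fun (grid N))"
proof -
  let ?T = "\<lambda>(D, b, c, a). restrict (block N D b c a) (grid (Suc N))"
  let ?M = "lebesgue_fun (grid (Suc N))"
  have sf: "sigma_finite_measure (lebesgue_fun {..<N})" "sigma_finite_measure (lborel :: complex measure)"
    by (auto intro: sigma_finite_lebesgue_fun sigma_finite_lborel)

  interpret V: sigma_finite_measure "lebesgue_fun {..<N}" by (rule sf)
  interpret M34: pair_sigma_finite "lebesgue_fun {..<N}" "lborel :: complex measure" ..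
  interpret M234: pair_sigma_finite "lebesgue_fun {..<N}" "lebesgue_fun {..<N} \<Otimes>\<^sub>M (lborel :: complex measure)" ..
  have "distr (block_measure N) ?M ?T = ?M"
  proof (rule lborel_prod.PiM_eqI)
    fix A assume A: "\<And>p. p \<in> grid (Suc N) \<Longrightarrow> A p \<in> sets (lborel :: complex measure)"
    let ?R = "Pi\<^sub>E (grid N) A \<times> (Pi\<^sub>E {..<N} (\<lambda>j. A (N, j)) \<times> (Pi\<^sub>E {..<N} (\<lambda>i. A (i, N)) \<times> A (N, N)))"
    have pre: "?T -` (Pi\<^sub>E (grid (Suc N)) A) \<inter> space (block_measure N) = ?R"
    proof (intro subset_antisym subsetI)
      fix x assume "x \<in> ?T -` (Pi\<^sub>E (grid (Suc N)) A) \<inter> space (block_measure N)"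
      then obtain D b c a where x: "x = (D, b, c, a)" and
        sp: "D \<in> extensional (grid N)" "b \<in> extensional {..<N}" "c \<in> extensional {..<N}" and
        mem: "\<And>i j. i < Suc N \<Longrightarrow> j < Suc N \<Longrightarrow> block N D b c a (i, j) \<in> A (i, j)"
        by (cases x) (auto simp: block_measure_def space_pair_measure space_PiM PiE_iff)
      have "D (i, j) \<in> A (i, j)" if "i < N" "j < N" for i j using mem[of i j] that by (simp add: block_def)
      moreover have "b j \<in> A (N, j)" if "j < N" for j using mem[of N j] that by (simp add: block_def)
      moreover have "c i \<in> A (i, N)" if "i < N" for i using mem[of i N] that by (simp add: block_def)
      moreover have "a \<in> A (N, N)" using mem[of N N] by (simp add: block_def)
      ultimately show "x \<in> ?R" using sp by (auto simp: x PiE_iff)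
    next
      fix x assume "x \<in> ?R"
      then show "x \<in> ?T -` (Pi\<^sub>E (grid (Suc N)) A) \<inter> space (block_measure N)"
        by (cases x) (auto simp: block_measure_def space_pair_measure space_PiM PiE_iff block_def less_Suc_eq)
    qed
    have s: "Pi\<^sub>E (grid N) A \<in> sets (lebesgue_fun (grid N))"
      "Pi\<^sub>E {..<N} (\<lambda>j. A (N, j)) \<in> sets (lebesgue_fun {..<N})"
      "Pi\<^sub>E {..<N} (\<lambda>i. A (i, N)) \<in> sets (lebesgue_fun {..<N})"
      "A (N, N) \<in> sets lborel"
      using A by (auto intro!: sets_PiM_I_finite)
    have "emeasure (distr (block_measure N) ?M ?T) (Pi\<^sub>E (grid (Suc N)) A) = emeasure (block_measure N) ?R"
      unfolding pre[symmetric] using A by (intro emeasure_distr block_measurable sets_PiM_I_finite) auto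
    also have "\<dots> = emeasure (lebesgue_fun (grid N)) (Pi\<^sub>E (grid N) A) *
       (emeasure (lebesgue_fun {..<N}) (Pi\<^sub>E {..<N} (\<lambda>j. A (N, j))) *
       (emeasure (lebesgue_fun {..<N}) (Pi\<^sub>E {..<N} (\<lambda>i. A (i, N))) * emeasure lborel (A (N, N))))"
      unfolding block_measure_def using s
      by (simp add: M234.P.emeasure_pair_measure_Times M34.P.emeasure_pair_measure_Times lborel.emeasure_pair_measure_Times)
    also have "\<dots> = (\<Prod>p\<in>grid (Suc N). emeasure lborel (A p))"
    proof -
      have "emeasure (lebesgue_fun (grid N)) (Pi\<^sub>E (grid N) A) = (\<Prod>p\<in>grid N. emeasure lborel (A p))"
        using A by (intro lborel_prod.emeasure_PiM) auto
      moreover have "emeasure (lebesgue_fun {..<N}) (Pi\<^sub>E {..<N} (\<lambda>j. A (N, j))) = (\<Prod>j<N. emeasure lborel (A (N, j)))"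
        using A by (intro lborel_prod.emeasure_PiM) auto
      moreover have "emeasure (lebesgue_fun {..<N}) (Pi\<^sub>E {..<N} (\<lambda>i. A (i, N))) = (\<Prod>i<N. emeasure lborel (A (i, N)))"
        using A by (intro lborel_prod.emeasure_PiM) auto
      ultimately show ?thesis unfolding prod.grid_Suc by simp
    qed
    finally show "emeasure (distr (block_measure N) ?M ?T) (Pi\<^sub>E (grid (Suc N)) A)
        = (\<Prod>p\<in>grid (Suc N). emeasure lborel (A p))" .
  qed auto
  then have "(\<integral>\<^sup>+x. F x \<partial>?M) = (\<integral>\<^sup>+x. F x \<partial>distr (block_measure N) ?M ?T)" by simp
  also have "\<dots> = (\<integral>\<^sup>+x. F (?T x) \<partial>block_measure N)"
    by (rule nn_integral_distr[OF block_measurable]) (use F in simp)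
  also have "\<dots> = (\<integral>\<^sup>+D. \<integral>\<^sup>+b. \<integral>\<^sup>+c. \<integral>\<^sup>+a. F (?T (D, b, c, a))
      \<partial>lborel \<partial>lebesgue_fun {..<N} \<partial>lebesgue_fun {..<N} \<partial>lebesgue_fun (grid N))"
    unfolding block_measure_def
    by (rule nn_integral_pair4[OF sf(1) sf(1) sf(2)])
       (use measurable_compose[OF block_measurable F] in \<open>simp add: block_measure_def\<close>)
  finally show ?thesis by simp
qed

lemma mat_restrict_grid [simp]: "Matrix.mat n n (restrict f (grid n)) = Matrix.mat n n f"
  by (auto intro!: eq_matI)

text \<open>The determinant of z - X is affine in the corner entry, with slope minus its cofactor,
  and that cofactor is det(z - D). Solving for the corner at an eigenvalue gives the rational
  function q/p.\<close>

lemma chi_block_corner: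
  "chi (Suc N) (block N D b c a) = chi (Suc N) (block N D b c 0) - Polynomial.smult a (chi N D)"
proof (rule poly_eq_poly_eq_iff[THEN iffD1], rule ext)
  fix z
  let ?A = "\<lambda>a. Matrix.mat (Suc N) (Suc N) (\<lambda>(i, j). (if i = j then z else 0) - block N D b c a (i, j))"
  have "Determinant.det (?A a) = Determinant.det (?A 0) + (- a) * cofactor (?A 0) N N"
    by (rule det_add_entry) (auto simp: block_def)
  moreover have "cofactor (?A 0) N N = poly (chi N D) z"
    unfolding cofactor_def mat_delete_mat_last poly_char_poly_mat
    by (auto intro!: arg_cong[where f = Determinant.det] eq_matI simp: block_def)
  ultimately show "poly (chi (Suc N) (block N D b c a)) z
      = poly (chi (Suc N) (block N D b c 0) - Polynomial.smult a (chi N D)) z"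
    by (simp add: poly_char_poly_mat)
qed

section \<open>Generic coprimality of the characteristic polynomials of a matrix and of its leading
  block\<close>

lemma degree_monic_chi: "degree (chi n f) = n" "lead_coeff (chi n f) = 1"
  using degree_monic_char_poly[of "Matrix.mat n n f" n] by auto


text \<open>Here \<open>D\<close> has size \<open>Suc M\<close> and \<open>\<mu>\<close> is no
  eigenvalue of its leading M x M block. The determinant of \<mu> - X is affine in the last entry of
  \<open>c\<close> with slope minus a cofactor \<open>k b\<close>, and \<open>k b\<close> is affine
  in the last entry of \<open>b\<close> with slope \<open>poly (chi M D) \<mu>\<close>. Two
  applications of \<open>AE_affine_nonzero\<close> give the claim.\<close>

lemma AE_chi_block_nonzero:
  assumes nz: "poly (chi M D) \<mu> \<noteq> 0"
  shows "AE b in lebesgue_fun {..<Suc M}. AE c in lebesgue_fun {..<Suc M}.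
     poly (chi (Suc (Suc M)) (block (Suc M) D b c 0)) \<mu> \<noteq> 0"
proof -
  let ?N = "Suc M"
  let ?V = "lebesgue_fun {..<?N}"
  let ?A = "\<lambda>b c. Matrix.mat (Suc ?N) (Suc ?N) (\<lambda>(i, j). (if i = j then \<mu> else 0) - block ?N D b c 0 (i, j))"
  let ?Del = "\<lambda>b. mat_delete (?A b (\<lambda>_. 0)) M ?N"
  \<comment> \<open>This minor deletes the column that holds \<open>c\<close>, so \<open>c\<close>
    may be set to 0.\<close>
  define k where "k b = cofactor (?A b (\<lambda>_. 0)) M ?N" for b
  have Delc: "?Del b \<in> carrier_mat ?N ?N" for b
    using mat_delete_carrier[of "?A b (\<lambda>_. 0)" "Suc ?N" "Suc ?N" M ?N] by simp
  have k: "k b = - Determinant.det (?Del b)" for b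
    by (simp add: k_def cofactor_def power_add[symmetric])
  have cofD: "cofactor (?Del b) M M = poly (chi M D) \<mu>" for b
    unfolding cofactor_def poly_char_poly_mat
    by (auto intro!: arg_cong[where f = Determinant.det] eq_matI simp: mat_delete_def block_def)
  have comp: "(\<lambda>c. c i) \<in> borel_measurable ?V" if "i < ?N" for i
    using measurable_component_singleton[of i "{..<?N}" "\<lambda>_. lborel :: complex measure"] that by simp
  have "AE b in ?V. k b \<noteq> 0"
  proof (rule AE_affine_nonzero[where i = M])
    show "k \<in> borel_measurable ?V"
    proof -
      have "?Del b = Matrix.mat ?N ?N (\<lambda>(i, j). ?A b (\<lambda>_. 0) $$ (if i < M then i else Suc i, if j < ?N then j else Suc j))" for b
        by (rule eq_matI) (simp_all add: mat_delete_def)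
      then have eq: "k b = - Determinant.det (Matrix.mat ?N ?N (\<lambda>(i, j). ?A b (\<lambda>_. 0) $$ (if i < M then i else Suc i, if j < ?N then j else Suc j)))" for b
        by (simp add: k)
      show ?thesis unfolding eq[abs_def]
      proof (intro borel_measurable_uminus borel_measurable_det)
        fix i j assume "i < ?N" "j < ?N"
        then show "(\<lambda>b. (case (i, j) of (i, j) \<Rightarrow> ?A b (\<lambda>_. 0) $$ (if i < M then i else Suc i, if j < ?N then j else Suc j))) \<in> borel_measurable ?V"
          using comp[of j] by (cases "i < M") (auto simp: block_def)
      qed
    qed
    fix b :: "nat \<Rightarrow> complex" and t :: complex
    have "Determinant.det (?Del (b(M := b M + t))) = Determinant.det (?Del b) + (- t) * cofactor (?Del b) M M"
      by (rule det_add_entry[OF Delc _ _ Delc]) (auto simp: mat_delete_def block_def less_Suc_eq)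
    then show "k (b(M := b M + t)) = k b + t * poly (chi M D) \<mu>" by (simp add: k cofD)
  qed (use nz in auto)
  then show ?thesis
  proof eventually_elim
    case (elim b)
    show ?case
    proof (rule AE_affine_nonzero[where i = M and k = "- k b"])
      show "(\<lambda>c. poly (chi (Suc ?N) (block ?N D b c 0)) \<mu>) \<in> borel_measurable ?V"
      proof (rule borel_measurable_char_poly)
        fix i j assume "i < Suc ?N" "j < Suc ?N"
        show "(\<lambda>c. block ?N D b c 0 (i, j)) \<in> borel_measurable ?V"
          by (cases "i < ?N"; cases "j < ?N") (use comp[of i] in \<open>auto simp: block_def\<close>)
      qed simp
      fix c :: "nat \<Rightarrow> complex" and t :: complex
      have "mat_delete (?A b c) M ?N = ?Del b"
        by (rule eq_matI) (auto simp: mat_delete_def block_def)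
      then have "cofactor (?A b c) M ?N = k b" by (simp add: k_def cofactor_def)
      moreover have "Determinant.det (?A b (c(M := c M + t))) = Determinant.det (?A b c) + (- t) * cofactor (?A b c) M ?N"
        by (rule det_add_entry) (auto simp: block_def less_Suc_eq)
      ultimately show "poly (chi (Suc ?N) (block ?N D b (c(M := c M + t)) 0)) \<mu>
          = poly (chi (Suc ?N) (block ?N D b c 0)) \<mu> + t * - k b"
        by (simp add: poly_char_poly_mat)
    qed (use elim in auto)
  qed
qed

text \<open>Both matrices are cut from one entry function: size \<open>N\<close> selects the leading
  principal block. The condition says that q/p is in lowest terms.\<close>

definition minor_coprime :: "nat \<Rightarrow> (nat \<times> nat \<Rightarrow> complex) \<Rightarrow> bool" where
  "minor_coprime N X \<longleftrightarrow> (\<forall>\<mu>. poly (chi N X) \<mu> = 0 \<longrightarrow> poly (chi (Suc N) X) \<mu> \<noteq> 0)"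

text \<open>Changing the corner adds a multiple of the characteristic polynomial of
  \<open>D\<close>, which vanishes at the points in question.\<close>

lemma minor_coprime_block:
  "minor_coprime N (block N D b c a) \<longleftrightarrow> (\<forall>\<mu>. poly (chi N D) \<mu> = 0 \<longrightarrow> poly (chi (Suc N) (block N D b c 0)) \<mu> \<noteq> 0)"
proof -
  have "Matrix.mat N N (block N D b c a) = Matrix.mat N N D"
    by (rule eq_matI) (auto simp: block_def)
  then show ?thesis unfolding minor_coprime_def chi_block_corner[of N D b c a] by auto
qed

lemma measurable_minor_coprime:
  "{X \<in> space (lebesgue_fun (grid (Suc N))). \<not> minor_coprime N X} \<in> sets (lebesgue_fun (grid (Suc N)))"
proof -
  have c: "(\<lambda>X. X (i, j)) \<in> borel_measurable (lebesgue_fun (grid (Suc N)))" if "i < Suc N" "j < Suc N" for i j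
    using measurable_component_singleton[of "(i, j)" "grid (Suc N)" "\<lambda>_. lborel :: complex measure"] that by simp
  \<comment> \<open>A common root is a zero of a single continuous real function, the sum of the
    squared moduli.\<close>
  have "{X \<in> space (lebesgue_fun (grid (Suc N))). \<exists>\<mu>. (cmod (poly (chi N X) \<mu>))\<^sup>2 + (cmod (poly (chi (Suc N) X) \<mu>))\<^sup>2 = 0}
     \<in> sets (lebesgue_fun (grid (Suc N)))"
  proof (rule measurable_root_UNIV)
    fix z
    have "(\<lambda>X. poly (chi N X) z) \<in> borel_measurable (lebesgue_fun (grid (Suc N)))"
      "(\<lambda>X. poly (chi (Suc N) X) z) \<in> borel_measurable (lebesgue_fun (grid (Suc N)))"
      by (intro borel_measurable_char_poly c; simp)+
    then show "(\<lambda>X. (cmod (poly (chi N X) z))\<^sup>2 + (cmod (poly (chi (Suc N) X) z))\<^sup>2)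
        \<in> borel_measurable (lebesgue_fun (grid (Suc N)))" by measurable
  qed (intro continuous_intros)
  moreover have "(\<exists>\<mu>. (cmod (poly (chi N X) \<mu>))\<^sup>2 + (cmod (poly (chi (Suc N) X) \<mu>))\<^sup>2 = 0) \<longleftrightarrow> \<not> minor_coprime N X" for X
    by (auto simp: minor_coprime_def add_nonneg_eq_0_iff)
  ultimately show ?thesis by simp
qed

text \<open>Passage from iterated to joint almost-everywhere: the exceptional set is measurable and
  does not depend on the corner, so its measure is an iterated integral of 0.\<close>

lemma AE_minor_coprime:
  assumes ae: "AE D in lebesgue_fun (grid N). AE b in lebesgue_fun {..<N}. AE c in lebesgue_fun {..<N}.
     minor_coprime N (block N D b c 0)"
  shows "AE X in lebesgue_fun (grid (Suc N)). minor_coprime N X"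
proof -
  let ?M = "lebesgue_fun (grid (Suc N))"
  let ?S = "{X \<in> space ?M. \<not> minor_coprime N X}"
  note S = measurable_minor_coprime[of N]
  have "emeasure ?M ?S = (\<integral>\<^sup>+X. indicator ?S X \<partial>?M)" using S by simp
  also have "\<dots> = (\<integral>\<^sup>+D. \<integral>\<^sup>+b. \<integral>\<^sup>+c. \<integral>\<^sup>+a. indicator ?S (restrict (block N D b c a) (grid (Suc N)))
      \<partial>lborel \<partial>lebesgue_fun {..<N} \<partial>lebesgue_fun {..<N} \<partial>lebesgue_fun (grid N))"
    using S by (intro nn_integral_grid_Suc) auto
  also have "\<dots> = (\<integral>\<^sup>+D. \<integral>\<^sup>+b. \<integral>\<^sup>+c. 0 \<partial>lebesgue_fun {..<N} \<partial>lebesgue_fun {..<N} \<partial>lebesgue_fun (grid N))"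
  proof (rule nn_integral_cong_AE, use ae in eventually_elim)
    case (elim D)
    show ?case
    proof (rule nn_integral_cong_AE, use elim in eventually_elim)
      case (elim b)
      show ?case
      proof (rule nn_integral_cong_AE, use elim in eventually_elim)
        case (elim c)
        have "Matrix.mat N N (restrict f (grid (Suc N))) = Matrix.mat N N f" for f :: "nat \<times> nat \<Rightarrow> complex"
          by (rule eq_matI) auto
        then have "minor_coprime N (restrict (block N D b c a) (grid (Suc N)))" for a
          using elim by (simp only: minor_coprime_block[of N D b c 0] minor_coprime_block[of N D b c a, symmetric])
             (simp add: minor_coprime_def)
        then show ?case by simp
      qed
    qed
  qed
  finally have "emeasure ?M ?S = 0" by simp
  then show ?thesis using S by (intro AE_I[of _ _ ?S]) auto
qed

text \<open>Coprimality one size down says that no eigenvalue of \<open>D\<close> is an eigenvalue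
  of its leading block. So \<open>AE_chi_block_nonzero\<close> applies to each of the finitely many
  eigenvalues of \<open>D\<close>, which yields coprimality for the bordered matrix.\<close>

lemma AE_minor_coprime_nested:
  "AE D in lebesgue_fun (grid N). AE b in lebesgue_fun {..<N}. AE c in lebesgue_fun {..<N}.
     minor_coprime N (block N D b c 0)"
proof (induction N)
  case 0
  have "poly (chi 0 D) \<mu> \<noteq> 0" for D and \<mu> :: complex by (simp add: poly_char_poly_mat)
  then show ?case by (simp add: minor_coprime_block)
next
  case (Suc M)
  have "AE D in lebesgue_fun (grid (Suc M)). minor_coprime M D"
    using AE_minor_coprime[OF Suc.IH] .
  then show ?case
  proof eventually_elim
    case (elim D)
    let ?R = "{\<mu>. poly (chi (Suc M) D) \<mu> = 0}"
    have fin: "finite ?R"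
      using degree_monic_chi(2)[of "Suc M" D] by (intro poly_roots_finite) auto
    have "AE b in lebesgue_fun {..<Suc M}. \<forall>\<mu>\<in>?R. AE c in lebesgue_fun {..<Suc M}.
        poly (chi (Suc (Suc M)) (block (Suc M) D b c 0)) \<mu> \<noteq> 0"
      using elim by (intro AE_finite_allI[OF fin] AE_chi_block_nonzero) (auto simp: minor_coprime_def)
    then show ?case
    proof eventually_elim
      case (elim b)
      have "AE c in lebesgue_fun {..<Suc M}. \<forall>\<mu>\<in>?R.
          poly (chi (Suc (Suc M)) (block (Suc M) D b c 0)) \<mu> \<noteq> 0"
        using elim by (intro AE_finite_allI[OF fin]) auto
      then show ?case by eventually_elim (auto simp: minor_coprime_block)
    qed
  qed
qed

section \<open>Splitting off an eigenvalue\<close>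

definition frob :: "nat \<Rightarrow> (nat \<times> nat \<Rightarrow> complex) \<Rightarrow> real" where
  "frob n f = (\<Sum>p\<in>grid n. (cmod (f p))\<^sup>2)"

lemma frob_rows: "frob n f = (\<Sum>i<n. \<Sum>j<n. (cmod (f (i, j)))\<^sup>2)"
  by (simp add: frob_def sum.cartesian_product)

lemma frob_columns: "frob n f = (\<Sum>j<n. \<Sum>i<n. (cmod (f (i, j)))\<^sup>2)"
  unfolding frob_rows by (rule sum.swap)

text \<open>Expanding the squared moduli into double sums brings out the Gram matrix of the columns
  of \<open>h\<close>, which is the identity.\<close>

lemma sum_cmod_isometry:
  fixes h :: "nat \<Rightarrow> nat \<Rightarrow> complex"
  assumes h: "\<And>k l. k < n \<Longrightarrow> l < n \<Longrightarrow> (\<Sum>i<n. cnj (h i k) * h i l) = (if k = l then 1 else 0)"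
  shows "(\<Sum>i<n. (cmod (\<Sum>k<n. h i k * y k))\<^sup>2) = (\<Sum>k<n. (cmod (y k))\<^sup>2)"
proof -
  have "complex_of_real (\<Sum>i<n. (cmod (\<Sum>k<n. h i k * y k))\<^sup>2)
      = (\<Sum>i<n. (\<Sum>l<n. h i l * y l) * (\<Sum>k<n. cnj (h i k) * cnj (y k)))"
    by (simp only: of_real_sum complex_norm_square cnj_sum complex_cnj_mult)
  also have "\<dots> = (\<Sum>i<n. \<Sum>l<n. \<Sum>k<n. cnj (y k) * y l * (cnj (h i k) * h i l))"
    by (simp add: sum_product mult_ac)
  also have "\<dots> = (\<Sum>l<n. \<Sum>k<n. \<Sum>i<n. cnj (y k) * y l * (cnj (h i k) * h i l))"
    by (subst sum.swap, intro sum.cong refl sum.swap)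
  also have "\<dots> = (\<Sum>l<n. \<Sum>k<n. cnj (y k) * y l * (if k = l then 1 else 0))"
    by (intro sum.cong refl) (simp add: sum_distrib_left[symmetric] h)
  also have "\<dots> = (\<Sum>l<n. y l * cnj (y l))"
    by (intro sum.cong refl) (simp add: if_distrib[of "\<lambda>x. _ * x"] mult.commute cong: if_cong)
  also have "\<dots> = complex_of_real (\<Sum>k<n. (cmod (y k))\<^sup>2)"
    by (simp only: of_real_sum complex_norm_square)
  finally show ?thesis by (simp only: of_real_eq_iff)
qed

text \<open>Reflections are the only unitaries used. Such a matrix is its own inverse and its own
  adjoint, so conjugation takes the form \<open>H * A * H\<close>.\<close>

definition hermitian_involution :: "nat \<Rightarrow> complex mat \<Rightarrow> bool" where
  "hermitian_involution n H \<longleftrightarrow> H \<in> carrier_mat n n \<and> H * H = 1\<^sub>m n \<and>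
     (\<forall>i<n. \<forall>j<n. cnj (H $$ (j, i)) = H $$ (i, j))"

lemma hermitian_involution_sum:
  assumes "hermitian_involution n H" "i < n" "j < n"
  shows "(\<Sum>k<n. H $$ (i, k) * H $$ (k, j)) = (if i = j then 1 else 0)"
proof -
  have H: "H \<in> carrier_mat n n" "H * H = 1\<^sub>m n" using assms(1) by (auto simp: hermitian_involution_def)
  have "(H * H) $$ (i, j) = (\<Sum>k<n. H $$ (i, k) * H $$ (k, j))"
    using H(1) assms by (simp add: scalar_prod_def atLeast0LessThan)
  then show ?thesis using H(2) assms by simp
qed

text \<open>Left multiplication by an isometry preserves the norm of every column, right
  multiplication that of every row.\<close>

lemma frob_conjugate:
  assumes H: "hermitian_involution n H" and A: "A \<in> carrier_mat n n"
  shows "frob n (($$) (H * A * H)) = frob n (($$) A)"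
proof -
  have Hc: "H \<in> carrier_mat n n" and herm: "\<And>i j. i < n \<Longrightarrow> j < n \<Longrightarrow> cnj (H $$ (j, i)) = H $$ (i, j)"
    using H by (auto simp: hermitian_involution_def)
  have left: "frob n (($$) (H * C)) = frob n (($$) C)" if C: "C \<in> carrier_mat n n" for C
  proof -
    have "(\<Sum>i<n. (cmod ((H * C) $$ (i, j)))\<^sup>2) = (\<Sum>i<n. (cmod (C $$ (i, j)))\<^sup>2)" if j: "j < n" for j
    proof -
      have "(\<Sum>i<n. (cmod (\<Sum>k<n. H $$ (i, k) * C $$ (k, j)))\<^sup>2) = (\<Sum>k<n. (cmod (C $$ (k, j)))\<^sup>2)"
      proof (rule sum_cmod_isometry)
        fix k l assume kl: "k < n" "l < n"
        have "(\<Sum>i<n. cnj (H $$ (i, k)) * H $$ (i, l)) = (\<Sum>i<n. H $$ (k, i) * H $$ (i, l))"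
          using kl by (intro sum.cong) (auto simp: herm)
        then show "(\<Sum>i<n. cnj (H $$ (i, k)) * H $$ (i, l)) = (if k = l then 1 else 0)"
          using hermitian_involution_sum[OF H kl] by simp
      qed
      moreover have "(H * C) $$ (i, j) = (\<Sum>k<n. H $$ (i, k) * C $$ (k, j))" if "i < n" for i
        using Hc C j that by (simp add: scalar_prod_def atLeast0LessThan)
      ultimately show ?thesis by simp
    qed
    then show ?thesis unfolding frob_columns by simp
  qed
  have right: "frob n (($$) (C * H)) = frob n (($$) C)" if C: "C \<in> carrier_mat n n" for C
  proof -
    have "(\<Sum>j<n. (cmod ((C * H) $$ (i, j)))\<^sup>2) = (\<Sum>j<n. (cmod (C $$ (i, j)))\<^sup>2)" if i: "i < n" for i
    proof -
      have "(\<Sum>j<n. (cmod (\<Sum>k<n. H $$ (k, j) * C $$ (i, k)))\<^sup>2) = (\<Sum>k<n. (cmod (C $$ (i, k)))\<^sup>2)"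
      proof (rule sum_cmod_isometry)
        fix k l assume kl: "k < n" "l < n"
        have "(\<Sum>j<n. cnj (H $$ (k, j)) * H $$ (l, j)) = (\<Sum>j<n. H $$ (l, j) * H $$ (j, k))"
          using kl by (intro sum.cong) (auto simp: herm mult.commute)
        then show "(\<Sum>j<n. cnj (H $$ (k, j)) * H $$ (l, j)) = (if k = l then 1 else 0)"
          using hermitian_involution_sum[OF H kl(2,1)] by auto
      qed
      moreover have "(C * H) $$ (i, j) = (\<Sum>k<n. H $$ (k, j) * C $$ (i, k))" if "j < n" for j
        using Hc C i that by (simp add: scalar_prod_def atLeast0LessThan mult.commute)
      ultimately show ?thesis by simp
    qed
    then show ?thesis unfolding frob_rows by simp
  qed
  show ?thesis using right[of "H * A"] left[OF A] Hc A by simp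
qed

lemma char_poly_conjugate:
  assumes H: "hermitian_involution n H" and A: "A \<in> carrier_mat n n"
  shows "char_poly (H * A * H) = char_poly A"
proof (rule char_poly_similar)
  have "similar_mat_wit (H * A * H) A H H"
    using H A by (intro similar_mat_witI[of _ _ n]) (auto simp: hermitian_involution_def)
  then show "similar_mat (H * A * H) A" unfolding similar_mat_def by blast
qed

(* The Householder reflection exchanging the direction of (v, 1) with the last basis vector. *)
lemma householder_exists:
  fixes v :: "nat \<Rightarrow> complex" and N :: nat
  defines "x \<equiv> (\<lambda>k. if k < N then v k else 1)"
  obtains H and s :: complex where "hermitian_involution (Suc N) H" "s \<noteq> 0"
    "\<And>m. m < Suc N \<Longrightarrow> (\<Sum>k<Suc N. H $$ (m, k) * x k) = (if m = N then s else 0)"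
    "\<And>m. m < Suc N \<Longrightarrow> s * H $$ (m, N) = x m"
proof -
  let ?n = "Suc N"
  define q where "q = (\<Sum>k<N. (cmod (v k))\<^sup>2)"
  define n where "n = sqrt (1 + q)"
  have q0: "q \<ge> 0" by (auto simp: q_def intro: sum_nonneg)
  have n1: "n \<ge> 1" "n\<^sup>2 = 1 + q" using q0 by (auto simp: n_def)
  \<comment> \<open>With n = |x| and u = x - n e_N, the reflection in the hyperplane orthogonal to
    \<open>u\<close> exchanges x and n e_N. The scalar handed over at the end is \<open>n\<close>;
    the local \<open>s\<close> is |u|^2.\<close>
  define u where "u k = x k - (if k = N then of_real n else 0)" for k
  define s where "s = (\<Sum>k<?n. (cmod (u k))\<^sup>2)"
  have u: "u k = (if k < N then v k else 1 - of_real n)" if "k < ?n" for k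
    using that by (auto simp: u_def x_def less_Suc_eq)
  have s: "s = 2 * (n\<^sup>2 - n)"
  proof -
    have "s = q + (cmod (1 - complex_of_real n))\<^sup>2" by (simp add: s_def q_def u)
    also have "1 - complex_of_real n = complex_of_real (1 - n)" by simp
    also have "cmod (complex_of_real (1 - n)) = \<bar>1 - n\<bar>" by (rule norm_of_real)
    finally show ?thesis using n1(2) by (simp add: power2_eq_square algebra_simps)
  qed
  have sc: "(\<Sum>k<?n. cnj (u k) * u k) = of_real s"
    unfolding s_def of_real_sum complex_norm_square by (simp add: mult.commute)
  have ux: "(\<Sum>k<?n. cnj (u k) * x k) = of_real (n\<^sup>2 - n)"
  proof -
    have "(\<Sum>k<?n. cnj (u k) * x k) = (\<Sum>k<N. cnj (v k) * v k) + (1 - of_real n)"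
      by (simp add: u x_def)
    also have "(\<Sum>k<N. cnj (v k) * v k) = of_real q"
      unfolding q_def of_real_sum complex_norm_square by (simp add: mult.commute)
    finally show ?thesis using n1(2) by simp
  qed
  \<comment> \<open>If \<open>v\<close> vanishes below \<open>N\<close> then u = 0 and s = 0;
    division by zero yields 0, and \<open>H\<close> is the identity, as it should be since x =
    e_N.\<close>
  define H where "H = Matrix.mat ?n ?n (\<lambda>(i, j). (if i = j then 1 else 0) - 2 * u i * cnj (u j) / of_real s)"
  have Hx: "(\<Sum>k<?n. H $$ (m, k) * x k) = (if m = N then of_real n else 0)" if m: "m < ?n" for m
  proof -
    have "(\<Sum>k<?n. H $$ (m, k) * x k) = (\<Sum>k<?n. (if m = k then x k else 0) - 2 * u m / of_real s * (cnj (u k) * x k))"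
      using m by (intro sum.cong) (auto simp: H_def left_diff_distrib)
    also have "\<dots> = x m - 2 * u m / of_real s * of_real (n\<^sup>2 - n)"
      unfolding ux[symmetric] sum_subtractf sum_distrib_left[symmetric] using m by (simp del: sum.lessThan_Suc)
    also have "\<dots> = x m - u m"
    proof (cases "s = 0")
      case True
      then have "(cmod (u m))\<^sup>2 = 0" unfolding s_def using m by (subst (asm) sum_nonneg_eq_0_iff) auto
      then show ?thesis by simp
    next
      case False
      have "complex_of_real (n\<^sup>2 - n) = complex_of_real s / 2" using s by simp
      then show ?thesis using False by (simp only:) simp
    qed
    finally show ?thesis by (simp add: u_def)
  qed
  have herm: "cnj (H $$ (j, i)) = H $$ (i, j)" if "i < ?n" "j < ?n" for i j
    using that by (simp add: H_def)
  have inv: "H * H = 1\<^sub>m ?n"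
  proof (rule eq_matI)
    fix i j assume "i < dim_row (1\<^sub>m ?n :: complex mat)" "j < dim_col (1\<^sub>m ?n :: complex mat)"
    then have ij: "i < ?n" "j < ?n" by auto
    have "(H * H) $$ (i, j) = (\<Sum>k<?n. H $$ (i, k) * H $$ (k, j))"
      using ij by (simp add: scalar_prod_def atLeast0LessThan H_def)
    also have "\<dots> = (\<Sum>k<?n. (if k = i then (if i = j then 1 else 0) - 2 * u i * cnj (u j) / of_real s else 0)
        - (if k = j then 2 * u i * cnj (u j) / of_real s else 0)
        + 4 * u i * cnj (u j) / (of_real s * of_real s) * (cnj (u k) * u k))"
      using ij by (intro sum.cong) (auto simp: H_def algebra_simps add_divide_distrib diff_divide_distrib)
    also have "\<dots> = (if i = j then 1 else 0) - 2 * u i * cnj (u j) / of_real s - 2 * u i * cnj (u j) / of_real s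
        + 4 * u i * cnj (u j) / (of_real s * of_real s) * of_real s"
      unfolding sc[symmetric] sum.distrib sum_subtractf sum_distrib_left[symmetric]
      using ij by (simp del: sum.lessThan_Suc)
    also have "\<dots> = (if i = j then 1 else 0)"
      by (cases "s = 0") auto
    finally show "(H * H) $$ (i, j) = 1\<^sub>m ?n $$ (i, j)" using ij by simp
  qed (auto simp: H_def)
  have Hi: "hermitian_involution ?n H"
    unfolding hermitian_involution_def using inv herm by (auto simp: H_def)
  \<comment> \<open>Applying the involution to H x = n e_N gives x = n H e_N.\<close>
  have "of_real n * H $$ (m, N) = x m" if m: "m < ?n" for m
  proof -
    have "of_real n * H $$ (m, N) = (\<Sum>l<?n. H $$ (m, l) * (if l = N then of_real n else 0))"
      by (simp add: if_distrib[of "\<lambda>x. _ * x"] cong: if_cong)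
    also have "\<dots> = (\<Sum>l<?n. H $$ (m, l) * (\<Sum>k<?n. H $$ (l, k) * x k))"
      by (intro sum.cong refl) (simp add: Hx del: sum.lessThan_Suc)
    also have "\<dots> = (\<Sum>k<?n. (\<Sum>l<?n. H $$ (m, l) * H $$ (l, k)) * x k)"
      unfolding sum_distrib_left sum_distrib_right by (subst sum.swap) (simp add: mult.assoc)
    also have "\<dots> = (\<Sum>k<?n. (if m = k then 1 else 0) * x k)"
      using m by (intro sum.cong refl) (simp add: hermitian_involution_sum[OF Hi] del: sum.lessThan_Suc)
    also have "\<dots> = x m" using m by (simp add: if_distrib[of "\<lambda>y. y * _"] cong: if_cong)
    finally show ?thesis .
  qed
  with Hi Hx show thesis using n1(1) by (intro that[of H "of_real n"]) auto
qed

section \<open>Deflation: conjugating the eigenvector onto the last basis vector\<close>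

lemma nn_integral_rect:
  assumes F: "F \<in> borel_measurable (lebesgue_fun ({..<Suc N} \<times> {..<N}))"
  shows "(\<integral>\<^sup>+x. F x \<partial>lebesgue_fun ({..<Suc N} \<times> {..<N})) =
    (\<integral>\<^sup>+D. \<integral>\<^sup>+b. F (restrict (block N D b (\<lambda>_. 0) 0) ({..<Suc N} \<times> {..<N})) \<partial>lebesgue_fun {..<N} \<partial>lebesgue_fun (grid N))"
proof -
  let ?K = "{..<Suc N} \<times> {..<N}"
  let ?T = "\<lambda>(D, b). restrict (block N D b (\<lambda>_. 0) 0) ?K"
  let ?M = "lebesgue_fun ?K" and ?P = "lebesgue_fun (grid N) \<Otimes>\<^sub>M lebesgue_fun {..<N}"
  interpret V: sigma_finite_measure "lebesgue_fun {..<N}" by (rule sigma_finite_lebesgue_fun) simp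
  have T: "?T \<in> ?P \<rightarrow>\<^sub>M ?M"
    unfolding case_prod_beta
  proof (rule measurable_restrict)
    fix p assume p: "p \<in> ?K"
    obtain i j where ij: "p = (i, j)" by (cases p)
    have c: "(\<lambda>x. f x k) \<in> borel_measurable ?P"
      if "f \<in> ?P \<rightarrow>\<^sub>M lebesgue_fun I" "k \<in> I" for f :: "_ \<Rightarrow> 'i \<Rightarrow> complex" and I k
      using measurable_compose[OF that(1) measurable_component_singleton[OF that(2)]] by simp
    show "(\<lambda>x. block N (fst x) (snd x) (\<lambda>_. 0) 0 p) \<in> ?P \<rightarrow>\<^sub>M lborel"
      unfolding ij block_def
      by (cases "i < N"; cases "j < N") (use c[OF measurable_fst] c[OF measurable_snd] in auto)
  qed
  have "distr ?P ?M ?T = ?M"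
  proof (rule lborel_prod.PiM_eqI)
    fix A assume A: "\<And>p. p \<in> ?K \<Longrightarrow> A p \<in> sets (lborel :: complex measure)"
    let ?R = "Pi\<^sub>E (grid N) A \<times> Pi\<^sub>E {..<N} (\<lambda>j. A (N, j))"
    have pre: "?T -` (Pi\<^sub>E ?K A) \<inter> space ?P = ?R"
    proof (intro subset_antisym subsetI)
      fix x assume "x \<in> ?T -` (Pi\<^sub>E ?K A) \<inter> space ?P"
      then obtain D b where x: "x = (D, b)" and
        sp: "D \<in> extensional (grid N)" "b \<in> extensional {..<N}" and
        mem: "\<And>i j. i < Suc N \<Longrightarrow> j < N \<Longrightarrow> block N D b (\<lambda>_. 0) 0 (i, j) \<in> A (i, j)"
        by (cases x) (auto simp: space_pair_measure space_PiM PiE_iff)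
      have "D (i, j) \<in> A (i, j)" if "i < N" "j < N" for i j using mem[of i j] that by (simp add: block_def)
      moreover have "b j \<in> A (N, j)" if "j < N" for j using mem[of N j] that by (simp add: block_def)
      ultimately show "x \<in> ?R" using sp by (auto simp: x PiE_iff)
    next
      fix x assume "x \<in> ?R"
      then show "x \<in> ?T -` (Pi\<^sub>E ?K A) \<inter> space ?P"
        by (cases x) (auto simp: space_pair_measure space_PiM PiE_iff block_def less_Suc_eq)
    qed
    have s: "Pi\<^sub>E (grid N) A \<in> sets (lebesgue_fun (grid N))"
      "Pi\<^sub>E {..<N} (\<lambda>j. A (N, j)) \<in> sets (lebesgue_fun {..<N})"
      using A by (auto intro!: sets_PiM_I_finite)
    have "emeasure (distr ?P ?M ?T) (Pi\<^sub>E ?K A) = emeasure ?P ?R"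
      unfolding pre[symmetric] using A by (intro emeasure_distr T sets_PiM_I_finite) auto
    also have "\<dots> = emeasure (lebesgue_fun (grid N)) (Pi\<^sub>E (grid N) A) *
       emeasure (lebesgue_fun {..<N}) (Pi\<^sub>E {..<N} (\<lambda>j. A (N, j)))"
      using s by (rule V.emeasure_pair_measure_Times)
    also have "\<dots> = (\<Prod>p\<in>grid N. emeasure lborel (A p)) * (\<Prod>p\<in>Pair N ` {..<N}. emeasure lborel (A p))"
    proof -
      have "emeasure (lebesgue_fun (grid N)) (Pi\<^sub>E (grid N) A) = (\<Prod>p\<in>grid N. emeasure lborel (A p))"
        using A by (intro lborel_prod.emeasure_PiM) auto
      moreover have "emeasure (lebesgue_fun {..<N}) (Pi\<^sub>E {..<N} (\<lambda>j. A (N, j))) = (\<Prod>j<N. emeasure lborel (A (N, j)))"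
        using A by (intro lborel_prod.emeasure_PiM) auto
      ultimately show ?thesis by (subst prod.reindex) (auto simp: inj_on_def)
    qed
    also have "\<dots> = (\<Prod>p\<in>grid N \<union> Pair N ` {..<N}. emeasure lborel (A p))"
      by (rule prod.union_disjoint[symmetric]) auto
    also have "grid N \<union> Pair N ` {..<N} = ?K" by (auto simp: less_Suc_eq)
    finally show "emeasure (distr ?P ?M ?T) (Pi\<^sub>E ?K A) = (\<Prod>p\<in>?K. emeasure lborel (A p))" .
  qed auto
  then have "(\<integral>\<^sup>+x. F x \<partial>?M) = (\<integral>\<^sup>+x. F x \<partial>distr ?P ?M ?T)" by simp
  also have "\<dots> = (\<integral>\<^sup>+x. F (?T x) \<partial>?P)"
    by (rule nn_integral_distr[OF T]) (use F in simp)
  also have "\<dots> = (\<integral>\<^sup>+D. \<integral>\<^sup>+b. F (?T (D, b)) \<partial>lebesgue_fun {..<N} \<partial>lebesgue_fun (grid N))"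
    by (rule V.nn_integral_fst[symmetric]) (use measurable_compose[OF T F] in simp)
  finally show ?thesis by simp
qed

lemma measurable_fun_of_mat:
  fixes G :: "complex mat \<Rightarrow> ennreal"
  assumes G: "(\<lambda>x. G (Matrix.mat n n x)) \<in> borel_measurable (lebesgue_fun (grid n))"
    and f: "\<And>i j. i < n \<Longrightarrow> j < n \<Longrightarrow> (\<lambda>x. f x (i, j)) \<in> borel_measurable M"
  shows "(\<lambda>x. G (Matrix.mat n n (f x))) \<in> borel_measurable M"
proof -
  have "(\<lambda>x. restrict (f x) (grid n)) \<in> M \<rightarrow>\<^sub>M lebesgue_fun (grid n)"
    by (rule measurable_restrict) (use f in auto)
  from measurable_compose[OF this G] show ?thesis by simp
qed

lemma index_mult_mat3:
  assumes "A \<in> carrier_mat n n" "B \<in> carrier_mat n n" "C \<in> carrier_mat n n" "i < n" "j < n"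
  shows "(A * B * C) $$ (i, j) = (\<Sum>k<n. (\<Sum>l<n. A $$ (i, l) * B $$ (l, k)) * C $$ (k, j))"
proof -
  have "(A * B * C) $$ (i, j) = (\<Sum>k<n. (A * B) $$ (i, k) * C $$ (k, j))"
    using assms by (subst index_mult_mat(1)) (auto simp: scalar_prod_def atLeast0LessThan)
  also have "\<dots> = (\<Sum>k<n. (\<Sum>l<n. A $$ (i, l) * B $$ (l, k)) * C $$ (k, j))"
    using assms by (intro sum.cong refl) (simp add: scalar_prod_def atLeast0LessThan)
  finally show ?thesis .
qed

lemma measurable_lebesgue_fun_component:
  assumes "f \<in> M \<rightarrow>\<^sub>M lebesgue_fun I" "k \<in> I"
  shows "(\<lambda>x. f x k) \<in> borel_measurable M"
  using measurable_compose[OF assms(1) measurable_component_singleton[OF assms(2)]] by simp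

definition conjugation_invariant :: "nat \<Rightarrow> (complex mat \<Rightarrow> ennreal) \<Rightarrow> bool" where
  "conjugation_invariant n G \<longleftrightarrow>
     (\<lambda>x. G (Matrix.mat n n x)) \<in> borel_measurable (lebesgue_fun (grid n)) \<and>
     (\<forall>H A. hermitian_involution n H \<longrightarrow> A \<in> carrier_mat n n \<longrightarrow> G (H * A * H) = G A)"

(* The matrices with eigenvalue l and eigenvector (v, 1). *)
definition eigen_block :: "nat \<Rightarrow> (nat \<times> nat \<Rightarrow> complex) \<Rightarrow> (nat \<Rightarrow> complex) \<Rightarrow> (nat \<Rightarrow> complex) \<Rightarrow> complex
    \<Rightarrow> nat \<times> nat \<Rightarrow> complex" where
  "eigen_block N D b v l = block N D b
     (mult_fun N (Matrix.mat N N (\<lambda>(i, j). (if i = j then l else 0) - D (i, j))) v) (l - (\<Sum>j<N. b j * v j))"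

lemma measurable_eigen_block:
  assumes D: "D \<in> M \<rightarrow>\<^sub>M lebesgue_fun (grid N)" and b: "b \<in> M \<rightarrow>\<^sub>M lebesgue_fun {..<N}"
    and v: "v \<in> M \<rightarrow>\<^sub>M lebesgue_fun {..<N}" and l: "l \<in> borel_measurable M"
  shows "(\<lambda>x. eigen_block N (D x) (b x) (v x) (l x) (i, j)) \<in> borel_measurable M"
proof -
  note [measurable] = l
  have [measurable]: "i < N \<Longrightarrow> j < N \<Longrightarrow> (\<lambda>x. D x (i, j)) \<in> borel_measurable M"
    "i < N \<Longrightarrow> (\<lambda>x. b x i) \<in> borel_measurable M" "i < N \<Longrightarrow> (\<lambda>x. v x i) \<in> borel_measurable M" for i j
    using measurable_lebesgue_fun_component[OF D, of "(i, j)"] measurable_lebesgue_fun_component[OF b, of i]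
      measurable_lebesgue_fun_component[OF v, of i] by auto
  consider "i < N" "j < N" | "i < N" "\<not> j < N" | "\<not> i < N" "j < N" | "\<not> i < N" "\<not> j < N" by blast
  then show ?thesis
  proof cases
    case 2
    have "(\<lambda>x. \<Sum>j<N. ((if i = j then l x else 0) - D x (i, j)) * v x j) \<in> borel_measurable M"
    proof (intro borel_measurable_sum borel_measurable_times borel_measurable_diff)
      fix j show "(\<lambda>x. if i = j then l x else 0) \<in> borel_measurable M" by (cases "i = j") auto
    qed (use 2 in auto)
    then show ?thesis using 2 by (simp add: eigen_block_def block_def mult_fun_def)
  next
    case 4
    have "(\<lambda>x. l x - (\<Sum>j<N. b x j * v x j)) \<in> borel_measurable M"
      by (intro borel_measurable_diff borel_measurable_sum borel_measurable_times) auto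
    then show ?thesis using 4 by (simp add: eigen_block_def block_def)
  qed (auto simp: eigen_block_def block_def)
qed

text \<open>For fixed \<open>v\<close>, matrices X with X (v, 1) = l (v, 1) are l plus a linear
  family: the first N columns of X - l are free and determine the last one. Conjugation by the
  reflection maps this family linearly onto the matrices with zero last column, so uniqueness of
  Haar measure supplies a constant. It is common to all \<open>G\<close> and \<open>l\<close>, since
  neither enters the linear map.\<close>

lemma nn_integral_deflate:
  "\<exists>\<kappa>. \<forall>G l. conjugation_invariant (Suc N) G \<longrightarrow>
    (\<integral>\<^sup>+D. \<integral>\<^sup>+b. G (Matrix.mat (Suc N) (Suc N) (eigen_block N D b v l)) \<partial>lebesgue_fun {..<N} \<partial>lebesgue_fun (grid N))
    = \<kappa> * (\<integral>\<^sup>+D. \<integral>\<^sup>+b. G (Matrix.mat (Suc N) (Suc N) (block N D b (\<lambda>_. 0) l)) \<partial>lebesgue_fun {..<N} \<partial>lebesgue_fun (grid N))"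
proof -
  let ?n = "Suc N" and ?K = "{..<Suc N} \<times> {..<N}"
  let ?V = "lebesgue_fun {..<N}" and ?D = "lebesgue_fun (grid N)"
  interpret V: sigma_finite_measure ?V by (rule sigma_finite_lebesgue_fun) simp
  obtain H s where H: "hermitian_involution ?n H" and s: "s \<noteq> 0" and
    Hx: "\<And>m. m < ?n \<Longrightarrow> (\<Sum>k<?n. H $$ (m, k) * (if k < N then v k else 1)) = (if m = N then s else 0)" and
    HN: "\<And>m. m < ?n \<Longrightarrow> s * H $$ (m, N) = (if m < N then v m else 1)"
    by (rule householder_exists[of N v]) blast
  have Hc: "H \<in> carrier_mat ?n ?n" and HH: "H * H = 1\<^sub>m ?n" using H by (auto simp: hermitian_involution_def)
  \<comment> \<open>\<open>X0\<close> completes N columns by the last column forced by the kernel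
    vector (v, 1), \<open>Y0\<close> by a zero column.\<close>
  define X0 where "X0 Z = (\<lambda>(i, j). if j < N then Z (i, j) else - (\<Sum>k<N. Z (i, k) * v k))" for Z :: "nat \<times> nat \<Rightarrow> complex"
  define Y0 where "Y0 Z = (\<lambda>(i, j). if j < N then Z (i, j) else 0)" for Z :: "nat \<times> nat \<Rightarrow> complex"
  define XM where "XM Z = Matrix.mat ?n ?n (X0 Z)" for Z
  define YM where "YM Z = Matrix.mat ?n ?n (Y0 Z)" for Z
  have XMc: "XM Z \<in> carrier_mat ?n ?n" and YMc: "YM Z \<in> carrier_mat ?n ?n" for Z
    by (auto simp: XM_def YM_def)
  define f where "f Z = (\<lambda>p\<in>?K. (H * XM Z * H) $$ p)" for Z
  \<comment> \<open>Up to the scalar \<open>s\<close>, the last column of \<open>H\<close> is (v,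
    1), which \<open>XM Z\<close> annihilates.\<close>
  have last0: "(H * XM Z * H) $$ (i, N) = 0" if i: "i < ?n" for Z i
  proof -
    have "s * (H * XM Z * H) $$ (i, N) = (\<Sum>k<?n. (\<Sum>l<?n. H $$ (i, l) * XM Z $$ (l, k)) * (s * H $$ (k, N)))"
      using index_mult_mat3[OF Hc XMc Hc i, of N] by (simp add: sum_distrib_left mult_ac del: sum.lessThan_Suc)
    also have "\<dots> = (\<Sum>k<?n. (\<Sum>l<?n. H $$ (i, l) * XM Z $$ (l, k)) * (if k < N then v k else 1))"
      by (intro sum.cong refl) (simp add: HN)
    also have "\<dots> = (\<Sum>l<?n. H $$ (i, l) * (\<Sum>k<?n. XM Z $$ (l, k) * (if k < N then v k else 1)))"
      unfolding sum_distrib_left sum_distrib_right by (subst sum.swap) (simp add: mult.assoc)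
    also have "\<dots> = 0"
      by (intro sum.neutral) (simp add: XM_def X0_def)
    finally show ?thesis using s by simp
  qed
  have YMf: "YM (f Z) = H * XM Z * H" for Z
  proof (rule eq_matI)
    fix i j assume "i < dim_row (H * XM Z * H)" "j < dim_col (H * XM Z * H)"
    then have "i < ?n" "j < ?n" using Hc by auto
    then show "YM (f Z) $$ (i, j) = (H * XM Z * H) $$ (i, j)"
      using last0[of i Z] by (auto simp: YM_def Y0_def f_def less_Suc_eq)
  qed (use Hc in \<open>auto simp: YM_def\<close>)
  have XMf: "XM Z = H * YM (f Z) * H" for Z
  proof -
    have "H * (H * XM Z * H) * H = (H * H) * XM Z * (H * H)"
      using Hc XMc[of Z] by (simp add: assoc_mult_mat[of _ ?n ?n _ ?n _ ?n])
    then show ?thesis using XMc[of Z] by (simp add: YMf HH)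
  qed
  have X0m: "(\<lambda>Z. X0 Z (l, k)) \<in> borel_measurable (lebesgue_fun ?K)" if "l < ?n" for l k
  proof (cases "k < N")
    case True
    then show ?thesis using measurable_lebesgue_fun_component[OF measurable_ident_sets[OF refl], of "(l, k)" ?K] that
      by (simp add: X0_def)
  next
    case False
    have "(\<lambda>Z. - (\<Sum>k<N. Z (l, k) * v k)) \<in> borel_measurable (lebesgue_fun ?K)"
      using measurable_lebesgue_fun_component[OF measurable_ident_sets[OF refl], of _ ?K] that
      by (intro borel_measurable_uminus borel_measurable_sum borel_measurable_times borel_measurable_const) auto
    then show ?thesis using False by (simp add: X0_def)
  qed
  have fm: "f \<in> lebesgue_fun ?K \<rightarrow>\<^sub>M lebesgue_fun ?K"
    unfolding f_def[abs_def]
  proof (rule measurable_restrict)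
    fix p assume "p \<in> ?K"
    then obtain i j where p: "p = (i, j)" "i < ?n" "j < ?n" by auto
    have "(\<lambda>Z. \<Sum>k<?n. (\<Sum>l<?n. H $$ (i, l) * X0 Z (l, k)) * H $$ (k, j)) \<in> borel_measurable (lebesgue_fun ?K)"
      using X0m by (intro borel_measurable_sum borel_measurable_times borel_measurable_const) auto
    moreover have "(\<Sum>k<?n. (\<Sum>l<?n. H $$ (i, l) * X0 Z (l, k)) * H $$ (k, j)) = (H * XM Z * H) $$ p" for Z
      unfolding p(1) index_mult_mat3[OF Hc XMc Hc p(2,3)] by (intro sum.cong arg_cong2[where f = "(*)"] refl) (simp add: XM_def)
    ultimately show "(\<lambda>Z. (H * XM Z * H) $$ p) \<in> lebesgue_fun ?K \<rightarrow>\<^sub>M lborel" by simp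
  qed
  have fadd: "f (fun_add ?K Z Z') = fun_add ?K (f Z) (f Z')" for Z Z'
  proof (rule ext)
    fix p
    show "f (fun_add ?K Z Z') p = fun_add ?K (f Z) (f Z') p"
    proof (cases "p \<in> ?K")
      case True
      then obtain i j where p: "p = (i, j)" "i < ?n" "j < ?n" by auto
      have "XM (fun_add ?K Z Z') $$ (l, k) = XM Z $$ (l, k) + XM Z' $$ (l, k)" if "l < ?n" "k < ?n" for l k
        using that by (auto simp: XM_def X0_def fun_add_def sum.distrib ring_distribs)
      then have "(H * XM (fun_add ?K Z Z') * H) $$ (i, j) = (H * XM Z * H) $$ (i, j) + (H * XM Z' * H) $$ (i, j)"
        unfolding index_mult_mat3[OF Hc XMc Hc p(2,3)]
        by (simp add: ring_distribs sum.distrib del: sum.lessThan_Suc)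
      then show ?thesis using True p(1) by (simp add: f_def fun_add_def)
    qed (simp add: f_def fun_add_def)
  qed
  \<comment> \<open>Conjugate back: \<open>H\<close> maps (v, 1) to a multiple of e_N, which
    \<open>YM W\<close> annihilates. So \<open>H * YM W * H\<close> annihilates (v, 1) and has the
    form \<open>XM Z\<close>.\<close>
  have fsurj: "space (lebesgue_fun ?K) \<subseteq> f ` space (lebesgue_fun ?K)"
  proof
    fix W assume W: "W \<in> space (lebesgue_fun ?K)"
    define U where "U = H * YM W * H"
    have Uc: "U \<in> carrier_mat ?n ?n" using Hc YMc[of W] by (simp add: U_def)
    have Ux: "(\<Sum>k<?n. U $$ (i, k) * (if k < N then v k else 1)) = 0" if i: "i < ?n" for i
    proof -
      have "(\<Sum>k<?n. U $$ (i, k) * (if k < N then v k else 1))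
          = (\<Sum>k<?n. (\<Sum>m<?n. (\<Sum>l<?n. H $$ (i, l) * YM W $$ (l, m)) * H $$ (m, k)) * (if k < N then v k else 1))"
        unfolding U_def using index_mult_mat3[OF Hc YMc Hc i] by (intro sum.cong refl) simp
      also have "\<dots> = (\<Sum>m<?n. (\<Sum>l<?n. H $$ (i, l) * YM W $$ (l, m)) * (\<Sum>k<?n. H $$ (m, k) * (if k < N then v k else 1)))"
        unfolding sum_distrib_left[of "sum _ _"] sum_distrib_right[of _ _ "if _ then _ else _"]
        by (subst sum.swap) (simp add: mult.assoc del: sum.lessThan_Suc)
      also have "\<dots> = (\<Sum>m<?n. (\<Sum>l<?n. H $$ (i, l) * YM W $$ (l, m)) * (if m = N then s else 0))"
        by (intro sum.cong refl) (simp add: Hx del: sum.lessThan_Suc)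
      also have "\<dots> = 0"
        by (intro sum.neutral ballI) (auto simp: YM_def Y0_def intro!: sum.neutral simp del: sum.lessThan_Suc)
      finally show ?thesis .
    qed
    define Z where "Z = (\<lambda>p\<in>?K. U $$ p)"
    have "XM Z = U"
    proof (rule eq_matI)
      fix i j assume "i < dim_row U" "j < dim_col U"
      then have ij: "i < ?n" "j < ?n" using Uc by auto
      have "U $$ (i, N) = - (\<Sum>k<N. U $$ (i, k) * v k)"
        using Ux[OF ij(1)] by (simp add: eq_neg_iff_add_eq_0 add.commute)
      then show "XM Z $$ (i, j) = U $$ (i, j)"
        using ij by (auto simp: XM_def X0_def Z_def less_Suc_eq)
    qed (use Uc in \<open>auto simp: XM_def\<close>)
    then have "H * XM Z * H = (H * H) * YM W * (H * H)"
      using Hc YMc[of W] by (simp add: U_def assoc_mult_mat[of _ ?n ?n _ ?n _ ?n])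
    then have HXH: "H * XM Z * H = YM W" using YMc[of W] by (simp add: HH)
    have "f Z = W"
    proof (rule ext)
      fix p show "f Z p = W p"
        using W by (cases p) (auto simp: f_def HXH YM_def Y0_def space_PiM PiE_def extensional_def)
    qed
    moreover have "Z \<in> space (lebesgue_fun ?K)" by (auto simp: Z_def space_PiM)
    ultimately show "W \<in> f ` space (lebesgue_fun ?K)" by blast
  qed
  have "\<exists>\<kappa>. \<forall>g \<in> borel_measurable (lebesgue_fun ?K).
      (\<integral>\<^sup>+z. g (f z) \<partial>lebesgue_fun ?K) = \<kappa> * (\<integral>\<^sup>+z. g z \<partial>lebesgue_fun ?K)"
    by (rule nn_integral_lebesgue_fun_additive[OF _ fm fadd fsurj]) simp
  then obtain \<kappa> where \<kappa>: "\<And>g. g \<in> borel_measurable (lebesgue_fun ?K) \<Longrightarrow>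
      (\<integral>\<^sup>+z. g (f z) \<partial>lebesgue_fun ?K) = \<kappa> * (\<integral>\<^sup>+z. g z \<partial>lebesgue_fun ?K)" by blast
  have "(\<integral>\<^sup>+D. \<integral>\<^sup>+b. G (Matrix.mat ?n ?n (eigen_block N D b v l)) \<partial>?V \<partial>?D)
      = \<kappa> * (\<integral>\<^sup>+D. \<integral>\<^sup>+b. G (Matrix.mat ?n ?n (block N D b (\<lambda>_. 0) l)) \<partial>?V \<partial>?D)"
    if G: "conjugation_invariant ?n G" for G l
  proof -
    have Gm: "(\<lambda>x. G (Matrix.mat ?n ?n x)) \<in> borel_measurable (lebesgue_fun (grid ?n))"
      and Ginv: "\<And>A. A \<in> carrier_mat ?n ?n \<Longrightarrow> G (H * A * H) = G A"
      using G H by (auto simp: conjugation_invariant_def)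
    define g where "g Z = G (YM Z + l \<cdot>\<^sub>m 1\<^sub>m ?n)" for Z
    have Yl: "YM Z + l \<cdot>\<^sub>m 1\<^sub>m ?n = Matrix.mat ?n ?n (\<lambda>p. Y0 Z p + (if fst p = snd p then l else 0))" for Z
      by (rule eq_matI) (auto simp: YM_def)
    have gm: "g \<in> borel_measurable (lebesgue_fun ?K)"
      unfolding g_def[abs_def] Yl
    proof (rule measurable_fun_of_mat[OF Gm])
      fix i j assume ij: "i < ?n" "j < ?n"
      have "(\<lambda>Z. Y0 Z (i, j)) \<in> borel_measurable (lebesgue_fun ?K)"
        using measurable_lebesgue_fun_component[OF measurable_ident_sets[OF refl], of "(i, j)" ?K] ij
        by (cases "j < N") (auto simp: Y0_def)
      then show "(\<lambda>Z. Y0 Z (i, j) + (if fst (i, j) = snd (i, j) then l else 0)) \<in> borel_measurable (lebesgue_fun ?K)"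
        by simp
    qed
    have gf: "g (f Z) = G (XM Z + l \<cdot>\<^sub>m 1\<^sub>m ?n)" for Z
    proof -
      have "XM Z + l \<cdot>\<^sub>m 1\<^sub>m ?n = H * (YM (f Z) + l \<cdot>\<^sub>m 1\<^sub>m ?n) * H"
      proof -
        have "H * (l \<cdot>\<^sub>m 1\<^sub>m ?n) = l \<cdot>\<^sub>m H"
          using mult_smult_distrib[OF Hc one_carrier_mat, of l] right_mult_one_mat[OF Hc] by simp
        then have Hl: "H * (l \<cdot>\<^sub>m 1\<^sub>m ?n) * H = l \<cdot>\<^sub>m (H * H)"
          using mult_smult_assoc_mat[OF Hc Hc, of l] by simp
        have "H * (YM (f Z) + l \<cdot>\<^sub>m 1\<^sub>m ?n) * H = H * YM (f Z) * H + l \<cdot>\<^sub>m (H * H)"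
          using Hc YMc[of "f Z"]
          by (simp add: mult_add_distrib_mat[of _ ?n ?n] add_mult_distrib_mat[of _ ?n ?n] Hl)
        then show ?thesis by (simp add: XMf[symmetric] HH)
      qed
      then show ?thesis using Ginv[of "YM (f Z) + l \<cdot>\<^sub>m 1\<^sub>m ?n"] YMc by (simp add: g_def)
    qed
    \<comment> \<open>Translating \<open>D\<close> by l on the diagonal turns
      \<open>eigen_block\<close> into l plus the linear family \<open>XM\<close>.\<close>
    define sh where "sh = (\<lambda>p\<in>grid N. if fst p = snd p then l else 0)"
    have sh: "sh \<in> space ?D" by (auto simp: sh_def space_PiM)
    let ?r = "\<lambda>D b. restrict (block N D b (\<lambda>_. 0) 0) ?K"
    \<comment> \<open>\<open>v\<close> is an arbitrary function; its restriction is a point of the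
      space and defines the same \<open>eigen_block\<close>.\<close>
    have v': "(\<lambda>_. restrict v {..<N}) \<in> M \<rightarrow>\<^sub>M ?V" for M :: "((nat \<times> nat \<Rightarrow> complex) \<times> (nat \<Rightarrow> complex)) measure"
      by (rule measurable_const) (auto simp: space_PiM)
    have ev: "eigen_block N D b (restrict v {..<N}) l = eigen_block N D b v l" for D b
      by (auto simp: eigen_block_def mult_fun_def fun_eq_iff block_def)
    have e1: "(\<lambda>D. \<integral>\<^sup>+b. G (Matrix.mat ?n ?n (eigen_block N D b v l)) \<partial>?V) \<in> borel_measurable ?D"
    proof (rule V.borel_measurable_nn_integral)
      show "(\<lambda>(D, b). G (Matrix.mat ?n ?n (eigen_block N D b v l))) \<in> borel_measurable (?D \<Otimes>\<^sub>M ?V)"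
        unfolding case_prod_beta'
        using measurable_eigen_block[OF measurable_fst measurable_snd v' measurable_const[of l]]
        by (intro measurable_fun_of_mat[OF Gm]) (simp add: ev)
    qed
    have e2: "(\<lambda>D. \<integral>\<^sup>+b. G (Matrix.mat ?n ?n (block N D b (\<lambda>_. 0) l)) \<partial>?V) \<in> borel_measurable ?D"
    proof (rule V.borel_measurable_nn_integral)
      show "(\<lambda>(D, b). G (Matrix.mat ?n ?n (block N D b (\<lambda>_. 0) l))) \<in> borel_measurable (?D \<Otimes>\<^sub>M ?V)"
        unfolding case_prod_beta'
      proof (rule measurable_fun_of_mat[OF Gm])
        fix i j
        show "(\<lambda>x. block N (fst x) (snd x) (\<lambda>_. 0) l (i, j)) \<in> borel_measurable (?D \<Otimes>\<^sub>M ?V)"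
          using measurable_lebesgue_fun_component[OF measurable_fst, of "(i, j)" "grid N" ?V]
            measurable_lebesgue_fun_component[OF measurable_snd, of j "{..<N}" ?D]
          by (cases "i < N"; cases "j < N") (auto simp: block_def)
      qed
    qed
    have p1: "Matrix.mat ?n ?n (eigen_block N (fun_add (grid N) D sh) b v l) = XM (?r D b) + l \<cdot>\<^sub>m 1\<^sub>m ?n" for D b
    proof (rule eq_matI)
      fix i j assume "i < dim_row (XM (?r D b) + l \<cdot>\<^sub>m 1\<^sub>m ?n)" "j < dim_col (XM (?r D b) + l \<cdot>\<^sub>m 1\<^sub>m ?n)"
      then have ij: "i < ?n" "j < ?n" by auto
      have "((if i = k then l else 0) - (D (i, k) + (if i = k then l else 0))) * v k = - (D (i, k) * v k)" for k
        by auto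
      then have c: "(\<Sum>k<N. ((if i = k then l else 0) - (D (i, k) + (if i = k then l else 0))) * v k) = - (\<Sum>k<N. D (i, k) * v k)"
        by (simp add: sum_negf)
      consider "i < N" "j < N" | "i < N" "j = N" | "i = N" "j < N" | "i = N" "j = N" using ij by linarith
      then show "Matrix.mat ?n ?n (eigen_block N (fun_add (grid N) D sh) b v l) $$ (i, j) = (XM (?r D b) + l \<cdot>\<^sub>m 1\<^sub>m ?n) $$ (i, j)"
      proof cases
        case 2
        then show ?thesis using c
          by (simp add: eigen_block_def block_def XM_def X0_def mult_fun_def fun_add_def sh_def cong: if_cong)
      qed (auto simp: eigen_block_def block_def XM_def X0_def fun_add_def sh_def)
    qed (auto simp: XM_def)
    have p2: "Matrix.mat ?n ?n (block N (fun_add (grid N) D sh) b (\<lambda>_. 0) l) = YM (?r D b) + l \<cdot>\<^sub>m 1\<^sub>m ?n" for D b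
      by (rule eq_matI) (auto simp: YM_def Y0_def block_def fun_add_def sh_def less_Suc_eq)
    have "(\<integral>\<^sup>+D. \<integral>\<^sup>+b. G (Matrix.mat ?n ?n (eigen_block N D b v l)) \<partial>?V \<partial>?D)
        = (\<integral>\<^sup>+D. \<integral>\<^sup>+b. g (f (?r D b)) \<partial>?V \<partial>?D)"
      using nn_integral_lebesgue_fun_translate[OF _ sh e1] unfolding p1 gf by simp
    also have "\<dots> = (\<integral>\<^sup>+Z. g (f Z) \<partial>lebesgue_fun ?K)"
      by (rule nn_integral_rect[OF measurable_compose[OF fm gm], symmetric])
    also have "\<dots> = \<kappa> * (\<integral>\<^sup>+Z. g Z \<partial>lebesgue_fun ?K)" by (rule \<kappa>[OF gm])
    also have "(\<integral>\<^sup>+Z. g Z \<partial>lebesgue_fun ?K) = (\<integral>\<^sup>+D. \<integral>\<^sup>+b. g (?r D b) \<partial>?V \<partial>?D)"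
      by (rule nn_integral_rect[OF gm])
    also have "\<dots> = (\<integral>\<^sup>+D. \<integral>\<^sup>+b. G (Matrix.mat ?n ?n (block N D b (\<lambda>_. 0) l)) \<partial>?V \<partial>?D)"
      using nn_integral_lebesgue_fun_translate[OF _ sh e2] unfolding p2 g_def by simp
    finally show ?thesis .
  qed
  then show ?thesis by blast
qed

section \<open>Gaussian integrals over the plane and over finite families\<close>

lemma lborel_Complex: "(lborel :: complex measure) = distr (lborel \<Otimes>\<^sub>M lborel) borel (\<lambda>(x, y). Complex x y)"
proof (rule lborel_eqI)
  have m: "(\<lambda>(x, y). Complex x y) \<in> borel_measurable (borel \<Otimes>\<^sub>M borel)"
    unfolding Complex_eq by measurable
  fix l u :: complex
  assume le: "\<And>b. b \<in> Basis \<Longrightarrow> l \<bullet> b \<le> u \<bullet> b"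
  have le': "Re l \<le> Re u" "Im l \<le> Im u" using le[of 1] le[of \<i>] by (auto simp: Basis_complex_def)
  have "(\<lambda>(x, y). Complex x y) -` box l u \<inter> space (lborel \<Otimes>\<^sub>M lborel) = {Re l<..<Re u} \<times> {Im l<..<Im u}"
    by (auto simp: box_def Basis_complex_def space_pair_measure)
  then have "emeasure (distr (lborel \<Otimes>\<^sub>M lborel) borel (\<lambda>(x, y). Complex x y)) (box l u)
      = emeasure (lborel \<Otimes>\<^sub>M lborel) ({Re l<..<Re u} \<times> {Im l<..<Im u})"
    using m by (subst emeasure_distr) auto
  also have "\<dots> = ennreal ((Re u - Re l) * (Im u - Im l))"
    using le' by (subst lborel.emeasure_pair_measure_Times) (auto simp: ennreal_mult')
  also have "(Re u - Re l) * (Im u - Im l) = (\<Prod>b\<in>Basis. (u - l) \<bullet> b)"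
    by (simp add: Basis_complex_def inner_diff_left)
  finally show "emeasure (distr (lborel \<Otimes>\<^sub>M lborel) borel (\<lambda>(x, y). Complex x y)) (box l u)
      = ennreal (\<Prod>b\<in>Basis. (u - l) \<bullet> b)" .
qed auto

lemma nn_integral_exp_minus_square: "(\<integral>\<^sup>+x. ennreal (exp (- x\<^sup>2)) \<partial>lborel) = ennreal (sqrt pi)"
proof -
  \<comment> \<open>Variance 1/2 makes the normal density equal to exp(-x^2) divided by sqrt
    pi.\<close>
  have d: "normal_density 0 (1 / sqrt 2) x = exp (- x\<^sup>2) / sqrt pi" for x :: real
    by (simp add: normal_density_def power_divide)
  interpret prob_space "density lborel (normal_density 0 (1 / sqrt 2))"
    by (rule prob_space_normal_density) simp
  have "(\<integral>\<^sup>+x. ennreal (exp (- x\<^sup>2) / sqrt pi) \<partial>lborel) = 1"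
    using emeasure_space_1 by (simp add: emeasure_density d)
  then have "ennreal (sqrt pi) * (\<integral>\<^sup>+x. ennreal (exp (- x\<^sup>2) / sqrt pi) \<partial>lborel) = ennreal (sqrt pi)" by simp
  then have "(\<integral>\<^sup>+x. ennreal (sqrt pi) * ennreal (exp (- x\<^sup>2) / sqrt pi) \<partial>lborel) = ennreal (sqrt pi)"
    by (subst nn_integral_cmult) auto
  then show ?thesis by (simp add: ennreal_mult'[symmetric])
qed

lemma nn_integral_complex_gaussian: "(\<integral>\<^sup>+z. ennreal (exp (- (cmod z)\<^sup>2)) \<partial>lborel) = ennreal pi"
proof -
  have m: "(\<lambda>(x, y). Complex x y) \<in> borel_measurable (lborel \<Otimes>\<^sub>M lborel)"
    unfolding Complex_eq by measurable
  have "(\<integral>\<^sup>+z. ennreal (exp (- (cmod z)\<^sup>2)) \<partial>(lborel :: complex measure))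
      = (\<integral>\<^sup>+p. ennreal (exp (- (cmod (case p of (x, y) \<Rightarrow> Complex x y))\<^sup>2)) \<partial>(lborel \<Otimes>\<^sub>M lborel))"
    by (subst lborel_Complex, subst nn_integral_distr[OF m]) auto
  also have "\<dots> = (\<integral>\<^sup>+p. ennreal (exp (- (fst p)\<^sup>2)) * ennreal (exp (- (snd p)\<^sup>2)) \<partial>(lborel \<Otimes>\<^sub>M lborel))"
    by (intro nn_integral_cong) (auto simp: cmod_power2 ennreal_mult'[symmetric] exp_add[symmetric])
  also have "\<dots> = (\<integral>\<^sup>+x. \<integral>\<^sup>+y. ennreal (exp (- x\<^sup>2)) * ennreal (exp (- y\<^sup>2)) \<partial>lborel \<partial>lborel)"
    by (subst lborel.nn_integral_fst[symmetric]) auto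
  also have "\<dots> = ennreal (sqrt pi) * ennreal (sqrt pi)"
    by (simp add: nn_integral_cmult nn_integral_multc nn_integral_exp_minus_square)
  also have "\<dots> = ennreal pi" by (simp add: ennreal_mult'[symmetric])
  finally show ?thesis .
qed

lemma nn_integral_gaussian_fun:
  assumes "finite I"
  shows "(\<integral>\<^sup>+x. ennreal (exp (- (\<Sum>i\<in>I. (cmod (x i))\<^sup>2))) \<partial>lebesgue_fun I) = ennreal (pi ^ card I)"
proof -
  have "(\<integral>\<^sup>+x. ennreal (exp (- (\<Sum>i\<in>I. (cmod (x i))\<^sup>2))) \<partial>lebesgue_fun I)
      = (\<integral>\<^sup>+x. (\<Prod>i\<in>I. ennreal (exp (- (cmod (x i))\<^sup>2))) \<partial>lebesgue_fun I)"
    using assms by (intro nn_integral_cong) (simp add: sum_negf[symmetric] exp_sum prod_ennreal)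
  also have "\<dots> = (\<Prod>i\<in>I. ennreal pi)"
    using assms by (subst lborel_prod.product_nn_integral_prod) (auto simp: nn_integral_complex_gaussian)
  finally show ?thesis by (simp add: ennreal_power)
qed

section \<open>Weights with a hole and marked points, and their measurability\<close>

definition hole_weight :: "real \<Rightarrow> complex list \<Rightarrow> complex poly \<Rightarrow> real" where
  "hole_weight r Ls p = (if \<exists>z\<in>ball 0 r. poly p z = 0 then 0 else (\<Prod>l\<leftarrow>Ls. (cmod (poly p l))\<^sup>2))"

lemma hole_weight_nonneg [simp]: "0 \<le> hole_weight r Ls p"
  by (auto simp: hole_weight_def intro!: prod_list_nonneg)

lemma hole_weight_Cons: "hole_weight r (l # Ls) p = (cmod (poly p l))\<^sup>2 * hole_weight r Ls p"
  by (simp add: hole_weight_def)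

text \<open>Both the hole condition and the product over the marked points are multiplicative in the
  polynomial. This separates the eigenvalue that is split off from the others.\<close>

lemma hole_weight_linear_factor:
  "hole_weight r Ls ([:- a, 1:] * p) = hole_weight r Ls [:- a, 1:] * hole_weight r Ls p"
proof -
  have "(\<Prod>l\<leftarrow>Ls. (cmod (poly ([:- a, 1:] * p) l))\<^sup>2) = (\<Prod>l\<leftarrow>Ls. (cmod (poly [:- a, 1:] l))\<^sup>2) * (\<Prod>l\<leftarrow>Ls. (cmod (poly p l))\<^sup>2)"
    unfolding poly_mult norm_mult power_mult_distrib by (induction Ls) (simp_all add: mult_ac)
  then show ?thesis by (auto simp: hole_weight_def simp del: mult_pCons_left)
qed

definition gaussian_hole_weight :: "nat \<Rightarrow> real \<Rightarrow> complex list \<Rightarrow> complex mat \<Rightarrow> ennreal" where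
  "gaussian_hole_weight n r Ls A = ennreal (hole_weight r Ls (char_poly A) * exp (- frob n (($$) A)))"

lemma frob_mat [simp]: "frob n (($$) (Matrix.mat n n f)) = frob n f"
  by (auto simp: frob_def intro!: sum.cong)

lemma measurable_frob:
  assumes "\<And>i j. i < n \<Longrightarrow> j < n \<Longrightarrow> (\<lambda>x. f x (i, j)) \<in> borel_measurable M"
  shows "(\<lambda>x. frob n (f x)) \<in> borel_measurable M"
proof -
  have [measurable]: "p \<in> grid n \<Longrightarrow> (\<lambda>x. f x p) \<in> borel_measurable M" for p
    using assms by (cases p) auto
  show ?thesis unfolding frob_def by measurable
qed

lemma measurable_grid_component: "i < n \<Longrightarrow> j < n \<Longrightarrow> (\<lambda>x. x (i, j)) \<in> borel_measurable (lebesgue_fun (grid n))"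
  using measurable_lebesgue_fun_component[OF measurable_ident_sets[OF refl], of "(i, j)" "grid n"] by simp

lemma measurable_frob_grid: "(\<lambda>x. frob n x) \<in> borel_measurable (lebesgue_fun (grid n))"
  by (rule measurable_frob[of n "\<lambda>x. x"]) (rule measurable_grid_component)

lemma nn_integral_exp_frob: "(\<integral>\<^sup>+X. ennreal (exp (- frob N X)) \<partial>lebesgue_fun (grid N)) = ennreal (pi ^ (N * N))"
  unfolding frob_def using nn_integral_gaussian_fun[of "grid N"] by simp

lemma frob_block_lower:
  "frob (Suc N) (block N D b (\<lambda>_. 0) l) = frob N D + ((\<Sum>j<N. (cmod (b j))\<^sup>2) + (cmod l)\<^sup>2)"
proof -
  have "(\<Sum>p\<in>grid N. (cmod (block N D b (\<lambda>_. 0) l p))\<^sup>2) = (\<Sum>p\<in>grid N. (cmod (D p))\<^sup>2)"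
    by (intro sum.cong refl) (auto simp: block_def)
  then show ?thesis unfolding frob_def sum.grid_Suc by (simp add: block_def)
qed

lemma measurable_hole_weight:
  assumes f: "\<And>i j. i < n \<Longrightarrow> j < n \<Longrightarrow> (\<lambda>x. f x (i, j)) \<in> borel_measurable M"
  shows "(\<lambda>x. hole_weight r Ls (chi n (f x))) \<in> borel_measurable M"
proof -
  have S: "{x \<in> space M. \<exists>z\<in>ball 0 r. cmod (poly (chi n (f x)) z) = 0} \<in> sets M"
  proof (rule measurable_root_ball)
    fix z
    have "(\<lambda>x. poly (chi n (f x)) z) \<in> borel_measurable M"
      by (rule borel_measurable_char_poly[where f = f, OF f]) auto
    then show "(\<lambda>x. cmod (poly (chi n (f x)) z)) \<in> borel_measurable M" by measurable
  qed (intro continuous_intros)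
  have P: "(\<lambda>x. \<Prod>l\<leftarrow>Ls. (cmod (poly (chi n (f x)) l))\<^sup>2) \<in> borel_measurable M"
  proof (induction Ls)
    case (Cons l Ls)
    have "(\<lambda>x. poly (chi n (f x)) l) \<in> borel_measurable M"
      by (rule borel_measurable_char_poly[where f = f, OF f]) auto
    with Cons show ?case by simp
  qed simp
  show ?thesis unfolding hole_weight_def
    using S by (intro measurable_If P borel_measurable_const) simp
qed

text \<open>\<open>[:- l, 1:]\<close> is the characteristic polynomial of the 1 x 1 matrix with
  entry \<open>l\<close>, so the statement for matrices applies.\<close>

lemma measurable_hole_weight_linear: "(\<lambda>l. hole_weight r Ls [:- l, 1:]) \<in> borel_measurable borel"
proof -
  have "chi 1 (\<lambda>_. l) = [:- l, 1:]" for l :: complex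
    by (rule poly_eq_poly_eq_iff[THEN iffD1], rule ext) (simp add: poly_char_poly_mat det_single[of _])
  then show ?thesis using measurable_hole_weight[of 1 "\<lambda>l _. l" borel r Ls] by simp
qed

lemma measurable_gaussian_hole_weight:
  assumes f: "\<And>i j. i < n \<Longrightarrow> j < n \<Longrightarrow> (\<lambda>x. f x (i, j)) \<in> borel_measurable M"
  shows "(\<lambda>x. gaussian_hole_weight n r Ls (Matrix.mat n n (f x))) \<in> borel_measurable M"
  unfolding gaussian_hole_weight_def frob_mat
  using measurable_hole_weight[where f = f, OF f] measurable_frob[where f = f, OF f] by measurable

text \<open>The derivative is the pointwise limit of difference quotients with increment 1/(k+1),
  each of which is measurable.\<close>

lemma borel_measurable_pderiv_char_poly:
  fixes f :: "'x \<Rightarrow> nat \<times> nat \<Rightarrow> complex"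
  assumes f: "\<And>i j. i < n \<Longrightarrow> j < n \<Longrightarrow> (\<lambda>x. f x (i, j)) \<in> borel_measurable M"
    and z: "z \<in> borel_measurable M"
  shows "(\<lambda>x. poly (pderiv (chi n (f x))) (z x)) \<in> borel_measurable M"
proof (rule borel_measurable_LIMSEQ_metric)
  let ?h = "\<lambda>k. 1 / of_nat (Suc k) :: complex"
  fix k
  have "(\<lambda>x. poly (chi n (f x)) (z x + ?h k)) \<in> borel_measurable M" "(\<lambda>x. poly (chi n (f x)) (z x)) \<in> borel_measurable M"
    using z by (auto intro!: borel_measurable_char_poly[where f = f, OF f])
  then show "(\<lambda>x. (poly (chi n (f x)) (z x + ?h k) - poly (chi n (f x)) (z x)) / ?h k) \<in> borel_measurable M"
    by measurable
next
  fix x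
  let ?h = "\<lambda>k. 1 / of_nat (Suc k) :: complex"
  have "((\<lambda>h. (poly (chi n (f x)) (z x + h) - poly (chi n (f x)) (z x)) / h) \<longlongrightarrow> poly (pderiv (chi n (f x))) (z x)) (at 0)"
    using poly_DERIV[of "chi n (f x)" "z x"] by (simp add: DERIV_def)
  moreover have "filterlim ?h (at 0) sequentially"
    using LIMSEQ_inverse_real_of_nat[THEN tendsto_of_real[where 'a = complex]]
    by (auto simp: filterlim_at inverse_eq_divide of_nat_Suc[symmetric] simp del: of_nat_Suc)
  ultimately show "(\<lambda>k. (poly (chi n (f x)) (z x + ?h k) - poly (chi n (f x)) (z x)) / ?h k) \<longlonglongrightarrow> poly (pderiv (chi n (f x))) (z x)"
    by (rule filterlim_compose)
qed

lemma chi_block_lower: "chi (Suc N) (block N D b (\<lambda>_. 0) l) = [:- l, 1:] * chi N D"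
proof (rule poly_eq_poly_eq_iff[THEN iffD1], rule ext)
  fix z
  let ?A = "Matrix.mat (Suc N) (Suc N) (\<lambda>(i, j). (if i = j then z else 0) - block N D b (\<lambda>_. 0) l (i, j))"
  have "Determinant.det ?A = (\<Sum>i<Suc N. ?A $$ (i, N) * cofactor ?A i N)"
    by (rule laplace_expansion_column) auto
  also have "\<dots> = (z - l) * cofactor ?A N N"
    by (simp add: block_def)
  also have "cofactor ?A N N = poly (chi N D) z"
    unfolding cofactor_def mat_delete_mat_last poly_char_poly_mat
    by (auto intro!: arg_cong[where f = Determinant.det] eq_matI simp: block_def)
  finally show "poly (chi (Suc N) (block N D b (\<lambda>_. 0) l)) z = poly ([:- l, 1:] * chi N D) z"
    by (simp add: poly_char_poly_mat algebra_simps)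
qed

lemma chi_eigen_block_root: "poly (chi (Suc N) (eigen_block N D b v l)) l = 0"
proof -
  let ?n = "Suc N"
  let ?A = "Matrix.mat ?n ?n (\<lambda>(i, j). (if i = j then l else 0) - eigen_block N D b v l (i, j))"
  let ?x = "Matrix.vec ?n (\<lambda>k. if k < N then v k else 1)"
  have "?A *\<^sub>v ?x = 0\<^sub>v ?n"
  proof (rule eq_vecI)
    fix i assume "i < dim_vec (0\<^sub>v ?n :: complex Matrix.vec)"
    then have i: "i < ?n" by simp
    have "vec_index (?A *\<^sub>v ?x) i = (\<Sum>k<?n. ?A $$ (i, k) * (if k < N then v k else 1))"
      using i by (simp add: scalar_prod_def atLeast0LessThan)
    also have "\<dots> = (\<Sum>k<N. ?A $$ (i, k) * v k) + ?A $$ (i, N)" by simp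
    also have "\<dots> = 0"
    proof (cases "i < N")
      case True
      then show ?thesis by (simp add: eigen_block_def block_def mult_fun_def)
    next
      case False
      then have "i = N" using i by simp
      then show ?thesis by (simp add: eigen_block_def block_def sum_negf)
    qed
    finally show "vec_index (?A *\<^sub>v ?x) i = vec_index (0\<^sub>v ?n) i" using i by simp
  qed auto
  moreover have "?x \<noteq> 0\<^sub>v ?n"
  proof
    assume "?x = 0\<^sub>v ?n"
    then have "vec_index ?x N = vec_index (0\<^sub>v ?n) N" by simp
    then show False by simp
  qed
  ultimately have "Determinant.det ?A = 0"
    by (intro iffD2[OF det_0_iff_vec_prod_zero[OF mat_carrier]] exI[of _ ?x] conjI vec_carrier)
  then show ?thesis by (simp add: poly_char_poly_mat)
qed

lemma nn_integral_swap_pairs: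
  assumes "sigma_finite_measure M1" "sigma_finite_measure M2" "sigma_finite_measure M3" "sigma_finite_measure M4"
    and f: "f \<in> borel_measurable ((M1 \<Otimes>\<^sub>M M2) \<Otimes>\<^sub>M (M3 \<Otimes>\<^sub>M M4))"
  shows "(\<integral>\<^sup>+x. \<integral>\<^sup>+y. \<integral>\<^sup>+z. \<integral>\<^sup>+w. f ((x, y), (z, w)) \<partial>M4 \<partial>M3 \<partial>M2 \<partial>M1)
       = (\<integral>\<^sup>+z. \<integral>\<^sup>+w. \<integral>\<^sup>+x. \<integral>\<^sup>+y. f ((x, y), (z, w)) \<partial>M2 \<partial>M1 \<partial>M4 \<partial>M3)"
proof -
  interpret M1: sigma_finite_measure M1 by fact
  interpret M2: sigma_finite_measure M2 by fact
  interpret M3: sigma_finite_measure M3 by fact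
  interpret M4: sigma_finite_measure M4 by fact
  interpret M12: pair_sigma_finite M1 M2 ..
  interpret M34: pair_sigma_finite M3 M4 ..
  interpret M: pair_sigma_finite "M1 \<Otimes>\<^sub>M M2" "M3 \<Otimes>\<^sub>M M4" ..
  have f1: "(\<lambda>q. f (p, q)) \<in> borel_measurable (M3 \<Otimes>\<^sub>M M4)" if "p \<in> space (M1 \<Otimes>\<^sub>M M2)" for p
    using measurable_compose[OF measurable_Pair1'[OF that] f] .
  have f2: "(\<lambda>p. f (p, q)) \<in> borel_measurable (M1 \<Otimes>\<^sub>M M2)" if "q \<in> space (M3 \<Otimes>\<^sub>M M4)" for q
    using measurable_compose[OF measurable_Pair2'[OF that] f] .
  have i1: "(\<lambda>p. \<integral>\<^sup>+q. f (p, q) \<partial>(M3 \<Otimes>\<^sub>M M4)) \<in> borel_measurable (M1 \<Otimes>\<^sub>M M2)"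
    by (rule M34.P.borel_measurable_nn_integral) (use f in simp)
  have i2: "(\<lambda>q. \<integral>\<^sup>+p. f (p, q) \<partial>(M1 \<Otimes>\<^sub>M M2)) \<in> borel_measurable (M3 \<Otimes>\<^sub>M M4)"
    by (rule M12.P.borel_measurable_nn_integral)
       (use measurable_compose[OF measurable_pair_swap'[of "M3 \<Otimes>\<^sub>M M4" "M1 \<Otimes>\<^sub>M M2"] f] in \<open>simp add: case_prod_beta'\<close>)
  have "(\<integral>\<^sup>+x. \<integral>\<^sup>+y. \<integral>\<^sup>+z. \<integral>\<^sup>+w. f ((x, y), (z, w)) \<partial>M4 \<partial>M3 \<partial>M2 \<partial>M1)
      = (\<integral>\<^sup>+x. \<integral>\<^sup>+y. \<integral>\<^sup>+q. f ((x, y), q) \<partial>(M3 \<Otimes>\<^sub>M M4) \<partial>M2 \<partial>M1)"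
    by (rule nn_integral_cong, rule nn_integral_cong, rule M4.nn_integral_fst[OF f1])
       (simp add: space_pair_measure)
  also have "\<dots> = (\<integral>\<^sup>+p. \<integral>\<^sup>+q. f (p, q) \<partial>(M3 \<Otimes>\<^sub>M M4) \<partial>(M1 \<Otimes>\<^sub>M M2))"
    by (rule M2.nn_integral_fst[OF i1])
  also have "\<dots> = (\<integral>\<^sup>+q. \<integral>\<^sup>+p. f (p, q) \<partial>(M1 \<Otimes>\<^sub>M M2) \<partial>(M3 \<Otimes>\<^sub>M M4))"
    by (rule M.Fubini'[symmetric]) (use f in simp)
  also have "\<dots> = (\<integral>\<^sup>+z. \<integral>\<^sup>+w. \<integral>\<^sup>+p. f (p, (z, w)) \<partial>(M1 \<Otimes>\<^sub>M M2) \<partial>M4 \<partial>M3)"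
    by (rule M4.nn_integral_fst[OF i2, symmetric])
  also have "\<dots> = (\<integral>\<^sup>+z. \<integral>\<^sup>+w. \<integral>\<^sup>+x. \<integral>\<^sup>+y. f ((x, y), (z, w)) \<partial>M2 \<partial>M1 \<partial>M4 \<partial>M3)"
    by (rule nn_integral_cong, rule nn_integral_cong, rule M2.nn_integral_fst[OF f2, symmetric])
       (simp add: space_pair_measure)
  finally show ?thesis .
qed

section \<open>The recursion that removes one eigenvalue\<close>

definition hole_integral :: "nat \<Rightarrow> real \<Rightarrow> complex list \<Rightarrow> ennreal" where
  "hole_integral N r Ls = (\<integral>\<^sup>+X. gaussian_hole_weight N r Ls (Matrix.mat N N X) \<partial>lebesgue_fun (grid N))"

text \<open>The factor |chi'(l)|^2 is the numerator of the Jacobian in the area formula; at an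
  eigenvalue \<open>l\<close> it is the product of |l - l_j|^2 over the other eigenvalues
  l_j.\<close>

definition marked_weight :: "nat \<Rightarrow> real \<Rightarrow> complex list \<Rightarrow> complex \<Rightarrow> complex mat \<Rightarrow> ennreal" where
  "marked_weight N r Ls l A = ennreal ((cmod (poly (pderiv (char_poly A)) l))\<^sup>2) * gaussian_hole_weight N r Ls A"

lemma measurable_marked_weight:
  assumes f: "\<And>i j. i < n \<Longrightarrow> j < n \<Longrightarrow> (\<lambda>x. f x (i, j)) \<in> borel_measurable M"
    and l: "l \<in> borel_measurable M"
  shows "(\<lambda>x. marked_weight n r Ls (l x) (Matrix.mat n n (f x))) \<in> borel_measurable M"
  unfolding marked_weight_def
  using borel_measurable_pderiv_char_poly[where f = f, OF f l] measurable_gaussian_hole_weight[where f = f, OF f]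
  by measurable

lemma gaussian_hole_weight_conjugate:
  "hermitian_involution n H \<Longrightarrow> A \<in> carrier_mat n n \<Longrightarrow>
    gaussian_hole_weight n r Ls (H * A * H) = gaussian_hole_weight n r Ls A"
  by (simp add: gaussian_hole_weight_def char_poly_conjugate frob_conjugate)

lemma conjugation_invariant_marked_weight: "conjugation_invariant n (marked_weight n r Ls l)"
proof -
  have "(\<lambda>x. marked_weight n r Ls l (Matrix.mat n n x)) \<in> borel_measurable (lebesgue_fun (grid n))"
    by (rule measurable_marked_weight[of n "\<lambda>x. x"]) (auto intro: measurable_grid_component)
  then show ?thesis
    by (auto simp: conjugation_invariant_def marked_weight_def char_poly_conjugate gaussian_hole_weight_conjugate)
qed

lemma measurable_corner:
  "(\<lambda>a. gaussian_hole_weight (Suc N) r Ls (Matrix.mat (Suc N) (Suc N) (block N D b c a))) \<in> borel_measurable lborel"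
proof (rule measurable_gaussian_hole_weight)
  fix i j show "(\<lambda>a. block N D b c a (i, j)) \<in> borel_measurable lborel"
    by (cases "i < N"; cases "j < N") (auto simp: block_def)
qed

(* Integrating out the corner entry a by the area formula: the eigenvalue l determines a = q(l)/p(l). *)
lemma corner_to_eigenvalue:
  assumes cop: "minor_coprime N (block N D b c 0)"
  defines "p \<equiv> chi N D" and "q \<equiv> chi (Suc N) (block N D b c 0)"
  shows "of_nat (Suc N) * (\<integral>\<^sup>+a. gaussian_hole_weight (Suc N) r Ls (Matrix.mat (Suc N) (Suc N) (block N D b c a)) \<partial>lborel)
    = (\<integral>\<^sup>+l. (if poly p l = 0 then 0 else ennreal (1 / (cmod (poly p l))\<^sup>2) *
         marked_weight (Suc N) r Ls l (Matrix.mat (Suc N) (Suc N) (block N D b c (poly q l / poly p l)))) \<partial>lborel)"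
proof -
  have "of_nat (Suc N) * (\<integral>\<^sup>+a. gaussian_hole_weight (Suc N) r Ls (Matrix.mat (Suc N) (Suc N) (block N D b c a)) \<partial>lborel)
    = (\<integral>\<^sup>+l. (if poly p l = 0 then 0 else
        ennreal ((cmod (poly (pderiv q) l - poly q l / poly p l * poly (pderiv p) l))\<^sup>2 / (cmod (poly p l))\<^sup>2)
          * gaussian_hole_weight (Suc N) r Ls (Matrix.mat (Suc N) (Suc N) (block N D b c (poly q l / poly p l)))) \<partial>lborel)"
    unfolding p_def q_def
  proof (rule nn_integral_rational_covering)
    fix z assume "poly (chi N D) z = 0"
    then show "poly (chi (Suc N) (block N D b c 0)) z \<noteq> 0" using cop by (simp add: minor_coprime_block)
  qed (use degree_monic_chi[of N D] degree_monic_chi[of "Suc N"] measurable_corner[of N r Ls D b c] in auto)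
  also have "\<dots> = (\<integral>\<^sup>+l. (if poly p l = 0 then 0 else ennreal (1 / (cmod (poly p l))\<^sup>2) *
         marked_weight (Suc N) r Ls l (Matrix.mat (Suc N) (Suc N) (block N D b c (poly q l / poly p l)))) \<partial>lborel)"
  proof (rule nn_integral_cong)
    fix l
    let ?a = "poly q l / poly p l"
    have "poly (pderiv (chi (Suc N) (block N D b c ?a))) l = poly (pderiv q) l - ?a * poly (pderiv p) l"
    proof -
      have "chi (Suc N) (block N D b c ?a) = q - Polynomial.smult ?a p"
        unfolding p_def q_def by (rule chi_block_corner)
      then show ?thesis by (simp add: pderiv_diff pderiv_smult)
    qed
    then show "(if poly p l = 0 then 0 else
        ennreal ((cmod (poly (pderiv q) l - poly q l / poly p l * poly (pderiv p) l))\<^sup>2 / (cmod (poly p l))\<^sup>2)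
          * gaussian_hole_weight (Suc N) r Ls (Matrix.mat (Suc N) (Suc N) (block N D b c (poly q l / poly p l))))
      = (if poly p l = 0 then 0 else ennreal (1 / (cmod (poly p l))\<^sup>2) *
         marked_weight (Suc N) r Ls l (Matrix.mat (Suc N) (Suc N) (block N D b c (poly q l / poly p l))))"
      by (simp add: marked_weight_def mult.assoc[symmetric] ennreal_mult'[symmetric])
  qed
  finally show ?thesis .
qed

(* For fixed l the column c = (l - D) v is parametrised by the eigenvector (v, 1). *)
lemma column_to_eigenvector:
  fixes D :: "nat \<times> nat \<Rightarrow> complex" and b :: "nat \<Rightarrow> complex" and N :: nat
  defines "p \<equiv> chi N D" and "q \<equiv> \<lambda>c. chi (Suc N) (block N D b c 0)"
  shows "(\<integral>\<^sup>+c. \<integral>\<^sup>+l. (if poly p l = 0 then 0 else ennreal (1 / (cmod (poly p l))\<^sup>2) *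
         marked_weight (Suc N) r Ls l (Matrix.mat (Suc N) (Suc N) (block N D b c (poly (q c) l / poly p l))))
         \<partial>lborel \<partial>lebesgue_fun {..<N})
    = (\<integral>\<^sup>+l. \<integral>\<^sup>+v. marked_weight (Suc N) r Ls l (Matrix.mat (Suc N) (Suc N) (eigen_block N D b v l))
         \<partial>lebesgue_fun {..<N} \<partial>lborel)"
proof -
  let ?n = "Suc N" and ?V = "lebesgue_fun {..<N}"
  interpret VL: pair_sigma_finite ?V "lborel :: complex measure"
    by (intro pair_sigma_finite.intro sigma_finite_lebesgue_fun sigma_finite_lborel) simp

  define \<Psi> where "\<Psi> c l = (if poly p l = 0 then 0 else ennreal (1 / (cmod (poly p l))\<^sup>2) *
         marked_weight ?n r Ls l (Matrix.mat ?n ?n (block N D b c (poly (q c) l / poly p l))))" for c l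
  have comp: "(\<lambda>x. fst x i) \<in> borel_measurable (?V \<Otimes>\<^sub>M (lborel :: complex measure))" if "i < N" for i
    using measurable_lebesgue_fun_component[OF measurable_fst, of i "{..<N}"] that by simp
  have pm: "(\<lambda>x. poly p (snd x)) \<in> borel_measurable (?V \<Otimes>\<^sub>M (lborel :: complex measure))"
    unfolding p_def by (rule borel_measurable_char_poly) auto
  have bm: "(\<lambda>x. block N D b (fst x) (h x) (i, j)) \<in> borel_measurable (?V \<Otimes>\<^sub>M (lborel :: complex measure))"
    if "h \<in> borel_measurable (?V \<Otimes>\<^sub>M (lborel :: complex measure))" for h i j
    using comp[of i] that by (cases "i < N"; cases "j < N") (auto simp: block_def)
  have qm: "(\<lambda>x. poly (q (fst x)) (snd x)) \<in> borel_measurable (?V \<Otimes>\<^sub>M (lborel :: complex measure))"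
    unfolding q_def by (rule borel_measurable_char_poly) (auto intro: bm)
  have "(\<lambda>x. marked_weight ?n r Ls (snd x) (Matrix.mat ?n ?n (block N D b (fst x) (poly (q (fst x)) (snd x) / poly p (snd x)))))
      \<in> borel_measurable (?V \<Otimes>\<^sub>M (lborel :: complex measure))"
    using pm qm by (intro measurable_marked_weight bm) auto
  then have \<Psi>m: "(\<lambda>x. \<Psi> (fst x) (snd x)) \<in> borel_measurable (?V \<Otimes>\<^sub>M (lborel :: complex measure))"
    unfolding \<Psi>_def using pm by measurable
  have fin: "finite {l. poly p l = 0}"
    using degree_monic_chi(2)[of N D] by (intro poly_roots_finite) (auto simp: p_def)
  have "(\<integral>\<^sup>+c. \<integral>\<^sup>+l. \<Psi> c l \<partial>lborel \<partial>?V) = (\<integral>\<^sup>+l. \<integral>\<^sup>+c. \<Psi> c l \<partial>?V \<partial>lborel)"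
    by (rule VL.Fubini'[symmetric]) (use \<Psi>m in \<open>simp add: case_prod_beta'\<close>)
  also have "\<dots> = (\<integral>\<^sup>+l. \<integral>\<^sup>+v. marked_weight ?n r Ls l (Matrix.mat ?n ?n (eigen_block N D b v l)) \<partial>?V \<partial>lborel)"
  proof (rule nn_integral_cong_AE)
    \<comment> \<open>The finitely many eigenvalues of \<open>D\<close> are excluded, since l - D is
      singular there.\<close>
    have "AE l in lborel. l \<notin> {l. poly p l = 0}"
      by (rule AE_not_in) (rule finite_imp_null_set_lborel[OF fin])
    then show "AE l in lborel. (\<integral>\<^sup>+c. \<Psi> c l \<partial>?V)
        = (\<integral>\<^sup>+v. marked_weight ?n r Ls l (Matrix.mat ?n ?n (eigen_block N D b v l)) \<partial>?V)"
    proof eventually_elim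
      case (elim l)
      then have pl: "poly p l \<noteq> 0" by simp
      let ?A = "Matrix.mat N N (\<lambda>(i, j). (if i = j then l else 0) - D (i, j))"
      \<comment> \<open>The substitution c = (l - D) v has determinant p(l); its real Jacobian
        |p(l)|^2 cancels the factor 1/|p(l)|^2 that came from the corner.\<close>
      have det: "Determinant.det ?A = poly p l" by (simp add: p_def poly_char_poly_mat)
      have m: "(\<lambda>c. \<Psi> c l) \<in> borel_measurable ?V"
        using measurable_compose[OF measurable_Pair2'[of l lborel ?V] \<Psi>m] by simp
      have "(\<integral>\<^sup>+c. \<Psi> c l \<partial>?V) = ennreal ((cmod (poly p l))\<^sup>2) * (\<integral>\<^sup>+v. \<Psi> (mult_fun N ?A v) l \<partial>?V)"
        using nn_integral_mult_fun[of ?A N, OF _ _ m] pl by (simp add: det)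
      also have "\<dots> = (\<integral>\<^sup>+v. ennreal ((cmod (poly p l))\<^sup>2) * \<Psi> (mult_fun N ?A v) l \<partial>?V)"
        by (rule nn_integral_cmult[symmetric]) (rule measurable_compose[OF mult_fun_measurable m])
      also have "\<dots> = (\<integral>\<^sup>+v. marked_weight ?n r Ls l (Matrix.mat ?n ?n (eigen_block N D b v l)) \<partial>?V)"
      proof (rule nn_integral_cong)
        fix v
        \<comment> \<open>Because (v, 1) is an eigenvector, the corner \<open>a\<close> of
          \<open>eigen_block\<close> solves q(l) - a p(l) = 0, so it is q(l)/p(l).\<close>
        have "poly (chi ?n (eigen_block N D b v l)) l = 0" by (rule chi_eigen_block_root)
        then have "poly (q (mult_fun N ?A v)) l - (l - (\<Sum>j<N. b j * v j)) * poly p l = 0"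
          unfolding eigen_block_def q_def p_def
          by (subst (asm) chi_block_corner) simp
        then have "poly (q (mult_fun N ?A v)) l / poly p l = l - (\<Sum>j<N. b j * v j)"
          using pl by (simp add: nonzero_divide_eq_eq)
        then have "block N D b (mult_fun N ?A v) (poly (q (mult_fun N ?A v)) l / poly p l) = eigen_block N D b v l"
          by (simp add: eigen_block_def)
        then show "ennreal ((cmod (poly p l))\<^sup>2) * \<Psi> (mult_fun N ?A v) l
            = marked_weight ?n r Ls l (Matrix.mat ?n ?n (eigen_block N D b v l))"
          using pl by (simp add: \<Psi>_def mult.assoc[symmetric] ennreal_mult'[symmetric])
      qed
      finally show ?case .
    qed
  qed
  finally show ?thesis unfolding \<Psi>_def .
qed

text \<open>The matrix is block triangular with characteristic polynomial (x - l) chi_D, whose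
  derivative at \<open>l\<close> is chi_D(l). So the Jacobian factor becomes a new marked point, and
  the norm splits into the parts of \<open>D\<close>, \<open>b\<close> and \<open>l\<close>.\<close>

lemma marked_weight_block_lower:
  "marked_weight (Suc N) r Ls l (Matrix.mat (Suc N) (Suc N) (block N D b (\<lambda>_. 0) l))
    = ennreal (hole_weight r Ls [:- l, 1:] * exp (- (cmod l)\<^sup>2)) *
      (gaussian_hole_weight N r (l # Ls) (Matrix.mat N N D) * ennreal (exp (- (\<Sum>j<N. (cmod (b j))\<^sup>2))))"
proof -
  have pd: "poly (pderiv ([:- l, 1:] * chi N D)) l = poly (chi N D) l"
    unfolding pderiv_mult by (simp add: pderiv_pCons)
  have ex: "exp (- (F + (S + L))) = exp (- L) * (exp (- F) * exp (- S))" for F S L :: real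
    by (simp add: exp_add[symmetric])
  have "ennreal P * ennreal (h * g * (eL * (eF * eS))) = ennreal (h * eL) * (ennreal (P * g * eF) * ennreal eS)"
    if "0 \<le> P" "0 \<le> h" "0 \<le> g" "0 \<le> eL" "0 \<le> eF" "0 \<le> eS" for P h g eL eF eS :: real
    using that by (simp add: ennreal_mult[symmetric] mult_ac)
  then show ?thesis
    unfolding marked_weight_def gaussian_hole_weight_def chi_block_lower pd frob_mat frob_block_lower hole_weight_linear_factor hole_weight_Cons ex
    by simp
qed


text \<open>The Gaussian is the test function from which the deflation constant is read off as a
  function of the eigenvector.\<close>

lemma conjugation_invariant_gaussian: "conjugation_invariant n (\<lambda>A. ennreal (exp (- frob n (($$) A))))"
  using measurable_frob_grid unfolding conjugation_invariant_def frob_mat by (auto simp: frob_conjugate)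

text \<open>The order of quantifiers matters: \<open>K\<close> is the same for all \<open>r\<close>
  and \<open>Ls\<close>. It gathers the deflation constants integrated over the eigenvectors, the
  Gaussian integral over \<open>b\<close>, and 1/(N + 1), because the area formula counts a matrix
  once for each of its N + 1 eigenvalues.\<close>

theorem hole_integral_Suc:
  "\<exists>K. \<forall>r Ls. hole_integral (Suc N) r Ls
     = K * (\<integral>\<^sup>+l. ennreal (hole_weight r Ls [:- l, 1:] * exp (- (cmod l)\<^sup>2)) * hole_integral N r (l # Ls) \<partial>lborel)"
proof -
  let ?n = "Suc N" and ?V = "lebesgue_fun {..<N}" and ?D = "lebesgue_fun (grid N)"
  interpret V: sigma_finite_measure ?V by (rule sigma_finite_lebesgue_fun) simp
  interpret D: sigma_finite_measure ?D by (rule sigma_finite_lebesgue_fun) simp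
  interpret DV: pair_sigma_finite ?D ?V ..
  define g0 where "g0 = (\<integral>\<^sup>+b. ennreal (exp (- (\<Sum>j<N. (cmod (b j))\<^sup>2))) \<partial>?V)"
  obtain \<kappa> where \<kappa>: "\<And>v G l. conjugation_invariant ?n G \<Longrightarrow>
    (\<integral>\<^sup>+D. \<integral>\<^sup>+b. G (Matrix.mat ?n ?n (eigen_block N D b v l)) \<partial>?V \<partial>?D)
    = \<kappa> v * (\<integral>\<^sup>+D. \<integral>\<^sup>+b. G (Matrix.mat ?n ?n (block N D b (\<lambda>_. 0) l)) \<partial>?V \<partial>?D)"
    using nn_integral_deflate[of N] by metis
  have [measurable]: "(\<lambda>b. b j) \<in> borel_measurable ?V" if "j < N" for j
    using measurable_lebesgue_fun_component[OF measurable_ident_sets[OF refl], of j "{..<N}"] that by simp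
  have Sm[measurable]: "(\<lambda>b. \<Sum>j<N. (cmod (b j))\<^sup>2) \<in> borel_measurable ?V" by measurable
  define c0 where "c0 = (\<integral>\<^sup>+D. \<integral>\<^sup>+b. ennreal (exp (- frob ?n (block N D b (\<lambda>_. 0) 0))) \<partial>?V \<partial>?D)"
  have c0: "c0 = ennreal (pi ^ (N * N)) * ennreal (pi ^ N)"
  proof -
    have "c0 = (\<integral>\<^sup>+D. \<integral>\<^sup>+b. ennreal (exp (- frob N D)) * ennreal (exp (- (\<Sum>j<N. (cmod (b j))\<^sup>2))) \<partial>?V \<partial>?D)"
      unfolding c0_def frob_block_lower by (simp add: exp_add[symmetric] ennreal_mult'[symmetric])
    also have "\<dots> = (\<integral>\<^sup>+D. ennreal (exp (- frob N D)) * ennreal (pi ^ N) \<partial>?D)"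
      using nn_integral_gaussian_fun[of "{..<N}"] by (intro nn_integral_cong) (simp add: nn_integral_cmult)
    also have "\<dots> = ennreal (pi ^ (N * N)) * ennreal (pi ^ N)"
      unfolding nn_integral_exp_frob[symmetric] using measurable_frob_grid[of N] by (intro nn_integral_multc) auto
    finally show ?thesis .
  qed
  have c0': "c0 \<noteq> 0" "c0 \<noteq> \<infinity>" unfolding c0 by (simp_all add: ennreal_mult_eq_top_iff)
  have evm: "(\<lambda>x. eigen_block N (fst (fst x)) (snd (fst x)) (snd (snd x)) (fst (snd x)) (i, j))
      \<in> borel_measurable ((?D \<Otimes>\<^sub>M ?V) \<Otimes>\<^sub>M ((lborel :: complex measure) \<Otimes>\<^sub>M ?V))" for i j
    by (rule measurable_eigen_block) measurable
  \<comment> \<open>The constant is chosen separately for every eigenvector, so its measurability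
    has to be proved. The deflation identity for the Gaussian writes \<open>\<kappa> v\<close> as an
    integral measurable in \<open>v\<close>, divided by \<open>c0\<close>, which is finite and
    nonzero.\<close>
  have \<kappa>m: "\<kappa> \<in> borel_measurable ?V"
  proof -
    have "\<kappa> v = (\<integral>\<^sup>+p. ennreal (exp (- frob ?n (eigen_block N (fst p) (snd p) v 0))) \<partial>(?D \<Otimes>\<^sub>M ?V)) / c0"
      if v: "v \<in> space ?V" for v
    proof -
      have "(\<lambda>p. frob ?n (eigen_block N (fst p) (snd p) v 0)) \<in> borel_measurable (?D \<Otimes>\<^sub>M ?V)"
      proof (rule measurable_frob)
        fix i j show "(\<lambda>p. eigen_block N (fst p) (snd p) v 0 (i, j)) \<in> borel_measurable (?D \<Otimes>\<^sub>M ?V)"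
          by (rule measurable_eigen_block[OF measurable_fst measurable_snd measurable_const[OF v]]) simp
      qed
      then have "(\<integral>\<^sup>+p. ennreal (exp (- frob ?n (eigen_block N (fst p) (snd p) v 0))) \<partial>(?D \<Otimes>\<^sub>M ?V))
          = (\<integral>\<^sup>+D. \<integral>\<^sup>+b. ennreal (exp (- frob ?n (eigen_block N D b v 0))) \<partial>?V \<partial>?D)"
        by (subst V.nn_integral_fst[symmetric]) simp_all
      also have "\<dots> = \<kappa> v * c0"
        using \<kappa>[OF conjugation_invariant_gaussian, of v 0] unfolding c0_def frob_mat .
      finally show ?thesis using c0' by (simp add: ennreal_times_divide[symmetric] ennreal_divide_self[OF c0'(1)] top.not_eq_extremum)
    qed
    moreover have "(\<lambda>v. (\<integral>\<^sup>+p. ennreal (exp (- frob ?n (eigen_block N (fst p) (snd p) v 0))) \<partial>(?D \<Otimes>\<^sub>M ?V)) / c0) \<in> borel_measurable ?V"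
    proof -
      have "(\<lambda>x. frob ?n (eigen_block N (fst (snd x)) (snd (snd x)) (fst x) 0)) \<in> borel_measurable (?V \<Otimes>\<^sub>M (?D \<Otimes>\<^sub>M ?V))"
      proof (rule measurable_frob)
        fix i j show "(\<lambda>x. eigen_block N (fst (snd x)) (snd (snd x)) (fst x) 0 (i, j)) \<in> borel_measurable (?V \<Otimes>\<^sub>M (?D \<Otimes>\<^sub>M ?V))"
          by (rule measurable_eigen_block) measurable
      qed
      then have "(\<lambda>v. \<integral>\<^sup>+p. ennreal (exp (- frob ?n (eigen_block N (fst p) (snd p) v 0))) \<partial>(?D \<Otimes>\<^sub>M ?V)) \<in> borel_measurable ?V"
        by (intro DV.P.borel_measurable_nn_integral) (simp add: case_prod_beta')
      then show ?thesis by measurable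
    qed
    ultimately show ?thesis by (subst measurable_cong) auto
  qed
  define K where "K = (\<integral>\<^sup>+v. \<kappa> v \<partial>?V) * g0 / of_nat ?n"
  have "hole_integral ?n r Ls
     = K * (\<integral>\<^sup>+l. ennreal (hole_weight r Ls [:- l, 1:] * exp (- (cmod l)\<^sup>2)) * hole_integral N r (l # Ls) \<partial>lborel)" for r Ls
  proof -
    let ?W = "\<lambda>D b c a. gaussian_hole_weight ?n r Ls (Matrix.mat ?n ?n (block N D b c a))"
    let ?h = "\<lambda>l. ennreal (hole_weight r Ls [:- l, 1:] * exp (- (cmod l)\<^sup>2))"
    define p where "p = chi N"
    define \<Psi> where "\<Psi> D b c l = (if poly (p D) l = 0 then 0 else ennreal (1 / (cmod (poly (p D) l))\<^sup>2) *
         marked_weight ?n r Ls l (Matrix.mat ?n ?n (block N D b c (poly (chi ?n (block N D b c 0)) l / poly (p D) l))))" for D b c l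
    have Wm: "(\<lambda>X. gaussian_hole_weight ?n r Ls (Matrix.mat ?n ?n X)) \<in> borel_measurable (lebesgue_fun (grid ?n))"
      by (rule measurable_gaussian_hole_weight[of ?n "\<lambda>x. x"]) (rule measurable_grid_component)
    have "of_nat ?n * hole_integral ?n r Ls
        = (\<integral>\<^sup>+X. of_nat ?n * gaussian_hole_weight ?n r Ls (Matrix.mat ?n ?n X) \<partial>lebesgue_fun (grid ?n))"
      unfolding hole_integral_def by (rule nn_integral_cmult[OF Wm, symmetric])
    also have "\<dots> = (\<integral>\<^sup>+D. \<integral>\<^sup>+b. \<integral>\<^sup>+c. \<integral>\<^sup>+a. of_nat ?n * ?W D b c a \<partial>lborel \<partial>?V \<partial>?V \<partial>?D)"
      using nn_integral_grid_Suc[OF borel_measurable_times_ennreal[OF borel_measurable_const Wm]] by simp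
    also have "\<dots> = (\<integral>\<^sup>+D. \<integral>\<^sup>+b. \<integral>\<^sup>+c. of_nat ?n * (\<integral>\<^sup>+a. ?W D b c a \<partial>lborel) \<partial>?V \<partial>?V \<partial>?D)"
      by (simp only: nn_integral_cmult[OF measurable_corner])
    also have "\<dots> = (\<integral>\<^sup>+D. \<integral>\<^sup>+b. \<integral>\<^sup>+c. \<integral>\<^sup>+l. \<Psi> D b c l \<partial>lborel \<partial>?V \<partial>?V \<partial>?D)"
    \<comment> \<open>\<open>corner_to_eigenvalue\<close> requires coprime characteristic
      polynomials, which is the case for almost all D, b and c.\<close>
    proof (rule nn_integral_cong_AE, use AE_minor_coprime_nested[of N] in eventually_elim)
      case (elim D)
      show ?case
      proof (rule nn_integral_cong_AE, use elim in eventually_elim)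
        case (elim b)
        show ?case
          by (rule nn_integral_cong_AE, use elim in eventually_elim) (unfold \<Psi>_def p_def, rule corner_to_eigenvalue)
      qed
    qed
    also have "\<dots> = (\<integral>\<^sup>+D. \<integral>\<^sup>+b. \<integral>\<^sup>+l. \<integral>\<^sup>+v. marked_weight ?n r Ls l (Matrix.mat ?n ?n (eigen_block N D b v l)) \<partial>?V \<partial>lborel \<partial>?V \<partial>?D)"
      unfolding \<Psi>_def p_def column_to_eigenvector ..
    also have "\<dots> = (\<integral>\<^sup>+l. \<integral>\<^sup>+v. \<integral>\<^sup>+D. \<integral>\<^sup>+b. marked_weight ?n r Ls l (Matrix.mat ?n ?n (eigen_block N D b v l)) \<partial>?V \<partial>?D \<partial>?V \<partial>lborel)"
    proof -
      have "(\<lambda>x. marked_weight ?n r Ls (fst (snd x)) (Matrix.mat ?n ?n (eigen_block N (fst (fst x)) (snd (fst x)) (snd (snd x)) (fst (snd x)))))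
        \<in> borel_measurable ((?D \<Otimes>\<^sub>M ?V) \<Otimes>\<^sub>M ((lborel :: complex measure) \<Otimes>\<^sub>M ?V))"
        by (rule measurable_marked_weight) (rule evm, measurable)
      from nn_integral_swap_pairs[OF D.sigma_finite_measure_axioms V.sigma_finite_measure_axioms
          sigma_finite_lborel V.sigma_finite_measure_axioms this]
      show ?thesis by simp
    qed
    also have "\<dots> = (\<integral>\<^sup>+l. \<integral>\<^sup>+v. \<kappa> v * (?h l * (hole_integral N r (l # Ls) * g0)) \<partial>?V \<partial>lborel)"
    proof (rule nn_integral_cong, rule nn_integral_cong)
      fix l v
      have gm: "(\<lambda>D. gaussian_hole_weight N r (l # Ls) (Matrix.mat N N D)) \<in> borel_measurable ?D"
        by (rule measurable_gaussian_hole_weight[of N "\<lambda>x. x"]) (rule measurable_grid_component)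
      have "(\<integral>\<^sup>+D. \<integral>\<^sup>+b. marked_weight ?n r Ls l (Matrix.mat ?n ?n (block N D b (\<lambda>_. 0) l)) \<partial>?V \<partial>?D)
          = (\<integral>\<^sup>+D. \<integral>\<^sup>+b. ?h l * gaussian_hole_weight N r (l # Ls) (Matrix.mat N N D) * ennreal (exp (- (\<Sum>j<N. (cmod (b j))\<^sup>2))) \<partial>?V \<partial>?D)"
        unfolding marked_weight_block_lower by (simp only: mult.assoc)
      also have "\<dots> = (\<integral>\<^sup>+D. ?h l * gaussian_hole_weight N r (l # Ls) (Matrix.mat N N D) * g0 \<partial>?D)"
        unfolding g0_def by (intro nn_integral_cong nn_integral_cmult) measurable
      also have "\<dots> = (\<integral>\<^sup>+D. ?h l * gaussian_hole_weight N r (l # Ls) (Matrix.mat N N D) \<partial>?D) * g0"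
        by (rule nn_integral_multc[OF borel_measurable_times_ennreal[OF borel_measurable_const gm]])
      also have "(\<integral>\<^sup>+D. ?h l * gaussian_hole_weight N r (l # Ls) (Matrix.mat N N D) \<partial>?D) = ?h l * hole_integral N r (l # Ls)"
        unfolding hole_integral_def by (rule nn_integral_cmult[OF gm])
      finally show "(\<integral>\<^sup>+D. \<integral>\<^sup>+b. marked_weight ?n r Ls l (Matrix.mat ?n ?n (eigen_block N D b v l)) \<partial>?V \<partial>?D)
          = \<kappa> v * (?h l * (hole_integral N r (l # Ls) * g0))"
        unfolding \<kappa>[OF conjugation_invariant_marked_weight] by (simp only: mult.assoc)
    qed
    also have "\<dots> = (\<integral>\<^sup>+l. (\<integral>\<^sup>+v. \<kappa> v \<partial>?V) * g0 * (?h l * hole_integral N r (l # Ls)) \<partial>lborel)"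
      unfolding nn_integral_multc[OF \<kappa>m] by (simp only: mult_ac)
    also have "\<dots> = (\<integral>\<^sup>+v. \<kappa> v \<partial>?V) * g0 * (\<integral>\<^sup>+l. ?h l * hole_integral N r (l # Ls) \<partial>lborel)"
    proof (rule nn_integral_cmult)
      have "(\<lambda>l. hole_integral N r (l # Ls)) \<in> borel_measurable lborel"
        unfolding hole_integral_def
      proof (rule D.borel_measurable_nn_integral)
        have e: "gaussian_hole_weight N r (l # Ls) A = ennreal ((cmod (poly (char_poly A) l))\<^sup>2) * gaussian_hole_weight N r Ls A" for l A
          by (simp add: gaussian_hole_weight_def hole_weight_Cons ennreal_mult'[symmetric] mult.assoc)
        have c: "(\<lambda>x. snd x (i, j)) \<in> borel_measurable ((lborel :: complex measure) \<Otimes>\<^sub>M ?D)" if "i < N" "j < N" for i j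
          using measurable_lebesgue_fun_component[OF measurable_snd, of "(i, j)" "grid N"] that by simp
        have "(\<lambda>x. poly (chi N (snd x)) (fst x)) \<in> borel_measurable ((lborel :: complex measure) \<Otimes>\<^sub>M ?D)"
          by (rule borel_measurable_char_poly[where f = snd, OF c]) auto
        moreover have "(\<lambda>x. gaussian_hole_weight N r Ls (Matrix.mat N N (snd x))) \<in> borel_measurable ((lborel :: complex measure) \<Otimes>\<^sub>M ?D)"
          by (rule measurable_gaussian_hole_weight[where f = snd, OF c])
        ultimately show "(\<lambda>(l, X). gaussian_hole_weight N r (l # Ls) (Matrix.mat N N X)) \<in> borel_measurable ((lborel :: complex measure) \<Otimes>\<^sub>M ?D)"
          unfolding e case_prod_beta' by measurable
      qed
      moreover have "(\<lambda>l. hole_weight r Ls [:- l, 1:] * exp (- (cmod l)\<^sup>2)) \<in> borel_measurable lborel"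
        using measurable_hole_weight_linear[of r Ls] by (intro borel_measurable_times) auto
      ultimately show "(\<lambda>l. ?h l * hole_integral N r (l # Ls)) \<in> borel_measurable lborel"
        by (intro borel_measurable_times_ennreal measurable_compose[OF _ measurable_ennreal])
    qed
    finally have eq: "of_nat ?n * hole_integral ?n r Ls
        = (\<integral>\<^sup>+v. \<kappa> v \<partial>?V) * g0 * (\<integral>\<^sup>+l. ?h l * hole_integral N r (l # Ls) \<partial>lborel)" .
    have n: "of_nat ?n \<noteq> (0 :: ennreal)" "of_nat ?n \<noteq> (\<top> :: ennreal)" by simp_all
    have "hole_integral ?n r Ls = of_nat ?n * hole_integral ?n r Ls / of_nat ?n"
      using ennreal_divide_self[OF n(1)] of_nat_less_top[of ?n]
      by (simp only: mult.commute[of "of_nat ?n"] ennreal_times_divide[symmetric] mult_1_right)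
    moreover have "P * R / m = P / m * R" for P R m :: ennreal
      using ennreal_times_divide[of R P m] by (simp add: mult.commute)
    ultimately show ?thesis unfolding eq K_def by (simp only:)
  qed
  then show ?thesis by blast
qed

section \<open>Orthogonality and the product formula\<close>

definition vandermonde :: "nat \<Rightarrow> (nat \<Rightarrow> complex) \<Rightarrow> complex" where
  "vandermonde N z = (\<Prod>i<N. \<Prod>j<i. z i - z j)"

(* The coefficient matrix of the monic polynomials p_j = (x - z_0)...(x - z_(j-1)) is unitriangular,
   and p_j(z_i) is lower triangular in (i, j). *)
lemma det_vandermonde: "Determinant.det (Matrix.mat N N (\<lambda>(i, j). z i ^ j)) = vandermonde N z"
proof -
  define p where "p j = (\<Prod>k<j. [:- z k, 1:])" for j
  have p: "degree (p j) = j \<and> coeff (p j) j = 1" for j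
  proof (induction j)
    case (Suc j)
    have e: "p (Suc j) = [:- z j, 1:] * p j" by (simp add: p_def mult.commute del: mult_pCons_left mult_pCons_right)
    have nz: "p j \<noteq> 0" using Suc by auto
    have "degree (p (Suc j)) = degree [:- z j, 1:] + degree (p j)"
      unfolding e by (rule degree_mult_eq) (use nz in auto)
    moreover have "lead_coeff (p (Suc j)) = lead_coeff [:- z j, 1:] * lead_coeff (p j)"
      unfolding e by (rule lead_coeff_mult)
    ultimately show ?case using Suc by simp
  qed (simp add: p_def)
  have pe: "poly (p j) x = (\<Prod>k<j. x - z k)" for j x by (simp add: p_def poly_prod)
  let ?A = "Matrix.mat N N (\<lambda>(i, j). z i ^ j)"
  let ?C = "Matrix.mat N N (\<lambda>(k, j). coeff (p j) k)"
  let ?B = "Matrix.mat N N (\<lambda>(i, j). poly (p j) (z i))"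
  have "?A * ?C = ?B"
  proof (rule eq_matI)
    fix i j assume "i < dim_row ?B" "j < dim_col ?B"
    then have ij: "i < N" "j < N" by auto
    have "(?A * ?C) $$ (i, j) = (\<Sum>k<N. coeff (p j) k * z i ^ k)"
      using ij by (simp add: scalar_prod_def atLeast0LessThan mult.commute)
    also have "\<dots> = (\<Sum>k\<le>degree (p j). coeff (p j) k * z i ^ k)"
      using p[of j] ij by (intro sum.mono_neutral_right) (auto intro: coeff_eq_0)
    finally show "(?A * ?C) $$ (i, j) = ?B $$ (i, j)" using ij by (simp add: poly_altdef)
  qed auto
  then have "Determinant.det ?A * Determinant.det ?C = Determinant.det ?B"
    using det_mult[of ?A N ?C] by simp
  moreover have "Determinant.det ?C = 1"
  proof -
    have "upper_triangular ?C"
      using p by (auto simp: upper_triangular_def intro!: coeff_eq_0)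
    then have "Determinant.det ?C = prod_list (diag_mat ?C)" by (rule det_upper_triangular[of _ N]) simp
    also have "\<dots> = (\<Prod>j<N. coeff (p j) j)"
      by (simp add: diag_mat_def prod.list_conv_set_nth atLeast0LessThan)
    also have "\<dots> = 1"
    proof (rule prod.neutral, rule ballI)
      fix j show "coeff (p j) j = 1" using p[of j] by (rule conjunct2)
    qed
    finally show ?thesis .
  qed
  moreover have "Determinant.det ?B = vandermonde N z"
  proof -
    have "Determinant.det ?B = prod_list (diag_mat ?B)"
      by (rule det_lower_triangular[of N]) (auto simp: pe)
    also have "\<dots> = vandermonde N z"
      by (simp add: diag_mat_def prod.list_conv_set_nth atLeast0LessThan pe vandermonde_def)
    finally show ?thesis .
  qed
  ultimately show ?thesis by simp
qed

lemma vandermonde_sum: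
  "vandermonde N z = (\<Sum>p | p permutes {..<N}. signof p * (\<Prod>i<N. z i ^ p i))"
  unfolding det_vandermonde[symmetric]
  by (subst det_def'[of _ N]) (auto intro!: sum.cong prod.cong simp: atLeast0LessThan permutes_in_image)

text \<open>Marking \<open>l\<close> multiplies the one-point weight at z_i by |l - z_i|^2, and
  these factors complete the Vandermonde product of N points to that of N + 1. The induction
  hypothesis is therefore applied to the longer list \<open>l # Ls\<close>.\<close>

lemma hole_integral_vandermonde:
  "\<exists>C. \<forall>r Ls. hole_integral N r Ls = C * (\<integral>\<^sup>+z. ennreal ((\<Prod>i<N. hole_weight r Ls [:- z i, 1:] * exp (- (cmod (z i))\<^sup>2))
      * (cmod (vandermonde N z))\<^sup>2) \<partial>lebesgue_fun {..<N})"
proof (induction N)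
  case 0
  \<comment> \<open>The product over no coordinates is a one-point space of mass 1.\<close>
  have em: "emeasure (lebesgue_fun {}) (space (lebesgue_fun ({} :: 'i set))) = 1"
    using lborel_prod.emeasure_PiM[of "{} :: 'i set" "\<lambda>_. UNIV"] by (simp add: space_PiM)
  have "chi 0 X = 1" for X :: "nat \<times> nat \<Rightarrow> complex"
    by (rule poly_eq_poly_eq_iff[THEN iffD1], rule ext) (simp add: poly_char_poly_mat)
  then have "gaussian_hole_weight 0 r Ls (Matrix.mat 0 0 X) = 1" for r Ls X
    by (simp add: gaussian_hole_weight_def frob_def hole_weight_def map_replicate_const)
  then have "hole_integral 0 r Ls = 1" for r Ls
    using em by (simp add: hole_integral_def)
  then show ?case using em by (intro exI[of _ 1]) (simp add: vandermonde_def)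
next
  case (Suc N)
  let ?V = "lebesgue_fun {..<N}"
  let ?h = "\<lambda>r Ls z. hole_weight r Ls [:- z, 1:] * exp (- (cmod z)\<^sup>2)"
  let ?f = "\<lambda>N r Ls z. ennreal ((\<Prod>i<N. ?h r Ls (z i)) * (cmod (vandermonde N z))\<^sup>2)"
  obtain C where C: "\<And>r Ls. hole_integral N r Ls = C * (\<integral>\<^sup>+z. ?f N r Ls z \<partial>?V)" using Suc by blast
  obtain K where K: "\<And>r Ls. hole_integral (Suc N) r Ls
     = K * (\<integral>\<^sup>+l. ennreal (?h r Ls l) * hole_integral N r (l # Ls) \<partial>lborel)"
    using hole_integral_Suc[of N] by blast
  have hm: "(\<lambda>z. ?h r Ls z) \<in> borel_measurable borel" for r Ls
    using measurable_hole_weight_linear[of r Ls] by measurable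
  have fm: "?f n r Ls \<in> borel_measurable (lebesgue_fun {..<n})" for n r Ls
  proof -
    have c: "(\<lambda>z. z i) \<in> borel_measurable (lebesgue_fun {..<n})" if "i < n" for i
      using measurable_lebesgue_fun_component[OF measurable_ident_sets[OF refl], of i "{..<n}"] that by simp
    have "vandermonde n \<in> borel_measurable (lebesgue_fun {..<n})"
      unfolding vandermonde_def[abs_def] using c
      by (intro borel_measurable_prod borel_measurable_diff) auto
    moreover have "(\<lambda>z. \<Prod>i<n. ?h r Ls (z i)) \<in> borel_measurable (lebesgue_fun {..<n})"
      using measurable_compose[OF c hm] by (intro borel_measurable_prod) auto
    ultimately show ?thesis by measurable
  qed
  have ins: "lebesgue_fun {..<Suc N} = lebesgue_fun (insert N {..<N})"
    by (rule arg_cong[where f = "\<lambda>I. lebesgue_fun I"]) auto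
  have "hole_integral (Suc N) r Ls = K * C * (\<integral>\<^sup>+z. ?f (Suc N) r Ls z \<partial>lebesgue_fun {..<Suc N})" for r Ls
  proof -
    have inner: "ennreal (?h r Ls l) * hole_integral N r (l # Ls)
        = C * (\<integral>\<^sup>+z. ?f (Suc N) r Ls (z(N := l)) \<partial>?V)" for l
    proof -
      have hC: "?h r (l # Ls) z = (cmod (l - z))\<^sup>2 * ?h r Ls z" for z
        by (simp add: hole_weight_Cons)
      have v: "vandermonde (Suc N) (z(N := l)) = vandermonde N z * (\<Prod>j<N. l - z j)" for z
        by (simp add: vandermonde_def)
      have e: "ennreal (?h r Ls l) * ?f N r (l # Ls) z = ?f (Suc N) r Ls (z(N := l))" for z
      proof -
        have "(cmod (\<Prod>j<N. l - z j))\<^sup>2 = (\<Prod>j<N. (cmod (l - z j))\<^sup>2)"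
          by (simp add: prod_norm[symmetric] prod_power_distrib)
        then have "?h r Ls l * ((\<Prod>i<N. ?h r (l # Ls) (z i)) * (cmod (vandermonde N z))\<^sup>2)
            = (\<Prod>i<Suc N. ?h r Ls ((z(N := l)) i)) * (cmod (vandermonde (Suc N) (z(N := l))))\<^sup>2"
          unfolding v hC norm_mult power_mult_distrib by (simp add: prod.distrib mult_ac)
        then show ?thesis by (simp only: ennreal_mult'[symmetric] mult_nonneg_nonneg hole_weight_nonneg exp_ge_zero)
      qed
      have "ennreal (?h r Ls l) * hole_integral N r (l # Ls) = C * (ennreal (?h r Ls l) * (\<integral>\<^sup>+z. ?f N r (l # Ls) z \<partial>?V))"
        unfolding C by (simp only: mult_ac)
      also have "ennreal (?h r Ls l) * (\<integral>\<^sup>+z. ?f N r (l # Ls) z \<partial>?V) = (\<integral>\<^sup>+z. ennreal (?h r Ls l) * ?f N r (l # Ls) z \<partial>?V)"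
        by (rule nn_integral_cmult[OF fm, symmetric])
      finally show ?thesis unfolding e .
    qed
    have m: "?f (Suc N) r Ls \<in> borel_measurable (lebesgue_fun (insert N {..<N}))"
      using fm[where n = "Suc N" and r = r and Ls = Ls] unfolding ins .
    have "(\<integral>\<^sup>+l. C * (\<integral>\<^sup>+z. ?f (Suc N) r Ls (z(N := l)) \<partial>?V) \<partial>lborel)
        = C * (\<integral>\<^sup>+l. \<integral>\<^sup>+z. ?f (Suc N) r Ls (z(N := l)) \<partial>?V \<partial>lborel)"
    proof (rule nn_integral_cmult)
      interpret V: sigma_finite_measure ?V by (rule sigma_finite_lebesgue_fun) simp
      have "(\<lambda>x. (snd x)(N := fst x)) \<in> (lborel :: complex measure) \<Otimes>\<^sub>M ?V \<rightarrow>\<^sub>M lebesgue_fun (insert N {..<N})"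
        by (rule measurable_fun_upd[where J = "{..<N}"]) auto
      from measurable_compose[OF this m]
      show "(\<lambda>l. \<integral>\<^sup>+z. ?f (Suc N) r Ls (z(N := l)) \<partial>?V) \<in> borel_measurable lborel"
        by (intro V.borel_measurable_nn_integral) (simp only: case_prod_beta')
    qed
    also have "(\<integral>\<^sup>+l. \<integral>\<^sup>+z. ?f (Suc N) r Ls (z(N := l)) \<partial>?V \<partial>lborel) = (\<integral>\<^sup>+z. ?f (Suc N) r Ls z \<partial>lebesgue_fun {..<Suc N})"
      unfolding ins by (rule lborel_prod.product_nn_integral_insert_rev[OF _ _ m, symmetric]) auto
    finally show ?thesis unfolding K inner by (simp only: mult.assoc)
  qed
  then show ?case by blast
qed

section \<open>Radial moments and the orthogonality of monomials\<close>

definition hole_density :: "real \<Rightarrow> complex \<Rightarrow> real" where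
  "hole_density r z = (if cmod z < r then 0 else exp (- (cmod z)\<^sup>2))"

text \<open>In closed form this is pi Gamma(k + 1, r^2) with the upper incomplete gamma function,
  and pi k! at r = 0, where no point is excluded.\<close>

definition moment :: "real \<Rightarrow> nat \<Rightarrow> real" where
  "moment r k = (\<integral>z. cmod z ^ (2 * k) * hole_density r z \<partial>lborel)"

lemma hole_density_measurable [measurable]: "hole_density r \<in> borel_measurable borel"
  unfolding hole_density_def[abs_def] by measurable

lemma hole_density_bounds: "0 \<le> hole_density r z" "hole_density r z \<le> exp (- (cmod z)\<^sup>2)"
  by (auto simp: hole_density_def)

lemma hole_weight_Nil: "hole_weight r [] [:- z, 1:] * exp (- (cmod z)\<^sup>2) = hole_density r z"
  by (auto simp: hole_weight_def hole_density_def)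

text \<open>From x^n \<le> n! exp x, a single term of the exponential series, and x \<le> (1 +
  x^2)/2. Half of the Gaussian decay survives, so all moments are finite.\<close>

lemma power_gaussian_bound:
  fixes x :: real
  assumes "x \<ge> 0"
  shows "x ^ n * exp (- x\<^sup>2) \<le> fact n * exp (1 / 2) * exp (- x\<^sup>2 / 2)"
proof -
  have "x ^ n / fact n \<le> exp x"
  proof -
    have "(\<Sum>k\<in>{n}. x ^ k / fact k) \<le> (\<Sum>k. x ^ k / fact k)"
      using assms summable_exp[of x] by (intro sum_le_suminf) (auto simp: field_simps)
    then show ?thesis by (simp add: exp_def scaleR_conv_of_real field_simps)
  qed
  then have "x ^ n \<le> fact n * exp x" by (simp add: field_simps)
  also have "exp x \<le> exp (1 / 2 + x\<^sup>2 / 2)"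
    using sum_squares_bound[of 1 x] by (simp add: power2_eq_square)
  finally have "x ^ n * exp (- x\<^sup>2) \<le> fact n * exp (1 / 2 + x\<^sup>2 / 2) * exp (- x\<^sup>2)"
    by (intro mult_right_mono) auto
  also have "\<dots> = fact n * exp (1 / 2) * exp (- x\<^sup>2 / 2)"
    by (simp add: mult.assoc exp_add[symmetric])
  finally show ?thesis .
qed

lemma integrable_power_gaussian: "integrable lborel (\<lambda>z :: complex. cmod z ^ n * exp (- (cmod z)\<^sup>2))"
proof (rule integrableI_bounded)
  have "(\<integral>\<^sup>+z. ennreal (exp (- (cmod z)\<^sup>2 / 2)) \<partial>(lborel :: complex measure))
      = ennreal ((cmod (of_real (sqrt 2)))\<^sup>2) * (\<integral>\<^sup>+z. ennreal (exp (- (cmod (of_real (sqrt 2) * z))\<^sup>2 / 2)) \<partial>(lborel :: complex measure))"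
    by (rule nn_integral_lborel_mult) auto
  also have "\<dots> = ennreal (2 * pi)"
    using nn_integral_complex_gaussian by (simp add: norm_mult power_mult_distrib ennreal_mult)
  finally have g: "(\<integral>\<^sup>+z. ennreal (exp (- (cmod z)\<^sup>2 / 2)) \<partial>(lborel :: complex measure)) = ennreal (2 * pi)" .
  have "(\<integral>\<^sup>+z. ennreal (norm (cmod z ^ n * exp (- (cmod z)\<^sup>2))) \<partial>(lborel :: complex measure))
      \<le> (\<integral>\<^sup>+z. ennreal (fact n * exp (1 / 2)) * ennreal (exp (- (cmod z)\<^sup>2 / 2)) \<partial>(lborel :: complex measure))"
  proof (rule nn_integral_mono)
    fix z :: complex
    show "ennreal (norm (cmod z ^ n * exp (- (cmod z)\<^sup>2))) \<le> ennreal (fact n * exp (1 / 2)) * ennreal (exp (- (cmod z)\<^sup>2 / 2))"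
      using power_gaussian_bound[of "cmod z" n] by (simp add: ennreal_mult'[symmetric] ennreal_leI)
  qed
  also have "\<dots> = ennreal (fact n * exp (1 / 2)) * ennreal (2 * pi)"
    unfolding g[symmetric] by (rule nn_integral_cmult) auto
  also have "\<dots> < \<infinity>" by (simp add: ennreal_mult_less_top)
  finally show "(\<integral>\<^sup>+z. ennreal (norm (cmod z ^ n * exp (- (cmod z)\<^sup>2))) \<partial>(lborel :: complex measure)) < \<infinity>" .
qed simp

lemma integrable_power_hole_density: "integrable lborel (\<lambda>z :: complex. cmod z ^ n * hole_density r z)"
  by (rule Bochner_Integration.integrable_bound[OF integrable_power_gaussian[of n]])
     (auto simp: hole_density_bounds abs_mult intro!: mult_left_mono)

lemma cnj_measurable [measurable]: "cnj \<in> borel_measurable borel"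
  by (intro borel_measurable_continuous_onI continuous_intros)

lemma integrable_mixed_moment:
  "integrable lborel (\<lambda>z :: complex. of_real (hole_density r z) * (z ^ a * cnj z ^ b))"
  by (rule Bochner_Integration.integrable_bound[OF integrable_power_hole_density[of "a + b" r]])
     (auto simp: norm_mult norm_power hole_density_bounds power_add)

lemma distr_lborel_rotation:
  assumes "cmod t = 1"
  shows "distr lborel borel ((*) t) = (lborel :: complex measure)"
proof (rule measure_eqI)
  fix A assume "A \<in> sets (distr lborel borel ((*) t))"
  then have A[measurable]: "A \<in> sets borel" by simp
  have t: "t \<noteq> 0" using assms by auto
  have "emeasure lborel A = (\<integral>\<^sup>+z. indicator A z \<partial>lborel)" by simp
  also have "\<dots> = (\<integral>\<^sup>+z. indicator A (t * z) \<partial>lborel)"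
    using nn_integral_lborel_mult[OF t, of "indicator A"] assms by simp
  also have "\<dots> = (\<integral>\<^sup>+z. indicator A z \<partial>distr lborel borel ((*) t))"
    by (subst nn_integral_distr) auto
  also have "\<dots> = emeasure (distr lborel borel ((*) t)) A" by simp
  finally show "emeasure (distr lborel borel ((*) t)) A = emeasure lborel A" ..
qed simp

text \<open>Lebesgue measure and the density are invariant under rotations. For a \<noteq> b,
  rotation by the angle pi/(a - b) multiplies z^a conj(z)^b by -1, so the integral equals its own
  negative.\<close>

lemma mixed_moment:
  "(\<integral>z. of_real (hole_density r z) * (z ^ a * cnj z ^ b) \<partial>lborel) = (if a = b then of_real (moment r a) else 0)"
proof (cases "a = b")
  case True
  have "of_real (hole_density r z) * (z ^ a * cnj z ^ a) = complex_of_real (cmod z ^ (2 * a) * hole_density r z)" for z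
  proof -
    have "z ^ a * cnj z ^ a = complex_of_real (cmod z ^ (2 * a))"
      by (simp only: power_mult_distrib[symmetric] complex_norm_square[symmetric] power_mult of_real_power)
    then show ?thesis by simp
  qed
  then show ?thesis using True by (simp only: moment_def integral_complex_of_real if_True simp_thms)
next
  case False
  let ?g = "\<lambda>z. of_real (hole_density r z) * (z ^ a * cnj z ^ b)"
  define x where "x = pi / (real a - real b)"
  define t where "t = cis x"
  have t: "cmod t = 1" by (simp add: t_def)
  have "t ^ a * cnj t ^ b = cis (real a * x + real b * - x)"
    by (simp only: t_def cis_cnj Complex.DeMoivre cis_mult)
  also have "real a * x + real b * - x = (real a - real b) * x" by (simp add: algebra_simps)
  also have "\<dots> = pi" using False by (simp add: x_def)
  finally have tt: "t ^ a * cnj t ^ b = -1" by simp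
  have gt: "?g (t * z) = - ?g z" for z
  proof -
    have "?g (t * z) = (t ^ a * cnj t ^ b) * ?g z"
      using t by (simp add: hole_density_def norm_mult power_mult_distrib)
    then show ?thesis by (simp add: tt)
  qed
  have "(\<integral>z. ?g z \<partial>lborel) = (\<integral>z. ?g z \<partial>distr lborel borel ((*) t))"
    by (simp add: distr_lborel_rotation[OF t])
  also have "\<dots> = (\<integral>z. ?g (t * z) \<partial>lborel)" by (rule integral_distr) auto
  also have "\<dots> = - (\<integral>z. ?g z \<partial>lborel)" unfolding gt by simp
  finally have "(\<integral>z. ?g z \<partial>lborel) = 0" by simp
  then show ?thesis using False by simp
qed

text \<open>Expand both Vandermonde determinants over permutations p and q; each term factorises
  over the points. Orthogonality leaves only p = q, and each of the N! remaining terms is the same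
  product of moments.\<close>

lemma vandermonde_integral:
  "(\<integral>\<^sup>+z. ennreal ((\<Prod>i<N. hole_density r (z i)) * (cmod (vandermonde N z))\<^sup>2) \<partial>lebesgue_fun {..<N})
    = ennreal (fact N * (\<Prod>k<N. moment r k))"
proof -
  let ?P = "{p. p permutes {..<N}}"
  let ?g = "\<lambda>a b z. complex_of_real (hole_density r z) * (z ^ a * cnj z ^ b)"
  let ?F = "\<lambda>z. (\<Prod>i<N. hole_density r (z i)) * (cmod (vandermonde N z))\<^sup>2"
  have finP: "finite ?P" by (rule finite_permutations) simp
  have expand: "complex_of_real (?F z) = (\<Sum>p\<in>?P. \<Sum>q\<in>?P. signof p * signof q * (\<Prod>i<N. ?g (p i) (q i) (z i)))" for z
  proof -
    have "complex_of_real (?F z) = (\<Prod>i<N. complex_of_real (hole_density r (z i))) * (vandermonde N z * cnj (vandermonde N z))"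
      by (simp only: of_real_mult of_real_prod complex_norm_square)
    also have "cnj (vandermonde N z) = (\<Sum>q\<in>?P. signof q * (\<Prod>i<N. cnj (z i) ^ q i))"
      unfolding vandermonde_sum by (simp add: sign_def)
    finally have e: "complex_of_real (?F z) = (\<Prod>i<N. complex_of_real (hole_density r (z i))) *
        (vandermonde N z * (\<Sum>q\<in>?P. signof q * (\<Prod>i<N. cnj (z i) ^ q i)))" .
    show ?thesis
      unfolding e unfolding vandermonde_sum sum_product unfolding sum_distrib_left
      by (intro sum.cong refl) (simp add: prod.distrib mult_ac)
  qed
  have int: "integrable (lebesgue_fun {..<N}) (\<lambda>z. \<Prod>i<N. ?g (p i) (q i) (z i))" for p q
    by (rule lborel_prod.product_integrable_prod) (auto intro: integrable_mixed_moment)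
  have val: "(\<integral>z. (\<Prod>i<N. ?g (p i) (q i) (z i)) \<partial>lebesgue_fun {..<N})
      = (if p = q then of_real (\<Prod>k<N. moment r k) else 0)" if pq: "p \<in> ?P" "q \<in> ?P" for p q
  proof -
    have "(\<integral>z. (\<Prod>i<N. ?g (p i) (q i) (z i)) \<partial>lebesgue_fun {..<N}) = (\<Prod>i<N. if p i = q i then of_real (moment r (p i)) else 0)"
      by (subst lborel_prod.product_integral_prod) (auto intro: integrable_mixed_moment simp: mixed_moment)
    also have "\<dots> = (if p = q then of_real (\<Prod>k<N. moment r k) else 0)"
    proof (cases "p = q")
      case True
      have "(\<Prod>i<N. moment r (p i)) = (\<Prod>k<N. moment r k)"
        using pq(1) by (intro prod.permute[symmetric, unfolded o_def]) simp
      then show ?thesis using True by (simp add: of_real_prod[symmetric] del: of_real_prod)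
    next
      case False
      then obtain i where i: "p i \<noteq> q i" by auto
      then have "i < N" using pq by (metis lessThan_iff mem_Collect_eq permutes_not_in)
      then show ?thesis using i False by (intro trans[OF prod_zero[of _]]) auto
    qed
    finally show ?thesis .
  qed
  have intF: "integrable (lebesgue_fun {..<N}) (\<lambda>z. complex_of_real (?F z))"
    unfolding expand by (intro Bochner_Integration.integrable_sum integrable_mult_right int)
  have "(\<integral>z. complex_of_real (?F z) \<partial>lebesgue_fun {..<N})
      = (\<Sum>p\<in>?P. \<Sum>q\<in>?P. signof p * signof q * (if p = q then of_real (\<Prod>k<N. moment r k) else 0))"
    unfolding expand using int val
    by (subst Bochner_Integration.integral_sum, force)+ simp
  also have "\<dots> = (\<Sum>p\<in>?P. of_real (\<Prod>k<N. moment r k))"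
  proof (rule sum.cong[OF refl])
    fix p assume p: "p \<in> ?P"
    have "(\<Sum>q\<in>?P. signof p * signof q * (if p = q then complex_of_real (\<Prod>k<N. moment r k) else 0))
        = signof p * signof p * of_real (\<Prod>k<N. moment r k)"
    proof -
      have "(\<Sum>q\<in>?P. signof p * signof q * (if p = q then complex_of_real (\<Prod>k<N. moment r k) else 0))
         = (\<Sum>q\<in>{p}. signof p * signof q * (if p = q then complex_of_real (\<Prod>k<N. moment r k) else 0))"
        using p finP by (intro sum.mono_neutral_right) auto
      then show ?thesis by simp
    qed
    then show "(\<Sum>q\<in>?P. signof p * signof q * (if p = q then complex_of_real (\<Prod>k<N. moment r k) else 0))
        = of_real (\<Prod>k<N. moment r k)" by (simp add: sign_def)
  qed
  also have "\<dots> = of_real (fact N * (\<Prod>k<N. moment r k))"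
    by (simp add: card_permutations[of "{..<N}" N])
  finally have "complex_of_real (\<integral>z. ?F z \<partial>lebesgue_fun {..<N}) = of_real (fact N * (\<Prod>k<N. moment r k))"
    by (simp only: integral_complex_of_real)
  then have I: "(\<integral>z. ?F z \<partial>lebesgue_fun {..<N}) = fact N * (\<Prod>k<N. moment r k)"
    by (simp only: of_real_eq_iff)
  have "integrable (lebesgue_fun {..<N}) ?F"
    using integrable_Re[OF intF] by (simp only: Re_complex_of_real)
  then show ?thesis
    using I by (subst nn_integral_eq_integral) (auto intro!: mult_nonneg_nonneg prod_nonneg hole_density_bounds)
qed

lemma hole_integral_moments:
  "\<exists>C. \<forall>r. hole_integral N r [] = C * ennreal (\<Prod>k<N. moment r k)"
proof -
  obtain C where C: "\<And>r Ls. hole_integral N r Ls = C * (\<integral>\<^sup>+z. ennreal ((\<Prod>i<N. hole_weight r Ls [:- z i, 1:] * exp (- (cmod (z i))\<^sup>2))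
      * (cmod (vandermonde N z))\<^sup>2) \<partial>lebesgue_fun {..<N})"
    using hole_integral_vandermonde[of N] by blast
  have "hole_integral N r [] = C * ennreal (fact N) * ennreal (\<Prod>k<N. moment r k)" for r
    unfolding C hole_weight_Nil vandermonde_integral
    by (subst ennreal_mult') (simp_all add: mult.assoc)
  then show ?thesis by blast
qed

section \<open>Asymptotics of the hole probability\<close>

lemma moment_nonneg: "0 \<le> moment r k"
  unfolding moment_def by (intro integral_nonneg_AE) (auto simp: hole_density_bounds)

lemma moment_le: "moment r k \<le> moment 0 k"
  unfolding moment_def
  by (intro integral_mono integrable_power_hole_density mult_left_mono)
     (auto simp: hole_density_def)

lemma integrable_indicator_cball: "integrable lborel (\<lambda>z :: complex. c * indicator (cball 0 r) z :: real)"
  using emeasure_bounded_finite[OF bounded_cball[of "0 :: complex" r]]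
  by (intro integrable_mult_right integrable_real_indicator) auto

lemma measure_cball_complex: "0 \<le> r \<Longrightarrow> measure lborel (cball 0 r :: complex set) = pi * r\<^sup>2"
  using content_cball[of r "0 :: complex"] by (simp add: unit_ball_vol_2)

lemma integral_indicator_cball:
  assumes "0 \<le> r"
  shows "(\<integral>z. c * indicator (cball 0 r) z \<partial>(lborel :: complex measure)) = c * (pi * r\<^sup>2)"
  using measure_cball_complex[OF assms] by simp

lemma moment_diff:
  "moment 0 k - moment r k = (\<integral>z. (if cmod z < r then cmod z ^ (2 * k) * exp (- (cmod z)\<^sup>2) else 0) \<partial>lborel)"
proof -
  have "moment 0 k - moment r k = (\<integral>z. cmod z ^ (2 * k) * hole_density 0 z - cmod z ^ (2 * k) * hole_density r z \<partial>lborel)"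
    unfolding moment_def by (intro Bochner_Integration.integral_diff[symmetric] integrable_power_hole_density)
  also have "\<dots> = (\<integral>z. (if cmod z < r then cmod z ^ (2 * k) * exp (- (cmod z)\<^sup>2) else 0) \<partial>lborel)"
    by (intro Bochner_Integration.integral_cong refl) (auto simp: hole_density_def)
  finally show ?thesis .
qed

lemma integrable_moment_diff:
  "integrable lborel (\<lambda>z :: complex. if cmod z < r then cmod z ^ (2 * k) * exp (- (cmod z)\<^sup>2) else 0)"
  by (rule Bochner_Integration.integrable_bound[OF integrable_power_gaussian[of "2 * k"]]) auto

text \<open>On the disc, of area pi r^2, the integrand is at most r^(2k).\<close>

lemma moment_diff_upper:
  assumes "0 \<le> r"
  shows "moment 0 k - moment r k \<le> pi * r ^ (2 * k + 2)"
proof -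
  have "moment 0 k - moment r k \<le> (\<integral>z. r ^ (2 * k) * indicator (cball 0 r) z \<partial>(lborel :: complex measure))"
    unfolding moment_diff
  proof (intro integral_mono integrable_moment_diff integrable_indicator_cball)
    fix z :: complex
    have "cmod z ^ (2 * k) * exp (- (cmod z)\<^sup>2) \<le> r ^ (2 * k) * 1" if "cmod z < r"
      using that assms by (intro mult_mono power_mono) auto
    then show "(if cmod z < r then cmod z ^ (2 * k) * exp (- (cmod z)\<^sup>2) else 0) \<le> r ^ (2 * k) * indicator (cball 0 r) z"
      using assms by (auto simp: indicator_def)
  qed
  then show ?thesis unfolding integral_indicator_cball[OF assms] by (simp add: power_add mult_ac power2_eq_square)
qed

text \<open>On the disc the Gaussian is at least exp(-r^2). The density omits the open disc whereas
  \<open>cball\<close> is closed; the two differ by a circle, which is null.\<close>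

lemma moment_diff_lower:
  assumes "0 \<le> r"
  shows "moment 0 0 - moment r 0 \<ge> pi * r\<^sup>2 * exp (- r\<^sup>2)"
proof -
  have "(\<integral>z. exp (- r\<^sup>2) * indicator (cball 0 r) z \<partial>(lborel :: complex measure)) \<le> moment 0 0 - moment r 0"
    unfolding moment_diff
  proof (rule integral_mono_AE[OF integrable_indicator_cball integrable_moment_diff])
    have "sphere (0 :: complex) r \<in> null_sets lborel"
      using negligible_sphere[of "0 :: complex" r] by (auto simp: negligible_iff_null_sets null_sets_def)
    then have "AE z :: complex in lborel. z \<notin> sphere 0 r" by (rule AE_not_in)
    then show "AE z :: complex in lborel. exp (- r\<^sup>2) * indicator (cball 0 r) z
        \<le> (if cmod z < r then cmod z ^ (2 * 0) * exp (- (cmod z)\<^sup>2) else 0)"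
    proof eventually_elim
      case (elim z)
      have "exp (- r\<^sup>2) \<le> exp (- (cmod z)\<^sup>2)" if "cmod z < r"
        using that assms by (simp add: power_mono)
      then show ?case using elim by (auto simp: indicator_def)
    qed
  qed
  then show ?thesis unfolding integral_indicator_cball[OF assms] by (simp add: mult_ac)
qed

lemma moment_0_0: "moment 0 0 = pi"
proof -
  have "ennreal (moment 0 0) = (\<integral>\<^sup>+z. ennreal (exp (- (cmod z)\<^sup>2)) \<partial>(lborel :: complex measure))"
    unfolding moment_def using integrable_power_hole_density[of 0 0]
    by (subst nn_integral_eq_integral[symmetric]) (auto simp: hole_density_def)
  also have "\<dots> = ennreal pi" by (rule nn_integral_complex_gaussian)
  finally show ?thesis by (simp add: moment_nonneg)
qed

text \<open>On the unit square with opposite corners 1 and 2 + i one has 1 \<le> |z|^2 \<le> 5, so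
  the integrand is at least exp(-5) for every k. The tail estimate relies on this uniformity in
  k.\<close>

lemma moment_0_lower: "moment 0 k \<ge> exp (- 5)"
proof -
  let ?C = "cbox (Complex 1 0) (Complex 2 1)"
  have m: "measure lborel ?C = 1"
    unfolding measure_def by (subst emeasure_lborel_cbox) (auto simp: Basis_complex_def)
  have "(\<integral>z. exp (- 5) * indicator ?C z \<partial>(lborel :: complex measure)) \<le> moment 0 k"
    unfolding moment_def
  proof (intro integral_mono integrable_power_hole_density)
    show "integrable lborel (\<lambda>z. exp (- 5) * indicator ?C z :: real)"
      using emeasure_bounded_finite[OF bounded_cbox[of "Complex 1 0" "Complex 2 1"]]
      by (intro integrable_mult_right integrable_real_indicator) auto
    fix z :: complex
    have "exp (- 5) \<le> cmod z ^ (2 * k) * exp (- (cmod z)\<^sup>2)" if "z \<in> ?C"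
    proof -
      have re: "1 \<le> Re z" "Re z \<le> 2" "0 \<le> Im z" "Im z \<le> 1"
        using that by (auto simp: mem_box Basis_complex_def)
      have "(Re z)\<^sup>2 \<le> 2\<^sup>2" "(Im z)\<^sup>2 \<le> 1\<^sup>2" using re by (intro power_mono; simp)+
      then have "(cmod z)\<^sup>2 \<le> 5" by (simp add: cmod_power2)
      moreover have "1 \<le> cmod z" using re abs_Re_le_cmod[of z] by linarith
      then have "1 \<le> cmod z ^ (2 * k)" by (rule one_le_power)
      ultimately have "1 * exp (- 5) \<le> cmod z ^ (2 * k) * exp (- (cmod z)\<^sup>2)" by (intro mult_mono) auto
      then show ?thesis by simp
    qed
    then show "exp (- 5) * indicator ?C z \<le> cmod z ^ (2 * k) * hole_density 0 z"
      by (auto simp: indicator_def hole_density_def)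
  qed
  then show ?thesis using m by simp
qed

lemma moment_0_pos: "moment 0 k > 0"
  using moment_0_lower[of k] exp_gt_zero[of "-5 :: real"] by linarith

section \<open>The hole probability and its bounds uniform in the matrix size\<close>

definition hole_prob :: "nat \<Rightarrow> real \<Rightarrow> real" where
  "hole_prob N r = (\<Prod>k<N. moment r k / moment 0 k)"

lemma moment_ratio: "0 \<le> moment r k / moment 0 k" "moment r k / moment 0 k \<le> 1"
  using moment_nonneg[of r k] moment_le[of r k] moment_0_pos[of k] by auto

lemma hole_prob_nonneg: "0 \<le> hole_prob N r"
  unfolding hole_prob_def using moment_ratio by (intro prod_nonneg) auto

lemma hole_prob_convergent: "convergent (\<lambda>N. hole_prob N r)"
proof (rule Bseq_monoseq_convergent)
  have dec: "decseq (\<lambda>N. hole_prob N r)"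
  proof (rule decseq_SucI)
    fix N
    show "hole_prob (Suc N) r \<le> hole_prob N r"
      using mult_left_le[OF moment_ratio(2) hole_prob_nonneg[of N r]] by (simp add: hole_prob_def)
  qed
  then show "monoseq (\<lambda>N. hole_prob N r)" by (rule decseq_imp_monoseq)
  show "Bseq (\<lambda>N. hole_prob N r)"
    using dec hole_prob_nonneg by (intro decseq_bounded[of _ 0]) auto
qed

lemma hole_prob_upper: "0 < N \<Longrightarrow> hole_prob N r \<le> moment r 0 / moment 0 0"
proof (induction N)
  case (Suc N)
  show ?case
  proof (cases "N = 0")
    case False
    have "hole_prob (Suc N) r \<le> hole_prob N r"
      using mult_left_le[OF moment_ratio(2) hole_prob_nonneg[of N r]] by (simp add: hole_prob_def)
    then show ?thesis using Suc False by simp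
  qed (simp add: hole_prob_def)
qed simp

text \<open>All factors lie in [0, 1], so one further factor x lowers the product by at most 1 - x;
  these losses add up.\<close>

lemma hole_prob_lower:
  "0 < N \<Longrightarrow> hole_prob N r \<ge> moment r 0 / moment 0 0 - (\<Sum>k\<in>{1..<N}. 1 - moment r k / moment 0 k)"
proof (induction N)
  case (Suc N)
  show ?case
  proof (cases "N = 0")
    case False
    let ?x = "moment r N / moment 0 N"
    have "hole_prob N r - hole_prob (Suc N) r = hole_prob N r * (1 - ?x)"
      by (simp add: hole_prob_def algebra_simps)
    also have "\<dots> \<le> 1 * (1 - ?x)"
    proof (rule mult_right_mono)
      show "hole_prob N r \<le> 1"
        unfolding hole_prob_def using moment_ratio by (intro prod_le_1) auto
    qed (use moment_ratio(2)[of r N] in simp)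
    finally have "hole_prob N r - hole_prob (Suc N) r \<le> 1 - ?x" by simp
    then show ?thesis using Suc False by (simp add: atLeastLessThanSuc)
  qed (simp add: hole_prob_def)
qed simp

text \<open>The 1 comes from the factor k = 0: it and exp(-r^2) both lie between 1 - r^2 and 1 - r^2
  + r^4. Each further factor loses at most pi exp(5) r^(2k+2), where exp(5) is the reciprocal of the
  lower bound for the moments, and a geometric series of ratio 1/2 contributes the 2. The constant
  does not depend on N.\<close>

lemma hole_prob_bound:
  assumes r: "0 < r" "r \<le> 1 / 2" and N: "0 < N"
  shows "\<bar>hole_prob N r - exp (- r\<^sup>2)\<bar> \<le> (1 + 2 * pi * exp 5) * r ^ 4"
proof -
  define q where "q = moment r 0 / moment 0 0"
  have q: "q = 1 - (moment 0 0 - moment r 0) / pi"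
    by (simp add: q_def moment_0_0 diff_divide_distrib)
  have e1: "exp (- r\<^sup>2) \<ge> 1 - r\<^sup>2" using exp_ge_add_one_self[of "- r\<^sup>2"] by simp
  have q1: "q \<ge> 1 - r\<^sup>2"
    using moment_diff_upper[of r 0] r by (simp add: q field_simps power2_eq_square)
  have "(moment 0 0 - moment r 0) / pi \<ge> r\<^sup>2 * exp (- r\<^sup>2)"
    using moment_diff_lower[of r] r by (simp add: field_simps)
  moreover have "r\<^sup>2 * exp (- r\<^sup>2) \<ge> r\<^sup>2 * (1 - r\<^sup>2)" using e1 by (intro mult_left_mono) auto
  moreover have "r\<^sup>2 * (1 - r\<^sup>2) = r\<^sup>2 - r ^ 4" by (simp add: algebra_simps power_add[symmetric])
  ultimately have q2: "q \<le> 1 - r\<^sup>2 + r ^ 4" unfolding q by linarith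
  have e2: "exp (- r\<^sup>2) \<le> 1 - r\<^sup>2 + r ^ 4"
  proof -
    have "exp (- r\<^sup>2) = inverse (exp (r\<^sup>2))" by (rule exp_minus)
    also have "\<dots> \<le> inverse (1 + r\<^sup>2)"
      using exp_ge_add_one_self[of "r\<^sup>2"] by (intro le_imp_inverse_le) (auto intro: add_pos_nonneg)
    also have "\<dots> \<le> 1 - r\<^sup>2 + r ^ 4"
    proof -
      \<comment> \<open>The product is 1 + x^3.\<close>
      have "1 \<le> (1 - x + x\<^sup>2) * (1 + x)" if "x \<ge> 0" for x :: real
        using that by (simp add: algebra_simps power2_eq_square)
      from this[of "r\<^sup>2"] have "1 \<le> (1 - r\<^sup>2 + r ^ 4) * (1 + r\<^sup>2)" by (simp add: power_mult[symmetric])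
      moreover have "0 < 1 + r\<^sup>2" by (intro add_pos_nonneg) auto
      ultimately show ?thesis by (simp add: inverse_eq_divide pos_divide_le_eq)
    qed
    finally show ?thesis .
  qed
  have tail: "(\<Sum>k\<in>{1..<N}. 1 - moment r k / moment 0 k) \<le> 2 * pi * exp 5 * r ^ 4"
  proof -
    have "1 - moment r k / moment 0 k \<le> pi * exp 5 * r ^ 4 * (1 / 2) ^ (k - 1)" if k: "k \<in> {1..<N}" for k
    proof -
      have "1 - moment r k / moment 0 k = (moment 0 k - moment r k) / moment 0 k"
        using moment_0_pos[of k] by (simp add: diff_divide_distrib)
      also have "\<dots> \<le> (pi * r ^ (2 * k + 2)) / exp (- 5)"
        using moment_diff_upper[of r k] moment_0_lower[of k] moment_le[of r k] r by (intro frac_le) auto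
      also have "\<dots> = pi * exp 5 * r ^ (2 * k + 2)" by (simp add: exp_minus field_simps)
      \<comment> \<open>For k \<ge> 1 this splits off r^4 and leaves powers of r^2 for the geometric
        series.\<close>
      also have "2 * k + 2 = 4 + 2 * (k - 1)" using k by auto
      also have "pi * exp 5 * r ^ (4 + 2 * (k - 1)) = pi * exp 5 * r ^ 4 * (r\<^sup>2) ^ (k - 1)"
        by (simp add: power_add power_mult)
      also have "\<dots> \<le> pi * exp 5 * r ^ 4 * (1 / 2) ^ (k - 1)"
      proof (intro mult_left_mono power_mono)
        have "r\<^sup>2 \<le> (1 / 2)\<^sup>2" using r by (intro power_mono) auto
        then show "r\<^sup>2 \<le> 1 / 2" by (simp add: power2_eq_square)
      qed auto
      finally show ?thesis .
    qed
    then have "(\<Sum>k\<in>{1..<N}. 1 - moment r k / moment 0 k) \<le> (\<Sum>k\<in>{1..<N}. pi * exp 5 * r ^ 4 * (1 / 2) ^ (k - 1))"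
      by (rule sum_mono)
    also have "\<dots> = pi * exp 5 * r ^ 4 * (\<Sum>k\<in>{1..<N}. (1 / 2) ^ (k - 1))" by (simp add: sum_distrib_left)
    also have "\<dots> \<le> pi * exp 5 * r ^ 4 * 2"
    proof (rule mult_left_mono)
      have "(\<Sum>k\<in>{1..<N}. (1 / 2 :: real) ^ (k - 1)) = (\<Sum>k<N - 1. (1 / 2) ^ k)"
        using N by (intro sum.reindex_bij_witness[of _ Suc "\<lambda>k. k - 1"]) auto
      also have "\<dots> \<le> 2" by (simp add: sum_gp_strict)
      finally show "(\<Sum>k\<in>{1..<N}. (1 / 2 :: real) ^ (k - 1)) \<le> 2" .
    qed simp
    finally show ?thesis by (simp only: mult_ac)
  qed
  have "hole_prob N r \<le> q" using hole_prob_upper[OF N] by (simp add: q_def)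
  moreover have "hole_prob N r \<ge> q - 2 * pi * exp 5 * r ^ 4"
    using hole_prob_lower[OF N, of r] tail unfolding q_def by linarith
  moreover have "0 \<le> 2 * pi * exp 5 * r ^ 4" by simp
  ultimately show ?thesis using e1 e2 q1 q2 by (simp add: distrib_right abs_le_iff)
qed

section \<open>Distribution of the minimum modulus\<close>

definition hole_set :: "nat \<Rightarrow> real \<Rightarrow> (nat \<times> nat \<Rightarrow> complex) set" where
  "hole_set N r = {X \<in> space (lebesgue_fun (grid N)). \<forall>z\<in>ball 0 r. poly (chi N X) z \<noteq> 0}"

lemma hole_set_measurable: "hole_set N r \<in> sets (lebesgue_fun (grid N))"
proof -
  have "{X \<in> space (lebesgue_fun (grid N)). \<exists>z\<in>ball 0 r. cmod (poly (chi N X) z) = 0} \<in> sets (lebesgue_fun (grid N))"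
  proof (rule measurable_root_ball)
    fix z
    have "(\<lambda>X. poly (chi N X) z) \<in> borel_measurable (lebesgue_fun (grid N))"
      by (rule borel_measurable_char_poly[where f = "\<lambda>X. X", OF measurable_grid_component]) auto
    then show "(\<lambda>X. cmod (poly (chi N X) z)) \<in> borel_measurable (lebesgue_fun (grid N))" by measurable
  qed (intro continuous_intros)
  then have "space (lebesgue_fun (grid N)) - {X \<in> space (lebesgue_fun (grid N)). \<exists>z\<in>ball 0 r. cmod (poly (chi N X) z) = 0}
      \<in> sets (lebesgue_fun (grid N))" by (rule sets.compl_sets)
  moreover have "hole_set N r = space (lebesgue_fun (grid N)) - {X \<in> space (lebesgue_fun (grid N)). \<exists>z\<in>ball 0 r. cmod (poly (chi N X) z) = 0}"
    by (auto simp: hole_set_def)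
  ultimately show ?thesis by simp
qed

lemma hole_integral_Nil:
  "hole_integral N r [] = (\<integral>\<^sup>+X. ennreal (exp (- frob N X)) * indicator (hole_set N r) X \<partial>lebesgue_fun (grid N))"
  unfolding hole_integral_def
  by (rule nn_integral_cong) (auto simp: gaussian_hole_weight_def hole_weight_def hole_set_def indicator_def)

text \<open>The unknown constant of the product formula is eliminated by comparison with r = 0,
  where no matrix is excluded and the integral is the full Gaussian one.\<close>

lemma gaussian_hole_prob:
  "(\<integral>\<^sup>+X. ennreal (exp (- frob N X)) * indicator (hole_set N r) X \<partial>lebesgue_fun (grid N))
    = ennreal (hole_prob N r) * ennreal (pi ^ (N * N))"
proof -
  obtain C where C: "\<And>r. hole_integral N r [] = C * ennreal (\<Prod>k<N. moment r k)"
    using hole_integral_moments[of N] by blast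
  have "(\<Prod>k<N. moment r k) = hole_prob N r * (\<Prod>k<N. moment 0 k)"
    using moment_0_pos by (simp add: hole_prob_def prod.distrib[symmetric] less_imp_neq[symmetric])
  then have "hole_integral N r [] = ennreal (hole_prob N r) * hole_integral N 0 []"
    unfolding C using hole_prob_nonneg[of N r] by (simp add: ennreal_mult' mult.left_commute)
  also have "hole_integral N 0 [] = ennreal (pi ^ (N * N))"
    unfolding hole_integral_Nil nn_integral_exp_frob[symmetric]
    by (rule nn_integral_cong) (auto simp: hole_set_def)
  finally show ?thesis unfolding hole_integral_Nil .
qed

section \<open>Transfer of the hole probability to the two ensembles\<close>

lemma r_min_less_iff:
  assumes A: "A \<in> carrier_mat N N" and N: "N \<ge> 1"
  shows "r_min A < r \<longleftrightarrow> (\<exists>z\<in>ball 0 r. poly (char_poly A) z = 0)"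
proof -
  have "finite (cmod ` spectrum A)" "cmod ` spectrum A \<noteq> {}"
    using card_finite_spectrum(1)[OF A] spectrum_non_empty[OF A] N by auto
  then have "r_min A < r \<longleftrightarrow> (\<exists>x\<in>cmod ` spectrum A. x < r)"
    unfolding r_min_def by (rule Min_less_iff)
  then show ?thesis unfolding spectrum_root_char_poly[OF A] by auto
qed

lemma mat_adjoint_eq:
  assumes "A \<in> carrier_mat N N"
  shows "mat_adjoint A = Matrix.mat N N (\<lambda>(i, j). cnj (A $$ (j, i)))"
  using assms by (intro eq_matI) (auto simp: mat_adjoint_def mat_of_rows_index)

lemma mat_trace_adjoint_mult:
  assumes A: "A \<in> carrier_mat N N"
  shows "Re (mat_trace (mat_adjoint A * A)) = frob N (($$) A)"
proof -
  have "mat_trace (mat_adjoint A * A) = (\<Sum>i<N. \<Sum>k<N. cnj (A $$ (k, i)) * A $$ (k, i))"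
    unfolding mat_trace_def mat_adjoint_eq[OF A]
    using A by (auto simp: scalar_prod_def atLeast0LessThan intro!: sum.cong)
  also have "\<dots> = complex_of_real (frob N (($$) A))"
    unfolding frob_columns of_real_sum complex_norm_square by (simp add: mult.commute)
  finally show ?thesis by simp
qed

lemma det_adjoint_mult:
  assumes A: "A \<in> carrier_mat N N"
  shows "Determinant.det (mat_adjoint A * A) = complex_of_real ((cmod (Determinant.det A))\<^sup>2)"
proof -
  have "Determinant.det (mat_adjoint A) = Determinant.det (transpose_mat (Matrix.mat N N (\<lambda>p. cnj (A $$ p))))"
    unfolding mat_adjoint_eq[OF A] by (rule arg_cong[where f = Determinant.det]) (auto intro!: eq_matI)
  also have "\<dots> = Determinant.det (Matrix.mat N N (\<lambda>p. cnj (A $$ p)))" by (rule det_transpose[OF mat_carrier])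
  also have "\<dots> = cnj (Determinant.det A)"
    unfolding det_def'[OF A] det_def'[OF mat_carrier]
    by (auto intro!: sum.cong prod.cong simp: sign_def permutes_in_image)
  finally have "Determinant.det (mat_adjoint A) = cnj (Determinant.det A)" .
  moreover have "mat_adjoint A \<in> carrier_mat N N" unfolding mat_adjoint_eq[OF A] by simp
  ultimately show ?thesis using det_mult[OF _ A, of "mat_adjoint A"] complex_norm_square[of "Determinant.det A"]
    by (simp add: mult.commute)
qed

lemma induced_ginibre_weight_0:
  assumes A: "A \<in> carrier_mat N N"
  shows "induced_ginibre_weight 0 A = (if Determinant.det A = 0 then 0 else exp (- frob N (($$) A)))"
  unfolding induced_ginibre_weight_def det_adjoint_mult[OF A] mat_trace_adjoint_mult[OF A] by simp

text \<open>A singular matrix has the eigenvalue 0, which lies in every disc of positive radius.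
  Hence on the hole set the weight with L = 0 is the plain Gaussian, in spite of
  \<open>0 powr 0 = 0\<close>.\<close>

lemma hole_set_det:
  assumes X: "X \<in> hole_set N r" and r: "0 < r"
  shows "Determinant.det (Matrix.mat N N X) \<noteq> 0"
proof -
  have "poly (chi N X) 0 \<noteq> 0" using X r by (simp add: hole_set_def)
  moreover have "Matrix.mat N N (\<lambda>(i, j). (if i = j then 0 else 0) - X (i, j)) = - Matrix.mat N N X"
    by (rule eq_matI) auto
  ultimately have "Determinant.det (- Matrix.mat N N X) \<noteq> 0" by (simp add: poly_char_poly_mat)
  then show ?thesis using det_0_negate[of "Matrix.mat N N X" N] by simp
qed

lemma image_hole_set:
  "Matrix.mat N N ` hole_set N r = {A \<in> carrier_mat N N. \<forall>z\<in>ball 0 r. poly (char_poly A) z \<noteq> 0}"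
proof (intro subset_antisym subsetI)
  fix A :: "complex mat" assume A: "A \<in> {A \<in> carrier_mat N N. \<forall>z\<in>ball 0 r. poly (char_poly A) z \<noteq> 0}"
  let ?f = "restrict (($$) A) (grid N)"
  have e: "Matrix.mat N N ?f = A" using A by (intro eq_matI) auto
  moreover have "?f \<in> hole_set N r"
    using A e unfolding hole_set_def by (auto simp: space_PiM)
  ultimately show "A \<in> Matrix.mat N N ` hole_set N r" by (metis imageI)
qed (auto simp: hole_set_def)

text \<open>For use in fixing the normalising constant of the induced ensemble, of which the
  definition asserts only the existence.\<close>

lemma hole_prob_tendsto_1:
  assumes "0 < N"
  shows "((\<lambda>r. hole_prob N r) \<longlongrightarrow> 1) (at_right 0)"
proof -
  have "((\<lambda>r. hole_prob N r - exp (- r\<^sup>2)) \<longlongrightarrow> 0) (at_right 0)"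
  proof (rule tendsto_0_le[where K = "1 + 2 * pi * exp 5"])
    show "((\<lambda>r :: real. r ^ 4) \<longlongrightarrow> 0) (at_right 0)" by (rule tendsto_eq_intros | simp)+
    show "\<forall>\<^sub>F r in at_right 0. norm (hole_prob N r - exp (- r\<^sup>2)) \<le> norm (r ^ 4) * (1 + 2 * pi * exp 5)"
      using hole_prob_bound[OF _ _ assms]
      by (intro eventually_at_rightI[of 0 "1 / 2"]) (simp_all add: mult.commute)
  qed
  moreover have "((\<lambda>r :: real. exp (- r\<^sup>2)) \<longlongrightarrow> 1) (at_right 0)"
    by (rule tendsto_eq_intros | simp)+
  ultimately have "((\<lambda>r. hole_prob N r - exp (- r\<^sup>2) + exp (- r\<^sup>2)) \<longlongrightarrow> 0 + 1) (at_right 0)"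
    by (rule tendsto_add)
  then show ?thesis by simp
qed

text \<open>On the hole set the density is a multiple of the Gaussian, so
  \<open>gaussian_hole_prob\<close> evaluates its probability; the event in question is the
  complement.\<close>

lemma induced_ginibre_r_min:
  assumes G: "induced_ginibre M N 0 G" and N: "N \<ge> 1" and r: "0 < r"
  shows "measure M {\<omega> \<in> space M. r_min (G \<omega>) < r} = 1 - hole_prob N r"
proof -
  interpret prob_space M using G by (simp add: induced_ginibre_def)
  obtain c where c: "c > 0" and d: "distributed M (lborel_mat N) G (\<lambda>X. ennreal (c * induced_ginibre_weight 0 X))"
    using G by (auto simp: induced_ginibre_def)
  let ?E = "\<lambda>r. Matrix.mat N N ` hole_set N r"
  have E: "?E r \<in> sets (lborel_mat N)" for r
    unfolding lborel_mat_def by (rule in_sets_embed_measure) (rule hole_set_measurable)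
  have fm: "(\<lambda>X. ennreal (c * induced_ginibre_weight 0 X)) \<in> borel_measurable (lborel_mat N)"
    using d by (simp add: distributed_def)
  have nn: "(\<integral>\<^sup>+X. g X \<partial>lborel_mat N) = (\<integral>\<^sup>+x. g (Matrix.mat N N x) \<partial>lebesgue_fun (grid N))"
    if "g \<in> borel_measurable (lborel_mat N)" for g
    using that unfolding lborel_mat_def by (intro nn_integral_embed_measure' inj_on_mat_entries)
  have em: "(\<lambda>x. ennreal (exp (- frob N x))) \<in> borel_measurable (lebesgue_fun (grid N))"
    by (rule measurable_compose[OF measurable_frob_grid]) measurable
  have prob: "emeasure M (G -` ?E r \<inter> space M) = ennreal (c * pi ^ (N * N) * hole_prob N r)" if r: "0 < r" for r
  proof -
    have "emeasure M (G -` ?E r \<inter> space M) = (\<integral>\<^sup>+X. ennreal (c * induced_ginibre_weight 0 X) * indicator (?E r) X \<partial>lborel_mat N)"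
      by (rule distributed_emeasure[OF d E])
    also have "\<dots> = (\<integral>\<^sup>+x. ennreal (c * induced_ginibre_weight 0 (Matrix.mat N N x)) * indicator (?E r) (Matrix.mat N N x) \<partial>lebesgue_fun (grid N))"
      using fm E by (intro nn) auto
    also have "\<dots> = (\<integral>\<^sup>+x. ennreal c * (ennreal (exp (- frob N x)) * indicator (hole_set N r) x) \<partial>lebesgue_fun (grid N))"
    proof (rule nn_integral_cong)
      fix x assume x: "x \<in> space (lebesgue_fun (grid N))"
      have "Matrix.mat N N x \<in> ?E r \<longleftrightarrow> x \<in> hole_set N r"
        unfolding image_hole_set using x by (auto simp: hole_set_def)
      then show "ennreal (c * induced_ginibre_weight 0 (Matrix.mat N N x)) * indicator (?E r) (Matrix.mat N N x)
          = ennreal c * (ennreal (exp (- frob N x)) * indicator (hole_set N r) x)"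
        using hole_set_det[OF _ r, of x N] c
        by (auto simp: induced_ginibre_weight_0[OF mat_carrier] indicator_def ennreal_mult')
    qed
    also have "\<dots> = ennreal c * (ennreal (hole_prob N r) * ennreal (pi ^ (N * N)))"
      unfolding gaussian_hole_prob[symmetric]
      by (intro nn_integral_cmult borel_measurable_times_ennreal em borel_measurable_indicator hole_set_measurable)
    also have "\<dots> = ennreal (c * pi ^ (N * N) * hole_prob N r)"
      using c hole_prob_nonneg[of N r] by (simp add: ennreal_mult'[symmetric] mult_ac)
    finally show ?thesis .
  qed
  \<comment> \<open>From above: hole probabilities are at most 1, and \<open>hole_prob N r\<close>
    tends to 1 as r tends to 0. From below: the weight is at most the Gaussian, so total mass 1
    forces \<open>c * pi ^ (N * N)\<close> to be at least 1.\<close>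
  have c1: "c * pi ^ (N * N) = 1"
  proof (rule antisym)
    have "c * pi ^ (N * N) * hole_prob N r \<le> 1" if "0 < r" for r
    proof -
      have "ennreal (c * pi ^ (N * N) * hole_prob N r) \<le> 1"
        unfolding prob[OF that, symmetric] by (rule measure_le_1)
      then show ?thesis by simp
    qed
    then have ev: "\<forall>\<^sub>F r in at_right 0. c * pi ^ (N * N) * hole_prob N r \<le> 1"
      by (intro eventually_at_rightI[of 0 1]) auto
    have "((\<lambda>r. c * pi ^ (N * N) * hole_prob N r) \<longlongrightarrow> c * pi ^ (N * N) * 1) (at_right 0)"
      using hole_prob_tendsto_1[of N] N by (intro tendsto_mult_left) auto
    from tendsto_upperbound[OF this ev] show "c * pi ^ (N * N) \<le> 1" by simp
  next
    have "1 = emeasure M (G -` carrier_mat N N \<inter> space M)"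
    proof -
      have "G -` carrier_mat N N \<inter> space M = space M"
        using measurable_space[OF distributed_measurable[OF d]] by (auto simp: space_lborel_mat)
      then show ?thesis by (simp add: emeasure_space_1)
    qed
    also have "\<dots> = (\<integral>\<^sup>+X. ennreal (c * induced_ginibre_weight 0 X) * indicator (carrier_mat N N) X \<partial>lborel_mat N)"
      unfolding space_lborel_mat[symmetric] by (rule distributed_emeasure[OF d]) simp
    also have "\<dots> = (\<integral>\<^sup>+X. ennreal (c * induced_ginibre_weight 0 X) \<partial>lborel_mat N)"
      by (rule nn_integral_cong) (simp add: space_lborel_mat)
    also have "\<dots> = (\<integral>\<^sup>+x. ennreal (c * induced_ginibre_weight 0 (Matrix.mat N N x)) \<partial>lebesgue_fun (grid N))"
      by (rule nn[OF fm])
    also have "\<dots> \<le> (\<integral>\<^sup>+x. ennreal c * ennreal (exp (- frob N x)) \<partial>lebesgue_fun (grid N))"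
      using c by (intro nn_integral_mono) (auto simp: induced_ginibre_weight_0[OF mat_carrier] ennreal_mult'[symmetric] intro!: ennreal_leI)
    also have "\<dots> = ennreal c * ennreal (pi ^ (N * N))"
      unfolding nn_integral_exp_frob[symmetric] by (rule nn_integral_cmult[OF em])
    finally have "1 \<le> ennreal (c * pi ^ (N * N))" using c by (simp add: ennreal_mult')
    then show "1 \<le> c * pi ^ (N * N)"
      using c by (simp add: ennreal_1[symmetric] ennreal_le_iff del: ennreal_1)
  qed
  have m: "measure M (G -` ?E r \<inter> space M) = hole_prob N r"
    using prob[OF r] hole_prob_nonneg[of N r] by (simp add: c1 measure_def)
  have ev: "G -` ?E r \<inter> space M \<in> sets M"
    using measurable_sets[OF distributed_measurable[OF d] E] .
  have "{\<omega> \<in> space M. r_min (G \<omega>) < r} = space M - (G -` ?E r \<inter> space M)"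
  proof -
    have "r_min (G \<omega>) < r \<longleftrightarrow> G \<omega> \<notin> ?E r" if "\<omega> \<in> space M" for \<omega>
    proof -
      have "G \<omega> \<in> carrier_mat N N"
        using measurable_space[OF distributed_measurable[OF d] that] by (simp add: space_lborel_mat)
      then show ?thesis unfolding image_hole_set using r_min_less_iff[of "G \<omega>" N r] N by auto
    qed
    then show ?thesis by auto
  qed
  then show ?thesis using prob_compl[OF ev] m by simp
qed

text \<open>Both measures give a box the product of its one-coordinate masses, and a finite product
  measure is determined by boxes.\<close>

lemma PiM_density:
  fixes f :: "complex \<Rightarrow> ennreal"
  assumes I: "finite I" and f: "f \<in> borel_measurable borel" and one: "(\<integral>\<^sup>+w. f w \<partial>lborel) = 1"
  shows "Pi\<^sub>M I (\<lambda>_. density lborel f) = density (lebesgue_fun I) (\<lambda>x. \<Prod>i\<in>I. f (x i))"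
proof -
  have ps: "prob_space (density lborel f)"
    using f one by (intro prob_spaceI) (simp add: emeasure_density)
  interpret pf: product_sigma_finite "\<lambda>_. density lborel f"
    using ps by (intro product_sigma_finite.intro prob_space_imp_sigma_finite)
  have comp: "(\<lambda>x. f (x i)) \<in> borel_measurable (lebesgue_fun I)" if "i \<in> I" for i
    using measurable_compose[OF measurable_component_singleton[OF that, of "\<lambda>_. lborel"]] f by simp
  have pm: "(\<lambda>x. \<Prod>i\<in>I. f (x i)) \<in> borel_measurable (lebesgue_fun I)"
    using comp by (rule borel_measurable_prod_ennreal)
  have sets: "sets (density (lebesgue_fun I) (\<lambda>x. \<Prod>i\<in>I. f (x i))) = sets (Pi\<^sub>M I (\<lambda>_. density lborel f))"
    unfolding sets_density by (intro sets_PiM_cong) auto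
  show ?thesis
  proof (rule pf.PiM_eqI[OF I sets, symmetric])
    fix A assume "\<And>i. i \<in> I \<Longrightarrow> A i \<in> sets (density lborel f)"
    then have A: "\<And>i. i \<in> I \<Longrightarrow> A i \<in> sets borel" by simp
    have E: "Pi\<^sub>E I A \<in> sets (lebesgue_fun I)" using A I by (intro sets_PiM_I_finite) auto
    have "emeasure (density (lebesgue_fun I) (\<lambda>x. \<Prod>i\<in>I. f (x i))) (Pi\<^sub>E I A)
        = (\<integral>\<^sup>+x. (\<Prod>i\<in>I. f (x i)) * indicator (Pi\<^sub>E I A) x \<partial>lebesgue_fun I)"
      by (rule emeasure_density[OF pm E])
    also have "\<dots> = (\<integral>\<^sup>+x. (\<Prod>i\<in>I. f (x i) * indicator (A i) (x i)) \<partial>lebesgue_fun I)"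
    proof (rule nn_integral_cong)
      fix x assume x: "x \<in> space (lebesgue_fun I)"
      have "(indicator (Pi\<^sub>E I A) x :: ennreal) = (\<Prod>i\<in>I. indicator (A i) (x i))"
      proof (cases "x \<in> Pi\<^sub>E I A")
        case False
        then obtain i where "i \<in> I" "x i \<notin> A i" using x by (auto simp: space_PiM PiE_iff)
        then have "(\<Prod>i\<in>I. indicator (A i) (x i)) = (0 :: ennreal)"
          using I by (intro prod_zero) (auto intro!: bexI[of _ i])
        then show ?thesis using False by simp
      qed (auto simp: PiE_iff)
      then show "(\<Prod>i\<in>I. f (x i)) * indicator (Pi\<^sub>E I A) x = (\<Prod>i\<in>I. f (x i) * indicator (A i) (x i))"
        by (simp add: prod.distrib)
    qed
    also have "\<dots> = (\<Prod>i\<in>I. \<integral>\<^sup>+w. f w * indicator (A i) w \<partial>lborel)"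
      using f A by (intro lborel_prod.product_nn_integral_prod[OF I]) auto
    also have "\<dots> = (\<Prod>i\<in>I. emeasure (density lborel f) (A i))"
      using f A by (intro prod.cong refl) (simp add: emeasure_density)
    finally show "emeasure (density (lebesgue_fun I) (\<lambda>x. \<Prod>i\<in>I. f (x i))) (Pi\<^sub>E I A)
        = (\<Prod>i\<in>I. emeasure (density lborel f) (A i))" .
  qed
qed

text \<open>By independence the joint law of the entries is the product of the entry laws, whose
  density is the Gaussian divided by \<open>pi ^ (N * N)\<close>. So
  \<open>gaussian_hole_prob\<close> gives the same value as for the induced ensemble with L =
  0.\<close>

lemma ginibre_r_min:
  assumes A: "ginibre M N A" and N: "N \<ge> 1"
  shows "measure M {\<omega> \<in> space M. r_min (A \<omega>) < r} = 1 - hole_prob N r"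
proof -
  interpret prob_space M using A by (simp add: ginibre_def)
  let ?X = "\<lambda>p \<omega>. A \<omega> $$ p"
  let ?f = "\<lambda>w. ennreal (exp (- (cmod w)\<^sup>2) / pi)"
  have carr: "A \<omega> \<in> carrier_mat N N" if "\<omega> \<in> space M" for \<omega> using A that by (auto simp: ginibre_def)
  have "(\<lambda>(i, j) \<omega>. A \<omega> $$ (i, j)) = ?X" by (auto simp: fun_eq_iff)
  then have ind: "indep_vars (\<lambda>_. borel) ?X (grid N)"
    using A unfolding ginibre_def by metis
  have dist: "distributed M lborel (?X p) ?f" if "p \<in> grid N" for p using A that by (auto simp: ginibre_def)
  have rv: "random_variable borel (?X p)" if "p \<in> grid N" for p
    using distributed_measurable[OF dist[OF that]] by simp
  have ne: "grid N \<noteq> {}" using N by (auto simp: lessThan_empty_iff)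
  let ?T = "\<lambda>\<omega>. \<lambda>p\<in>grid N. ?X p \<omega>"
  have Tm: "?T \<in> M \<rightarrow>\<^sub>M lebesgue_fun (grid N)"
    by (rule measurable_restrict) (use rv in simp)
  have one: "(\<integral>\<^sup>+w. ?f w \<partial>lborel) = 1"
  proof -
    have "(\<integral>\<^sup>+w. ?f w \<partial>lborel) = (\<integral>\<^sup>+w. ennreal (1 / pi) * ennreal (exp (- (cmod w)\<^sup>2)) \<partial>lborel)"
      by (rule nn_integral_cong) (simp add: ennreal_mult'[symmetric])
    also have "\<dots> = ennreal (1 / pi) * ennreal pi"
      unfolding nn_integral_complex_gaussian[symmetric] by (rule nn_integral_cmult) simp
    also have "\<dots> = 1" by (simp add: ennreal_mult'[symmetric])
    finally show ?thesis .
  qed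
  have cong: "sets (lebesgue_fun (grid N)) = sets (Pi\<^sub>M (grid N) (\<lambda>_. borel :: complex measure))"
    by (intro sets_PiM_cong) auto
  have joint: "distr M (lebesgue_fun (grid N)) ?T = density (lebesgue_fun (grid N)) (\<lambda>x. \<Prod>p\<in>grid N. ?f (x p))"
  proof -
    have "distr M (lebesgue_fun (grid N)) ?T = distr M (Pi\<^sub>M (grid N) (\<lambda>_. borel)) ?T"
      by (rule distr_cong[OF refl cong refl])
    also have "\<dots> = Pi\<^sub>M (grid N) (\<lambda>p. distr M borel (?X p))"
      using indep_vars_iff_distr_eq_PiM'[where M' = "\<lambda>_. borel" and X = ?X, OF ne rv] ind by blast
    also have "\<dots> = Pi\<^sub>M (grid N) (\<lambda>p. density lborel ?f)"
    proof (rule PiM_cong[OF refl])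
      fix p assume "p \<in> grid N"
      from distributed_distr_eq_density[OF dist[OF this]]
      have "distr M lborel (?X p) = density lborel ?f" .
      moreover have "distr M lborel (?X p) = distr M borel (?X p)" by (rule distr_cong) simp_all
      ultimately show "distr M borel (?X p) = density lborel ?f" by simp
    qed
    also have "\<dots> = density (lebesgue_fun (grid N)) (\<lambda>x. \<Prod>p\<in>grid N. ?f (x p))"
      by (rule PiM_density[OF _ _ one]) auto
    finally show ?thesis .
  qed
  have fe: "(\<Prod>p\<in>grid N. ?f (x p)) = ennreal (1 / pi ^ (N * N)) * ennreal (exp (- frob N x))" for x
  proof -
    have "(\<Prod>p\<in>grid N. ?f (x p)) = ennreal (\<Prod>p\<in>grid N. exp (- (cmod (x p))\<^sup>2) / pi)"
      by (rule prod_ennreal) simp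
    also have "(\<Prod>p\<in>grid N. exp (- (cmod (x p))\<^sup>2) / pi) = exp (- frob N x) / pi ^ (N * N)"
      by (simp add: prod_dividef frob_def sum_negf[symmetric] exp_sum)
    also have "ennreal (exp (- frob N x) / pi ^ (N * N)) = ennreal (1 / pi ^ (N * N)) * ennreal (exp (- frob N x))"
      by (simp add: ennreal_mult'[symmetric])
    finally show ?thesis .
  qed
  have em: "(\<lambda>x. ennreal (exp (- frob N x))) \<in> borel_measurable (lebesgue_fun (grid N))"
    by (rule measurable_compose[OF measurable_frob_grid]) measurable
  let ?E = "?T -` hole_set N r \<inter> space M"
  have "emeasure M ?E = emeasure (distr M (lebesgue_fun (grid N)) ?T) (hole_set N r)"
    by (rule emeasure_distr[OF Tm hole_set_measurable, symmetric])
  also have "\<dots> = (\<integral>\<^sup>+x. (ennreal (1 / pi ^ (N * N)) * ennreal (exp (- frob N x))) * indicator (hole_set N r) x \<partial>lebesgue_fun (grid N))"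
    unfolding joint fe
    by (rule emeasure_density[OF borel_measurable_times_ennreal[OF borel_measurable_const em] hole_set_measurable])
  also have "\<dots> = ennreal (1 / pi ^ (N * N)) * (ennreal (hole_prob N r) * ennreal (pi ^ (N * N)))"
    unfolding gaussian_hole_prob[symmetric] mult.assoc
    by (intro nn_integral_cmult borel_measurable_times_ennreal em borel_measurable_indicator hole_set_measurable)
  also have "\<dots> = ennreal (hole_prob N r)"
    using hole_prob_nonneg[of N r] by (simp add: ennreal_mult'[symmetric])
  finally have m: "measure M ?E = hole_prob N r"
    using hole_prob_nonneg[of N r] by (simp add: measure_def)
  have ev: "?E \<in> sets M" using measurable_sets[OF Tm hole_set_measurable] .
  have "{\<omega> \<in> space M. r_min (A \<omega>) < r} = space M - ?E"
  proof -
    have "r_min (A \<omega>) < r \<longleftrightarrow> ?T \<omega> \<notin> hole_set N r" if "\<omega> \<in> space M" for \<omega>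
    proof -
      have c: "A \<omega> \<in> carrier_mat N N" by (rule carr[OF that])
      then have e: "Matrix.mat N N (?T \<omega>) = A \<omega>" by (intro eq_matI) auto
      have "?T \<omega> \<in> space (lebesgue_fun (grid N))" by (auto simp: space_PiM)
      then have "?T \<omega> \<in> hole_set N r \<longleftrightarrow> (\<forall>z\<in>ball 0 r. poly (char_poly (A \<omega>)) z \<noteq> 0)"
        unfolding hole_set_def e mem_Collect_eq by blast
      then show ?thesis using r_min_less_iff[OF c N, of r] by blast
    qed
    then show ?thesis by auto
  qed
  then show ?thesis using prob_compl[OF ev] m by simp
qed

theorem corollary13:
  fixes MG :: "nat \<Rightarrow> 'a measure" and G :: "nat \<Rightarrow> 'a \<Rightarrow> complex mat"
    and MA :: "nat \<Rightarrow> 'b measure" and A :: "nat \<Rightarrow> 'b \<Rightarrow> complex mat"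
  assumes "\<And>N. N \<ge> 1 \<Longrightarrow> induced_ginibre (MG N) N 0 (G N)"
    and "\<And>N. N \<ge> 1 \<Longrightarrow> ginibre (MA N) N (A N)"
  shows "\<exists>F :: real \<Rightarrow> real.
    (\<forall>\<^sub>F r in at_right 0.
       (\<lambda>N. measure (MG N) {\<omega> \<in> space (MG N). r_min (G N \<omega>) < r}) \<longlonglongrightarrow> F r \<and>
       (\<lambda>N. measure (MA N) {\<omega> \<in> space (MA N). r_min (A N \<omega>) < r}) \<longlonglongrightarrow> F r) \<and>
    (\<lambda>r. F r - (1 - exp (- r\<^sup>2))) \<in> O[at_right 0](\<lambda>r. r ^ 4)"
proof (intro exI conjI)
  \<comment> \<open>The limit exists because \<open>hole_prob N r\<close> decreases in N. For 0 < r
    and N \<ge> 1 both probabilities equal \<open>1 - hole_prob N r\<close>, so the witness F = 1 -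
    L serves both ensembles.\<close>
  define L where "L r = lim (\<lambda>N. hole_prob N r)" for r
  have L: "(\<lambda>N. hole_prob N r) \<longlonglongrightarrow> L r" for r
    unfolding L_def using hole_prob_convergent by (simp add: convergent_LIMSEQ_iff)
  then have L1: "(\<lambda>N. 1 - hole_prob N r) \<longlonglongrightarrow> 1 - L r" for r
    by (intro tendsto_diff tendsto_const)
  show "\<forall>\<^sub>F r in at_right 0.
       (\<lambda>N. measure (MG N) {\<omega> \<in> space (MG N). r_min (G N \<omega>) < r}) \<longlonglongrightarrow> 1 - L r \<and>
       (\<lambda>N. measure (MA N) {\<omega> \<in> space (MA N). r_min (A N \<omega>) < r}) \<longlonglongrightarrow> 1 - L r"
  proof (rule eventually_at_rightI[of 0 1])
    fix r :: real assume r: "r \<in> {0<..<1}"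
    have "\<forall>\<^sub>F N in sequentially. 1 - hole_prob N r = measure (MG N) {\<omega> \<in> space (MG N). r_min (G N \<omega>) < r}"
      using eventually_ge_at_top[of 1] by eventually_elim (use induced_ginibre_r_min[OF assms(1)] r in simp)
    moreover have "\<forall>\<^sub>F N in sequentially. 1 - hole_prob N r = measure (MA N) {\<omega> \<in> space (MA N). r_min (A N \<omega>) < r}"
      using eventually_ge_at_top[of 1] by eventually_elim (use ginibre_r_min[OF assms(2)] in simp)
    ultimately show "(\<lambda>N. measure (MG N) {\<omega> \<in> space (MG N). r_min (G N \<omega>) < r}) \<longlonglongrightarrow> 1 - L r \<and>
       (\<lambda>N. measure (MA N) {\<omega> \<in> space (MA N). r_min (A N \<omega>) < r}) \<longlonglongrightarrow> 1 - L r"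
      using L1[of r] by (blast intro: Lim_transform_eventually)
  qed simp
  show "(\<lambda>r. 1 - L r - (1 - exp (- r\<^sup>2))) \<in> O[at_right 0](\<lambda>r. r ^ 4)"
  proof (rule bigoI[where c = "1 + 2 * pi * exp 5"], rule eventually_at_rightI[of 0 "1 / 2"])
    fix r :: real assume r: "r \<in> {0<..<1 / 2}"
    \<comment> \<open>The bound holds with one constant for all N \<ge> 1, so it passes to the
      limit.\<close>
    have "(\<lambda>N. \<bar>hole_prob N r - exp (- r\<^sup>2)\<bar>) \<longlonglongrightarrow> \<bar>L r - exp (- r\<^sup>2)\<bar>"
      by (intro tendsto_intros L)
    then have "\<bar>L r - exp (- r\<^sup>2)\<bar> \<le> (1 + 2 * pi * exp 5) * r ^ 4"
    proof (rule tendsto_upperbound)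
      show "\<forall>\<^sub>F N in sequentially. \<bar>hole_prob N r - exp (- r\<^sup>2)\<bar> \<le> (1 + 2 * pi * exp 5) * r ^ 4"
        using eventually_gt_at_top[of 0] by eventually_elim (use hole_prob_bound[of r] r in auto)
    qed simp
    moreover have "norm (1 - L r - (1 - exp (- r\<^sup>2))) = \<bar>L r - exp (- r\<^sup>2)\<bar>"
      by (simp add: abs_minus_commute)
    moreover have "norm (r ^ 4) = r ^ 4" by simp
    ultimately show "norm (1 - L r - (1 - exp (- r\<^sup>2))) \<le> (1 + 2 * pi * exp 5) * norm (r ^ 4)" by simp
  qed simp
qed

end
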